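(* Let $p>1$ and let $X$ be a closed connected surface of negative Euler characteristic with a triangulation $\mathcal{T}=(V,E,F)$, $N=|V|$, and a weight $\Phi:E\to[0,\pi/2]$. For any initial circle packing metric $r(0)\in\mathbb{R}^N_{>0}$, the solution $r(t)$ to the combinatorial $p$-th Calabi flow in hyperbolic background geometry, $$\frac{dr_i}{dt}=(\Delta_pK_i-A_iK_i)\sinh r_i,\qquad i=1,\dots,N,$$ with initial value $r(0)$, exists for all $t\in[0,+\infty)$. Additionally, $r(t)$ converges (to a point of $\mathbb{R}^N_{>0}$, as $t\to+\infty$) if and only if there exists a zero curvature circle packing metric $r_{ze}$ (in hyperbolic background geometry) on $(X,\mathcal{T},\Phi)$.
   Context: Setting: $X$ is a closed surface with a triangulation $\mathcal{T}=(V,E,F)$ (vertices, edges, faces), $V=\{v_1,\dots,v_N\}$, and weight $\Phi:E\to[0,\pi/2]$, $\Phi_{ij}=\Phi(\{i,j\})$. Write $j\sim i$ if $v_i,v_j$ are adjacent. A circle packing metric is a positive function $r:V\to(0,+\infty)$, $v_i\mapsto r_i$, regarded as a point $r\in\mathbb{R}^N_{>0}$. In hyperbolic background geometry, $r$ assigns to each edge $\{i,j\}\in E$ the length $l_{ij}=\cosh^{-1}(\cosh r_i\cosh r_j+\sinh r_i\sinh r_j\cos\Phi_{ij})$; for each face $\{i,j,k\}\in F$ the three lengths satisfy the triangle inequalities, so the face is a hyperbolic triangle $\triangle v_iv_jv_k$ (in the hyperbolic plane of curvature $-1$). Let $\theta_i^{jk}$ be its inner angle at $v_i$ and $\mathrm{Area}(\triangle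 v_iv_jv_k)$ its hyperbolic area. The combinatorial Gauss curvature at $v_i$ is $K_i=2\pi-\sum_{\{i,j,k\}\in F}\theta_i^{jk}$, the sum being over all faces having $v_i$ as a vertex. A zero curvature circle packing metric $r_{ze}$ is a circle packing metric with $K_i=0$ for all $i$. For an edge $\{i,j\}$, let $k,l$ be the two vertices such that $\{i,j,k\},\{i,j,l\}$ are the two faces containing the edge, and set $$B_{ij}=\frac{\partial(\theta_i^{jk}+\theta_i^{jl})}{\partial r_j}\sinh r_j,\qquad A_i=\sinh r_i\,\frac{\partial}{\partial r_i}\Big(\sum_{\{i,j,k\}\in F}\mathrm{Area}(\triangle v_iv_jv_k)\Big).$$ The discrete $p$-Laplace operator is, for $f\in\mathbb{R}^N$, $$\Delta_pf_i=\sum_{j\sim i}B_{ij}|f_j-f_i|^{p-2}(f_j-f_i),$$ where $|x|^{p-2}x$ is read as $0$ when $x=0$. In the flow, $K_i$, $B_{ij}$, $A_i$ are evaluated at $r(t)$. *)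

theory Defs
  imports "HOL-Analysis.Analysis"
begin

section \<open>Triangulated closed surfaces\<close>

definition closed_surface :: "'a topology \<Rightarrow> bool" where
  "closed_surface X \<longleftrightarrow>
     compact_space X \<and> Hausdorff_space X \<and>
     (\<forall>x \<in> topspace X. \<exists>U. openin X U \<and> x \<in> U \<and>
        (\<exists>W :: (real^2) set. open W \<and>
           subtopology X U homeomorphic_space top_of_set W))"

text \<open>
  The vertex set is the whole finite type \<open>'v\<close>, and a triangulation is
  given by its set \<open>F\<close> of faces, each face being a set of three vertices.
  The edges are the two-element subsets of faces. The complex is realized in
  the simplex of \<open>real^'v\<close> whose corners are the standard basis vectors.
\<close>

definition edges :: "'v set set \<Rightarrow> 'v set set" where
  "edges F = {e. card e = 2 \<and> (\<exists>f \<in> F. e \<subseteq> f)}"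

definition geometric_realization :: "'v::finite set set \<Rightarrow> (real^'v) set" where
  "geometric_realization F = (\<Union>f \<in> F. convex hull ((\<lambda>i. axis i 1) ` f))"

definition triangulates :: "'v::finite set set \<Rightarrow> 'a topology \<Rightarrow> bool" where
  "triangulates F X \<longleftrightarrow>
     (\<forall>f \<in> F. card f = 3) \<and> \<Union>F = UNIV \<and>
     top_of_set (geometric_realization F) homeomorphic_space X"

definition euler_characteristic :: "'v::finite set set \<Rightarrow> int" where
  "euler_characteristic F = int CARD('v) - int (card (edges F)) + int (card F)"


section \<open>The hyperbolic plane\<close>

text \<open>
  We use the Beltrami--Klein model of the plane of curvature \<open>-1\<close>: the
  points are those of the open unit disc and geodesics are straight segments, so
  that the triangle with given vertices is their convex hull.
  The function \<open>klein_metric x\<close> is the Riemannian metric on the tangent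
  space at \<open>x\<close>, whose Gram determinant is \<open>(1 - |x|^2)^(-3)\<close>; the
  area element is the square root of this determinant.
\<close>

definition klein_dist :: "real^2 \<Rightarrow> real^2 \<Rightarrow> real" where
  "klein_dist x y =
     arcosh ((1 - x \<bullet> y) / (sqrt (1 - (norm x)\<^sup>2) * sqrt (1 - (norm y)\<^sup>2)))"

definition klein_metric :: "real^2 \<Rightarrow> real^2 \<Rightarrow> real^2 \<Rightarrow> real" where
  "klein_metric x v w =
     (v \<bullet> w) / (1 - (norm x)\<^sup>2) + (x \<bullet> v) * (x \<bullet> w) / (1 - (norm x)\<^sup>2)\<^sup>2"

text \<open>The angle at \<open>x\<close> between the geodesic segments to \<open>y\<close> and \<open>z\<close>.\<close>

definition klein_angle :: "real^2 \<Rightarrow> real^2 \<Rightarrow> real^2 \<Rightarrow> real" where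
  "klein_angle x y z =
     arccos (klein_metric x (y - x) (z - x) /
       (sqrt (klein_metric x (y - x) (y - x)) * sqrt (klein_metric x (z - x) (z - x))))"

definition klein_area :: "(real^2) set \<Rightarrow> real" where
  "klein_area S = integral S (\<lambda>x. (1 - (norm x)\<^sup>2) powr (- 3 / 2))"


section \<open>Circle packing metrics and curvature\<close>

definition circle_packing_metric :: "real^'v \<Rightarrow> bool" where
  "circle_packing_metric r \<longleftrightarrow> (\<forall>i. r $ i > 0)"

definition edge_length :: "('v set \<Rightarrow> real) \<Rightarrow> real^'v \<Rightarrow> 'v \<Rightarrow> 'v \<Rightarrow> real" where
  "edge_length \<Phi> r i j =
     arcosh (cosh (r $ i) * cosh (r $ j) + sinh (r $ i) * sinh (r $ j) * cos (\<Phi> {i, j}))"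

definition realizes_face ::
    "('v set \<Rightarrow> real) \<Rightarrow> real^'v \<Rightarrow> 'v set \<Rightarrow> ('v \<Rightarrow> real^2) \<Rightarrow> bool" where
  "realizes_face \<Phi> r f P \<longleftrightarrow>
     (\<forall>i \<in> f. norm (P i) < 1) \<and>
     (\<forall>i \<in> f. \<forall>j \<in> f. i \<noteq> j \<longrightarrow> klein_dist (P i) (P j) = edge_length \<Phi> r i j)"

text \<open>
  Triangles with the same side lengths are congruent, so their angles and area do
  not depend on the realization \<open>P\<close>. The definite descriptions below are meant
  for \<open>card f = 3\<close>, \<open>i \<in> f\<close>, a circle packing metric \<open>r\<close> and
  weights in \<open>[0, pi/2]\<close>.
\<close>

definition inner_angle :: "('v set \<Rightarrow> real) \<Rightarrow> real^'v \<Rightarrow> 'v set \<Rightarrow> 'v \<Rightarrow> real" where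
  "inner_angle \<Phi> r f i =
     (THE \<theta>. \<exists>P j k. f = {i, j, k} \<and> realizes_face \<Phi> r f P \<and>
        \<theta> = klein_angle (P i) (P j) (P k))"

definition face_area :: "('v set \<Rightarrow> real) \<Rightarrow> real^'v \<Rightarrow> 'v set \<Rightarrow> real" where
  "face_area \<Phi> r f =
     (THE a. \<exists>P. realizes_face \<Phi> r f P \<and> a = klein_area (convex hull (P ` f)))"

definition curvature :: "'v::finite set set \<Rightarrow> ('v set \<Rightarrow> real) \<Rightarrow> real^'v \<Rightarrow> 'v \<Rightarrow> real" where
  "curvature F \<Phi> r i = 2 * pi - (\<Sum>f \<in> {f \<in> F. i \<in> f}. inner_angle \<Phi> r f i)"

definition zero_curvature_metric ::
    "'v::finite set set \<Rightarrow> ('v set \<Rightarrow> real) \<Rightarrow> real^'v \<Rightarrow> bool" where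
  "zero_curvature_metric F \<Phi> r \<longleftrightarrow>
     circle_packing_metric r \<and> (\<forall>i. curvature F \<Phi> r i = 0)"


section \<open>The combinatorial p-th Calabi flow\<close>

definition partial_deriv :: "'v \<Rightarrow> (real^'v \<Rightarrow> real) \<Rightarrow> real^'v \<Rightarrow> real" where
  "partial_deriv i g r = deriv (\<lambda>s. g (\<chi> v. if v = i then s else r $ v)) (r $ i)"

text \<open>
  In a triangulated closed surface, the sum in \<open>coeff_B\<close> runs over the two
  faces containing the edge \<open>{i, j}\<close>.
\<close>

definition coeff_B ::
    "'v::finite set set \<Rightarrow> ('v set \<Rightarrow> real) \<Rightarrow> real^'v \<Rightarrow> 'v \<Rightarrow> 'v \<Rightarrow> real" where
  "coeff_B F \<Phi> r i j =
     partial_deriv j (\<lambda>r. \<Sum>f \<in> {f \<in> F. {i, j} \<subseteq> f}. inner_angle \<Phi> r f i) r * sinh (r $ j)"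

definition coeff_A :: "'v::finite set set \<Rightarrow> ('v set \<Rightarrow> real) \<Rightarrow> real^'v \<Rightarrow> 'v \<Rightarrow> real" where
  "coeff_A F \<Phi> r i =
     sinh (r $ i) * partial_deriv i (\<lambda>r. \<Sum>f \<in> {f \<in> F. i \<in> f}. face_area \<Phi> r f) r"

text \<open>Since \<open>0 powr a = 0\<close>, the summands with \<open>f j = f i\<close> vanish for every \<open>p\<close>.\<close>

definition p_laplace ::
    "'v::finite set set \<Rightarrow> ('v set \<Rightarrow> real) \<Rightarrow> real \<Rightarrow> real^'v \<Rightarrow> ('v \<Rightarrow> real) \<Rightarrow> 'v \<Rightarrow> real" where
  "p_laplace F \<Phi> p r f i =
     (\<Sum>j \<in> {j. {i, j} \<in> edges F}.
        coeff_B F \<Phi> r i j * (\<bar>f j - f i\<bar> powr (p - 2) * (f j - f i)))"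

definition calabi_field ::
    "'v::finite set set \<Rightarrow> ('v set \<Rightarrow> real) \<Rightarrow> real \<Rightarrow> real^'v \<Rightarrow> real^'v" where
  "calabi_field F \<Phi> p r =
     (\<chi> i. (p_laplace F \<Phi> p r (curvature F \<Phi> r) i
             - coeff_A F \<Phi> r i * curvature F \<Phi> r i) * sinh (r $ i))"

text \<open>
  A solution on the time interval \<open>I\<close>; at an endpoint belonging to \<open>I\<close> the
  derivative is one-sided.
\<close>

definition calabi_flow_on ::
    "real set \<Rightarrow> 'v::finite set set \<Rightarrow> ('v set \<Rightarrow> real) \<Rightarrow> real \<Rightarrow> (real \<Rightarrow> real^'v) \<Rightarrow> bool" where
  "calabi_flow_on I F \<Phi> p r \<longleftrightarrow>
     (\<forall>t \<in> I. circle_packing_metric (r t) \<and>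
        (r has_vector_derivative calabi_field F \<Phi> p (r t)) (at t within I))"

end

theory Submission
  imports Defs "HOL-Complex_Analysis.Great_Picard"
begin

text \<open>
  Put \<open>u\<^sub>i = ln (tanh (r\<^sub>i / 2)) < 0\<close>, so that \<open>dr\<^sub>i = sinh r\<^sub>i du\<^sub>i\<close>. In these coordinates
  the flow is \<open>du\<^sub>i/dt = \<Delta>\<^sub>p K\<^sub>i - A\<^sub>i K\<^sub>i\<close>, and the curvature has a symmetric Jacobian:
  \<open>\<partial>K\<^sub>i/\<partial>u\<^sub>j = - B\<^sub>i\<^sub>j\<close> for \<open>j \<noteq> i\<close> and \<open>\<partial>K\<^sub>i/\<partial>u\<^sub>i = A\<^sub>i + (\<Sum>j. B\<^sub>i\<^sub>j)\<close>. Weights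
  in \<open>[0, pi/2]\<close> make \<open>B\<^sub>i\<^sub>j \<ge> 0\<close> and \<open>A\<^sub>i > 0\<close>, so the Jacobian is positive definite and \<open>K\<close>
  is the gradient of a strictly convex function \<open>W\<close> of \<open>u\<close>. Along the flow
  \<open>dW/dt = (\<Sum>i. K\<^sub>i du\<^sub>i/dt) \<le> - (\<Sum>i. A\<^sub>i K\<^sub>i\<^sup>2)\<close> (\<open>energy_dissipation\<close>). The locale
  \<open>curvature_flow\<close> records these properties and all of the dynamics is derived in it.

  For \<open>p < 2\<close> the map \<open>x \<mapsto> |x|\<^sup>p\<^sup>-\<^sup>2 x\<close> is not Lipschitz at \<open>0\<close>, so solutions are provided by
  Peano's theorem (\<open>peano_half_line\<close>). A solution could cease to exist in finite time only by some \<open>r\<^sub>i\<close> tending to infinity or to zero. The first does not happen because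
  \<open>A\<^sub>i = (\<Sum>j. B\<^sub>i\<^sub>j\<close> \<open>(cosh l\<^sub>i\<^sub>j - 1))\<close>, summed face by face, is much larger than \<open>(\<Sum>j. B\<^sub>i\<^sub>j)\<close> when
  \<open>r\<^sub>i\<close> is large, while the angles at \<open>v\<^sub>i\<close> are then small and \<open>K\<^sub>i \<ge> pi \<ge> K\<^sub>j - K\<^sub>i\<close>: such a circle
  shrinks (\<open>large_circle_shrinks\<close>). The second does not happen in finite time because
  \<open>A\<close> and \<open>B\<close> are bounded as long as the radii are bounded above, uniformly for radii
  close to \<open>0\<close> (\<open>coupling_le\<close>), so that \<open>u\<close> moves at bounded speed.

  If a solution converges, its limit is a rest point, and there the dissipation inequality
  forces \<open>K = 0\<close> (\<open>limit_is_flat\<close>). Conversely a metric of zero curvature is a critical point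
  of the convex function \<open>W\<close>; so \<open>W\<close> grows at least linearly, the solution stays in a compact
  set, and \<open>W\<close> can only stop decreasing at the critical point (\<open>convergence_to_flat\<close>).

  What remains is geometry. Angles and areas are defined through realizations of the faces
  in the Klein disc. Realizations exist (\<open>triangle_exists\<close>), their angles are determined by
  the side lengths (\<open>klein_law_of_cosines\<close>), and their areas by the angles
  (\<open>hyperbolic_gauss_bonnet\<close>). The derivatives of the angles are then computed from the law
  of cosines (\<open>corner_angle_derivative\<close>), and those of the areas from the angles.
\<close>

section \<open>Integral curves of continuous vector fields\<close>

definition integral_curve_on :: "('a::real_normed_vector \<Rightarrow> 'a) \<Rightarrow> real set \<Rightarrow> (real \<Rightarrow> 'a) \<Rightarrow> bool" where
  "integral_curve_on f J x \<longleftrightarrow> (\<forall>t\<in>J. (x has_vector_derivative f (x t)) (at t within J))"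

lemma vector_derivative_bound_imp_lipschitz:
  fixes x :: "real \<Rightarrow> 'a::real_normed_vector"
  assumes "convex J" and "\<And>t. t \<in> J \<Longrightarrow> (x has_vector_derivative x' t) (at t within J)"
    and "\<And>t. t \<in> J \<Longrightarrow> norm (x' t) \<le> M" and "s \<in> J" "t \<in> J"
  shows "norm (x s - x t) \<le> M * \<bar>s - t\<bar>"
proof -
  have "onorm (\<lambda>h. h *\<^sub>R x' t) \<le> M" if "t \<in> J" for t
    using onorm_scaleR_left[of "\<lambda>h::real. h" "x' t"] assms(3)[OF that]
    by (simp add: onorm_id[unfolded id_def])
  then have "norm (x s - x t) \<le> M * norm (s - t)"
    using assms by (intro differentiable_bound[of J x "\<lambda>t h. h *\<^sub>R x' t"])
      (auto simp: has_vector_derivative_def)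
  then show ?thesis by simp
qed

text \<open>
  Tonelli's approximation to \<open>x' = f x\<close>: with the delay \<open>1 / n\<close> in the argument the integral
  equation determines its solution step by step, so that \<open>n\<close> Picard iterations already
  produce an exact solution on the unit interval.
\<close>

lemma delayed_integral_equation:
  fixes f :: "'a::euclidean_space \<Rightarrow> 'a"
  assumes f: "continuous_on UNIV f" and n: "n > 0"
  obtains z where "continuous_on {0..1} z"
    and "\<And>t. t \<in> {0..1} \<Longrightarrow> z t = x0 + integral {0..t} (\<lambda>s. f (z (max 0 (s - 1 / real n))))"
proof -
  define h where "h = 1 / real n"
  have h: "h > 0" using n by (simp add: h_def)
  define P where "P z = (\<lambda>t. x0 + integral {0..t} (\<lambda>s. f (z (max 0 (s - h)))))" for z
  define Z where "Z k = (P ^^ k) (\<lambda>_. x0)" for k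
  have Z0: "Z 0 = (\<lambda>_. x0)" and ZS: "Z (Suc k) = P (Z k)" for k by (simp_all add: Z_def)
  have cont: "continuous_on {0..1} (Z k)" for k
  proof (induction k)
    case 0 then show ?case by (simp add: Z0)
  next
    case (Suc k)
    have "continuous_on {0..1} (\<lambda>s. Z k (max 0 (s - h)))"
      by (rule continuous_on_compose2[OF Suc]) (use h in \<open>auto intro!: continuous_intros\<close>)
    then have "continuous_on {0..1} (\<lambda>s. f (Z k (max 0 (s - h))))"
      by (rule continuous_on_compose2[OF f]) auto
    then show ?case unfolding ZS P_def
      by (intro continuous_intros indefinite_integral_continuous_1 integrable_continuous_real)
  qed
  \<comment> \<open>Each iteration extends by \<open>h\<close> the interval on which the iterates are stationary.\<close>
  have stab: "Z (Suc k) t = Z k t" if "0 \<le> t" "t \<le> real k * h" for k t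
    using that
  proof (induction k arbitrary: t)
    case 0 then show ?case by (simp add: ZS Z0 P_def)
  next
    case (Suc k)
    have "integral {0..t} (\<lambda>s. f (Z (Suc k) (max 0 (s - h)))) = integral {0..t} (\<lambda>s. f (Z k (max 0 (s - h))))"
    proof (rule integral_cong)
      fix s assume "s \<in> {0..t}"
      then have "Z (Suc k) (max 0 (s - h)) = Z k (max 0 (s - h))"
        using Suc.prems h by (intro Suc.IH) (auto simp: algebra_simps)
      then show "f (Z (Suc k) (max 0 (s - h))) = f (Z k (max 0 (s - h)))" by simp
    qed
    then show ?case by (subst (1 2) ZS) (simp add: P_def)
  qed
  show ?thesis
  proof (rule that[of "Z n"])
    fix t :: real assume "t \<in> {0..1}"
    then have "Z n t = Z (Suc n) t"
      using stab[of t n] n by (simp add: h_def)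
    then show "Z n t = x0 + integral {0..t} (\<lambda>s. f (Z n (max 0 (s - 1 / real n))))"
      by (simp add: ZS P_def h_def)
  qed (rule cont)
qed

text \<open>
  The Tonelli approximations are Lipschitz with constant \<open>M\<close>, so by the Arzela--Ascoli theorem a
  subsequence converges uniformly. The integral equation survives in the limit, because the
  delays tend to zero and the integrands are bounded by \<open>M\<close>.
\<close>

lemma peano_unit_interval:
  fixes f :: "'a::euclidean_space \<Rightarrow> 'a"
  assumes f: "continuous_on UNIV f" and M: "\<And>x. norm (f x) \<le> M"
  obtains x where "x 0 = x0" "integral_curve_on f {0..1} x"
proof -
  have M0: "M \<ge> 0" using M[of 0] norm_ge_zero order_trans by blast
  have "\<exists>z. \<forall>n. continuous_on {0..1} (z n) \<and> (\<forall>t\<in>{0..1}.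
      z n t = x0 + integral {0..t} (\<lambda>s. f (z n (max 0 (s - 1 / real (Suc n))))))"
    using delayed_integral_equation[OF f, of "Suc _" x0] by (intro choice) (metis zero_less_Suc)
  then obtain z where zc: "\<And>n. continuous_on {0..1} (z n)"
    and z: "\<And>n t. t \<in> {0..1} \<Longrightarrow> z n t = x0 + integral {0..t} (\<lambda>s. f (z n (max 0 (s - 1 / real (Suc n)))))"
    by blast
  have fzc: "continuous_on {0..1} (\<lambda>s. f (z n (max 0 (s - 1 / real (Suc n)))))" for n
  proof (rule continuous_on_compose2[OF f])
    show "continuous_on {0..1} (\<lambda>s. z n (max 0 (s - 1 / real (Suc n))))"
    proof (rule continuous_on_compose2[OF zc])
      have "0 \<le> 1 / real (Suc n)" by simp
      then have "max 0 (s - 1 / real (Suc n)) \<in> {0..1}" if "s \<in> {0..1}" for s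
        using that by (simp only: atLeastAtMost_iff) linarith
      then show "(\<lambda>s. max 0 (s - 1 / real (Suc n))) ` {0..1} \<subseteq> {0..1}"
        by blast
    qed (auto intro!: continuous_intros)
  qed auto
  have zd: "(z n has_vector_derivative f (z n (max 0 (t - 1 / real (Suc n))))) (at t within {0..1})"
    if "t \<in> {0..1}" for n t
  proof (rule has_vector_derivative_transform[OF that])
    show "((\<lambda>t. x0 + integral {0..t} (\<lambda>s. f (z n (max 0 (s - 1 / real (Suc n)))))) has_vector_derivative
      f (z n (max 0 (t - 1 / real (Suc n))))) (at t within {0..1})"
      using has_vector_derivative_add[OF has_vector_derivative_const integral_has_vector_derivative[OF fzc that]]
      by simp
  qed (rule z)
  have lip: "norm (z n s - z n t) \<le> M * \<bar>s - t\<bar>" if "s \<in> {0..1}" "t \<in> {0..1}" for n s t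
    by (rule vector_derivative_bound_imp_lipschitz[OF _ zd M that]) auto
  have z0: "z n 0 = x0" for n using z[of 0 n] by simp
  have bd: "norm (z n t) \<le> norm x0 + M" if "t \<in> {0..1}" for n t
  proof -
    have "norm (z n t) \<le> norm (z n 0) + norm (z n t - z n 0)" by (metis norm_triangle_sub)
    also have "\<dots> \<le> norm x0 + M * t" using lip[of t 0 n] that z0 by auto
    also have "\<dots> \<le> norm x0 + M" using that M0 by (simp add: mult_left_le)
    finally show ?thesis .
  qed
  have equi: "\<exists>d. 0 < d \<and> (\<forall>n y. y \<in> {0..1} \<and> norm (x - y) < d \<longrightarrow> norm (z n x - z n y) < e)"
    if "x \<in> {0..1}" "0 < e" for x e
  proof (intro exI conjI allI impI)
    show "0 < e / (M + 1)" using that M0 by simp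
    fix n y assume y: "y \<in> {0..1} \<and> norm (x - y) < e / (M + 1)"
    then have "norm (z n x - z n y) \<le> M * \<bar>x - y\<bar>" using that lip by auto
    also have "\<dots> \<le> (M + 1) * \<bar>x - y\<bar>" by (simp add: algebra_simps)
    also have "\<dots> < e" using y M0 by (simp add: pos_less_divide_eq mult.commute)
    finally show "norm (z n x - z n y) < e" .
  qed
  obtain g k where gc: "continuous_on {0..1} g" and k: "strict_mono (k :: nat \<Rightarrow> nat)"
    and lim: "\<And>e. 0 < e \<Longrightarrow> \<exists>N. \<forall>n x. n \<ge> N \<and> x \<in> {0..1} \<longrightarrow> norm (z (k n) x - g x) < e"
    using Arzela_Ascoli[of "{0..1::real}" z, OF _ bd equi] compact_Icc by metis
  have ptw: "(\<lambda>n. z (k n) t) \<longlonglongrightarrow> g t" if "t \<in> {0..1}" for t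
    unfolding LIMSEQ_iff using lim that by metis
  have hlim: "(\<lambda>n. 1 / real (Suc (k n))) \<longlonglongrightarrow> 0"
    using LIMSEQ_subseq_LIMSEQ[OF LIMSEQ_inverse_real_of_nat k] by (simp add: o_def inverse_eq_divide)
  have delayed: "(\<lambda>n. z (k n) (max 0 (s - 1 / real (Suc (k n))))) \<longlonglongrightarrow> g s" if s: "s \<in> {0..1}" for s
  proof -
    have "(\<lambda>n. z (k n) (max 0 (s - 1 / real (Suc (k n)))) - z (k n) s) \<longlonglongrightarrow> 0"
    proof (rule Lim_null_comparison)
      show "(\<lambda>n. M * (1 / real (Suc (k n)))) \<longlonglongrightarrow> 0" using tendsto_mult_right_zero[OF hlim] by simp
      show "\<forall>\<^sub>F n in sequentially. norm (z (k n) (max 0 (s - 1 / real (Suc (k n)))) - z (k n) s)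
              \<le> M * (1 / real (Suc (k n)))"
      proof (intro always_eventually allI)
        fix n
        define h where "h = 1 / real (Suc (k n))"
        have h: "h > 0" by (simp add: h_def)
        have "norm (z (k n) (max 0 (s - h)) - z (k n) s) \<le> M * \<bar>max 0 (s - h) - s\<bar>"
          using s h by (intro lip) auto
        also have "\<dots> \<le> M * h" using s h M0 by (intro mult_left_mono) auto
        finally show "norm (z (k n) (max 0 (s - 1 / real (Suc (k n)))) - z (k n) s)
              \<le> M * (1 / real (Suc (k n)))" by (simp add: h_def)
      qed
    qed
    from tendsto_add[OF this ptw[OF s]] show ?thesis by simp
  qed
  have g: "g t = x0 + integral {0..t} (\<lambda>s. f (g s))" if t: "t \<in> {0..1}" for t
  proof -
    have "(\<lambda>n. integral {0..t} (\<lambda>s. f (z (k n) (max 0 (s - 1 / real (Suc (k n)))))))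
            \<longlonglongrightarrow> integral {0..t} (\<lambda>s. f (g s))"
    proof (rule dominated_convergence(2))
      show "(\<lambda>s. f (z (k n) (max 0 (s - 1 / real (Suc (k n)))))) integrable_on {0..t}" for n
        using t by (intro integrable_continuous_real continuous_on_subset[OF fzc]) auto
      show "(\<lambda>s. M) integrable_on {0..t}" by (rule integrable_const_ivl)
      show "(\<lambda>n. f (z (k n) (max 0 (s - 1 / real (Suc (k n)))))) \<longlonglongrightarrow> f (g s)" if "s \<in> {0..t}" for s
        using that t f by (intro isCont_tendsto_compose[of _ f] delayed)
          (auto simp: continuous_on_eq_continuous_at)
    qed (rule M)
    then have "(\<lambda>n. z (k n) t) \<longlonglongrightarrow> x0 + integral {0..t} (\<lambda>s. f (g s))"
      by (subst z[OF t]) (intro tendsto_intros)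
    then show ?thesis using LIMSEQ_unique ptw[OF t] by blast
  qed
  have fgc: "continuous_on {0..1} (\<lambda>s. f (g s))"
    by (rule continuous_on_compose2[OF f gc]) auto
  have "(g has_vector_derivative f (g t)) (at t within {0..1})" if "t \<in> {0..1}" for t
  proof (rule has_vector_derivative_transform[OF that])
    show "((\<lambda>t. x0 + integral {0..t} (\<lambda>s. f (g s))) has_vector_derivative f (g t)) (at t within {0..1})"
      using has_vector_derivative_add[OF has_vector_derivative_const integral_has_vector_derivative[OF fgc that]]
      by simp
  qed (rule g)
  moreover have "g 0 = x0" using g[of 0] by simp
  ultimately show ?thesis by (intro that[of g]) (auto simp: integral_curve_on_def)
qed

lemma integral_curve_concatenate:
  fixes x y :: "real \<Rightarrow> 'a::real_normed_vector"
  assumes x: "integral_curve_on f {0..T} x" and T: "T \<ge> 0"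
    and y: "integral_curve_on f J y" and J: "closed J" "0 \<in> J" "J \<subseteq> {0..}"
    and xy: "x T = y 0"
  shows "integral_curve_on f ({0..T} \<union> (\<lambda>t. t + T) ` J) (\<lambda>t. if t \<in> {0..T} then x t else y (t - T))"
  unfolding integral_curve_on_def
proof
  define S where "S = (\<lambda>t. t + T) ` J"
  have S: "closed S" unfolding S_def using closed_translation[OF J(1), of T] by (simp add: add.commute)
  have int: "{0..T} \<inter> S = {T}" using J T by (force simp: S_def)
  have yd: "((\<lambda>t. y (t - T)) has_vector_derivative f (y (t - T))) (at t within S)" if "t \<in> S" for t
  proof -
    have m: "t - T \<in> J" using that by (auto simp: S_def)
    have im: "(\<lambda>t. t - T) ` S = J" by (force simp: S_def image_iff)
    have "((y \<circ> (\<lambda>t. t - T)) has_vector_derivative 1 *\<^sub>R f (y (t - T))) (at t within S)"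
      by (rule vector_diff_chain_within)
        (use y m im in \<open>auto simp: integral_curve_on_def intro!: derivative_eq_intros\<close>)
    then show ?thesis by (simp add: o_def)
  qed
  have ydT: "((\<lambda>t. y (t - T)) has_vector_derivative f (y 0)) (at T within S)" if "T \<in> S"
    using yd[OF that] by simp
  fix t assume t: "t \<in> {0..T} \<union> (\<lambda>t. t + T) ` J"
  have meet: "t = T" if "t \<in> {0..T}" "t \<in> S" using that int by blast
  have "((\<lambda>t. if t \<in> {0..T} then x t else y (t - T)) has_vector_derivative
     (if t \<in> {0..T} then f (x t) else f (y (t - T)))) (at t within ({0..T} \<union> S))"
    by (rule has_vector_derivative_If_within_closures)
      (use t x xy T yd ydT int S meet in \<open>auto simp: S_def[symmetric] integral_curve_on_def insert_absorb Un_absorb2\<close>)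
  then show "((\<lambda>t. if t \<in> {0..T} then x t else y (t - T)) has_vector_derivative
     f (if t \<in> {0..T} then x t else y (t - T))) (at t within {0..T} \<union> (\<lambda>t. t + T) ` J)"
    by (auto simp: S_def split: if_splits)
qed

text \<open>
  The bound \<open>M\<close> holds on the whole space, so the length of the interval in
  \<open>peano_unit_interval\<close> does not depend on the initial point and unit steps can be concatenated
  for ever.
\<close>

theorem peano_half_line:
  fixes f :: "'a::euclidean_space \<Rightarrow> 'a"
  assumes f: "continuous_on UNIV f" and M: "\<And>x. norm (f x) \<le> M"
  obtains x where "x 0 = x0" "integral_curve_on f {0..} x"
proof -
  let ?P = "\<lambda>n x. x 0 = x0 \<and> integral_curve_on f {0..real n} x"
  let ?Q = "\<lambda>n x x'. \<forall>t\<in>{0..real n}. x' t = x t"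
  have start: "?P 0 (\<lambda>_. x0)" by (simp add: integral_curve_on_def has_vector_derivative_def
      has_derivative_within_singleton_iff bounded_linear_scaleR_left)
  have step: "\<exists>x'. ?P (Suc n) x' \<and> ?Q n x x'" if x: "?P n x" for n x
  proof -
    obtain y where y: "y 0 = x (real n)" "integral_curve_on f {0..1} y"
      using peano_unit_interval[OF f M] by blast
    have "(\<lambda>t::real. t + real n) ` {0..1} = {real n..real n + 1}"
      using image_add_atLeastAtMost'[of "real n" 0 1] by (simp add: add.commute)
    then have "{0..real n} \<union> (\<lambda>t. t + real n) ` {0..1} = {0..real (Suc n)}" by auto
    then have "integral_curve_on f {0..real (Suc n)} (\<lambda>t. if t \<in> {0..real n} then x t else y (t - real n))"
      using integral_curve_concatenate[of f "real n" x "{0..1}" y] x y by auto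
    then show ?thesis using x
      by (intro exI[of _ "\<lambda>t. if t \<in> {0..real n} then x t else y (t - real n)"]) auto
  qed
  \<comment> \<open>The extensions are chosen successively, each agreeing with the previous one.\<close>
  obtain X where X: "\<And>n. ?P n (X n)" and XS: "\<And>n. ?Q n (X n) (X (Suc n))"
    using dependent_nat_choice[of ?P ?Q] start step by metis
  have agree: "X m t = X n t" if "n \<le> m" "t \<in> {0..real n}" for m n t
    using that by (induction m rule: dec_induct) (use XS in auto)
  define x where "x t = X (nat \<lceil>t\<rceil>) t" for t
  have x: "x t = X n t" if "t \<in> {0..real n}" for n t
    unfolding x_def using that by (intro agree[symmetric]) (auto simp: nat_le_iff ceiling_le_iff)
  have "(x has_vector_derivative f (x t)) (at t within {0..})" if "t \<in> {0..}" for t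
  proof -
    obtain n where n: "t < real n" using reals_Archimedean2 by blast
    have "(X n has_vector_derivative f (X n t)) (at t within {0..real n})"
      using X[of n] n that by (auto simp: integral_curve_on_def)
    then have "(x has_vector_derivative f (X n t)) (at t within {0..real n})"
      using n that x[of _ n]
      by - (rule has_vector_derivative_transform[where f' = "f (X n t)" and f = "X n"], simp_all)
    then have "(x has_vector_derivative f (x t)) (at t within {0..real n})"
      using n that x[of t n] by simp
    moreover have "at t within {0..real n} = at t within {0..}"
      by (rule at_within_nhd[of _ "{..<real n}"]) (use n in auto)
    ultimately show ?thesis by simp
  qed
  moreover have "x 0 = x0" using X[of 0] by (simp add: x_def)
  ultimately show ?thesis by (intro that[of x]) (auto simp: integral_curve_on_def)
qed

text \<open>
  If \<open>g t > b\<close>, then after the last time \<open>s < t\<close> with \<open>g s \<le> b\<close> the function stays above \<open>b\<close> and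
  hence does not increase, contradicting \<open>g t > g s\<close>. It is used with \<open>b = g a\<close> for
  functions that decrease everywhere, and with a larger \<open>b\<close> to confine a solution by
  information on the velocity that holds only above the level \<open>b\<close>.
\<close>

lemma derivative_barrier:
  fixes g :: "real \<Rightarrow> real"
  assumes J: "is_interval J" "a \<in> J" "t \<in> J" "a \<le> t"
    and g: "\<And>s. s \<in> J \<Longrightarrow> (g has_vector_derivative g' s) (at s within J)"
    and ga: "g a \<le> b" and neg: "\<And>s. s \<in> J \<Longrightarrow> g s \<ge> b \<Longrightarrow> g' s \<le> 0"
  shows "g t \<le> b"
proof (rule ccontr)
  assume "\<not> g t \<le> b"
  then have gt: "g t > b" by simp
  have sub: "{a..t} \<subseteq> J" using J by (meson atLeastAtMost_iff is_interval_1 subsetI)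
  have d: "(g has_vector_derivative g' s) (at s within {a..t})" if "s \<in> {a..t}" for s
    using has_vector_derivative_within_subset[OF g sub] that sub by blast
  have cont: "continuous_on {a..t} g"
    using d has_vector_derivative_continuous continuous_on_eq_continuous_within by blast
  define C where "C = {s \<in> {a..t}. g s \<le> b}"
  have "closed C" unfolding C_def
    using continuous_closed_preimage[OF cont, of "{..b}"] by (simp add: vimage_def Int_def)
  moreover have "C \<noteq> {}" "bdd_above C" using ga J by (auto simp: C_def)
  ultimately have s: "Sup C \<in> C" by (metis closed_contains_Sup)
  let ?s = "Sup C"
  have st: "?s \<in> {a..t}" "g ?s \<le> b" using s by (auto simp: C_def)
  have above: "g \<tau> > b" if "\<tau> \<in> {?s<..t}" for \<tau>
    using that st cSup_upper[of \<tau> C] \<open>bdd_above C\<close> by (force simp: C_def)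
  have "?s < t" using st gt by (cases "?s = t") auto
  then have "\<exists>\<xi>\<in>{?s<..<t}. g t - g ?s = g' \<xi> * (t - ?s)"
  proof (rule mvt_simple[of _ _ g "\<lambda>x h. g' x * h"])
    fix s assume s: "?s \<le> s" "s \<le> t"
    have "(g has_vector_derivative g' s) (at s within {?s..t})"
      by (rule has_vector_derivative_within_subset[OF d]) (use s st in auto)
    then show "(g has_derivative (*) (g' s)) (at s within {?s..t})"
      by (simp add: has_vector_derivative_def mult.commute[of _ "g' s"])
  qed
  then obtain \<xi> where "\<xi> \<in> {?s<..<t}" "g t - g ?s = g' \<xi> * (t - ?s)" by blast
  moreover have "\<xi> \<in> J" using calculation(1) st sub by auto
  moreover have "g' \<xi> \<le> 0" using neg[OF calculation(3)] above[of \<xi>] calculation(1) by simp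
  ultimately have "g t - g ?s \<le> 0" using \<open>?s < t\<close> by (simp add: mult_nonpos_nonneg)
  then show False using gt st by simp
qed

section \<open>Curvature flows on the negative orthant\<close>

definition negative_orthant :: "(real^'v) set" where
  "negative_orthant = {u. \<forall>i. u $ i < 0}"

lemma negative_orthant_eq: "(negative_orthant :: (real^'v::finite) set) = (\<Inter>i. {u. u $ i < 0})"
  by (auto simp: negative_orthant_def)

lemma open_negative_orthant: "open (negative_orthant :: (real^'v::finite) set)"
  unfolding negative_orthant_eq by (intro open_INT ballI open_halfspace_component_lt_cart) auto

lemma convex_negative_orthant: "convex (negative_orthant :: (real^'v::finite) set)"
proof (rule convexI)
  fix x y :: "real^'v" and a b :: real
  assume xy: "x \<in> negative_orthant" "y \<in> negative_orthant" and ab: "0 \<le> a" "0 \<le> b" "a + b = 1"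
  have "a * x $ i + b * y $ i < 0" for i
    using xy ab by (intro convex_bound_lt) (auto simp: negative_orthant_def)
  then show "a *\<^sub>R x + b *\<^sub>R y \<in> negative_orthant" by (simp add: negative_orthant_def)
qed

text \<open>
  The nonlinearity \<open>|x|\<^sup>p\<^sup>-\<^sup>2 x\<close> of the \<open>p\<close>-Laplace operator.
\<close>

definition signed_power :: "real \<Rightarrow> real \<Rightarrow> real" where
  "signed_power p x = \<bar>x\<bar> powr (p - 2) * x"

lemma abs_signed_power: "\<bar>signed_power p x\<bar> = \<bar>x\<bar> powr (p - 1)"
  using powr_mult_base[of "\<bar>x\<bar>" "p - 2"] by (simp add: signed_power_def abs_mult mult.commute)

lemma signed_power_minus: "signed_power p (- x) = - signed_power p x"
  by (simp add: signed_power_def)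

lemma signed_power_mult_nonneg: "x * signed_power p x \<ge> 0"
  using mult_nonneg_nonneg[of "\<bar>x\<bar> powr (p - 2)" "x * x"] by (simp add: signed_power_def mult_ac)

lemma continuous_on_signed_power:
  assumes "p > 1" shows "continuous_on UNIV (signed_power p)"
proof -
  have "isCont (signed_power p) x" for x
  proof (cases "x = 0")
    case True
    have "((\<lambda>x::real. \<bar>x\<bar> powr (p - 1)) \<longlongrightarrow> \<bar>0\<bar> powr (p - 1)) (at 0)"
      by (rule tendsto_powr') (use assms in \<open>auto intro!: tendsto_eq_intros\<close>)
    then have "(signed_power p \<longlongrightarrow> 0) (at 0)"
      using assms by - (rule Lim_null_comparison[where g = "\<lambda>x. \<bar>x\<bar> powr (p - 1)"],
        simp_all add: abs_signed_power)
    then show ?thesis using True by (simp add: isCont_def signed_power_def)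
  next
    case False
    then show ?thesis unfolding signed_power_def by (intro continuous_intros) auto
  qed
  then show ?thesis by (simp add: continuous_on_eq_continuous_at)
qed

text \<open>
  Summation by parts on a graph: for an antisymmetric flux \<open>M\<close>, testing the divergence of \<open>M\<close>
  against \<open>b\<close> gives half the sum of the flux times the differences of \<open>b\<close>. It yields the
  sign of the dissipation, the positivity of the Jacobian and its symmetry.
\<close>

lemma sum_antisymmetric:
  fixes M :: "'v::finite \<Rightarrow> 'v \<Rightarrow> real"
  assumes "\<And>i j. M j i = - M i j"
  shows "(\<Sum>i\<in>UNIV. \<Sum>j\<in>UNIV. M i j * b i) = (\<Sum>i\<in>UNIV. \<Sum>j\<in>UNIV. M i j * (b i - b j)) / 2"
proof -
  have "(\<Sum>i\<in>UNIV. \<Sum>j\<in>UNIV. M i j * b j) = (\<Sum>j\<in>UNIV. \<Sum>i\<in>UNIV. M i j * b j)"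
    by (rule sum.swap)
  also have "\<dots> = (\<Sum>i\<in>UNIV. \<Sum>j\<in>UNIV. - (M i j * b i))"
    by (subst assms) simp
  also have "\<dots> = - (\<Sum>i\<in>UNIV. \<Sum>j\<in>UNIV. M i j * b i)" by (simp add: sum_negf)
  finally show ?thesis by (simp add: right_diff_distrib sum_subtractf)
qed

text \<open>
  The properties of the flow on which the dynamics depends. The derivative of \<open>K\<close> is
  prescribed along differentiable curves only; the right-hand side of \<open>K_deriv\<close> is the symmetric
  matrix with off-diagonal entries \<open>- B\<close> and row sums \<open>A\<close>, applied to the velocity \<open>v\<close>.
  The last two assumptions are a bound on the velocity away from the upper boundary of the
  orthant, and a layer along this boundary in which no coordinate increases.
\<close>

locale curvature_flow =
  fixes K A :: "real^'v::finite \<Rightarrow> 'v \<Rightarrow> real" and B :: "real^'v \<Rightarrow> 'v \<Rightarrow> 'v \<Rightarrow> real" and p :: real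
    and H :: "real^'v \<Rightarrow> real^'v"
  assumes p: "p > 1"
    and K_cont: "continuous_on negative_orthant (\<lambda>u. K u i)"
    and A_cont: "continuous_on negative_orthant (\<lambda>u. A u i)"
    and B_cont: "continuous_on negative_orthant (\<lambda>u. B u i j)"
    and A_pos: "u \<in> negative_orthant \<Longrightarrow> A u i > 0"
    and B_nonneg: "u \<in> negative_orthant \<Longrightarrow> B u i j \<ge> 0"
    and B_sym: "B u i j = B u j i"
    and K_deriv: "(c has_vector_derivative v) (at t within S) \<Longrightarrow> t \<in> S \<Longrightarrow> c t \<in> negative_orthant \<Longrightarrow>
      ((\<lambda>t. K (c t) i) has_real_derivative
        A (c t) i * v $ i + (\<Sum>j\<in>UNIV. B (c t) i j * (v $ i - v $ j))) (at t within S)"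
    and H_eq: "u \<in> negative_orthant \<Longrightarrow>
      H u $ i = (\<Sum>j\<in>UNIV. B u i j * signed_power p (K u j - K u i)) - A u i * K u i"
    and H_bounded: "b < 0 \<Longrightarrow> \<exists>M. \<forall>u. (\<forall>i. u $ i \<le> b) \<longrightarrow> (\<forall>i. \<bar>H u $ i\<bar> \<le> M)"
    and H_barrier: "\<exists>b<0. \<forall>u\<in>negative_orthant. \<forall>i. b \<le> u $ i \<longrightarrow> H u $ i \<le> 0"
begin

lemma velocity_continuous: "continuous_on negative_orthant H"
proof -
  have "continuous_on negative_orthant (\<lambda>u. \<chi> i. (\<Sum>j\<in>UNIV. B u i j * signed_power p (K u j - K u i)) - A u i * K u i)"
    by (intro continuous_intros K_cont A_cont B_cont
        continuous_on_compose2[OF continuous_on_signed_power[OF p]]) auto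
  then show ?thesis
    by (rule continuous_on_cong[THEN iffD1, rotated -1]) (auto simp: vec_eq_iff H_eq)
qed

text \<open>
  The nonlinear Laplacian is the divergence of an antisymmetric flux, and the flux along each
  edge has the sign of the difference of curvatures that drives it. Its contribution to the left-hand
  side is therefore nonpositive.
\<close>

lemma energy_dissipation:
  assumes u: "u \<in> negative_orthant"
  shows "(\<Sum>i\<in>UNIV. K u i * H u $ i) \<le> - (\<Sum>i\<in>UNIV. A u i * (K u i)\<^sup>2)"
proof -
  let ?M = "\<lambda>i j. B u i j * signed_power p (K u j - K u i)"
  have anti: "?M j i = - ?M i j" for i j
    using signed_power_minus[of p "K u j - K u i"] B_sym[of u i j] by simp
  have "(\<Sum>i\<in>UNIV. \<Sum>j\<in>UNIV. ?M i j * K u i) = (\<Sum>i\<in>UNIV. \<Sum>j\<in>UNIV. ?M i j * (K u i - K u j)) / 2"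
    by (rule sum_antisymmetric) (rule anti)
  moreover have "?M i j * (K u i - K u j) \<le> 0" for i j
    using mult_nonneg_nonneg[OF B_nonneg[OF u, of i j] signed_power_mult_nonneg[of "K u j - K u i" p]]
    by (simp add: algebra_simps)
  ultimately have "(\<Sum>i\<in>UNIV. \<Sum>j\<in>UNIV. ?M i j * K u i) \<le> 0"
    using sum_nonpos[of UNIV "\<lambda>i. \<Sum>j\<in>UNIV. ?M i j * (K u i - K u j)"]
      sum_nonpos[of UNIV "\<lambda>j. ?M _ j * (K u _ - K u j)"] by auto
  moreover have "(\<Sum>i\<in>UNIV. K u i * H u $ i)
    = (\<Sum>i\<in>UNIV. \<Sum>j\<in>UNIV. ?M i j * K u i) - (\<Sum>i\<in>UNIV. A u i * (K u i)\<^sup>2)"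
    by (simp add: H_eq[OF u] right_diff_distrib sum_subtractf sum_distrib_left sum_distrib_right
        power2_eq_square mult_ac)
  ultimately show ?thesis by simp
qed

lemma stationary_imp_flat:
  assumes u: "u \<in> negative_orthant" and "H u = 0"
  shows "K u i = 0"
proof -
  have "(\<Sum>i\<in>UNIV. A u i * (K u i)\<^sup>2) \<le> 0"
    using energy_dissipation[OF u] assms(2) by simp
  moreover have nonneg: "A u i * (K u i)\<^sup>2 \<ge> 0" for i using A_pos[OF u, of i] by simp
  ultimately have "(\<Sum>i\<in>UNIV. A u i * (K u i)\<^sup>2) = 0" by (intro antisym sum_nonneg)
  then have "A u i * (K u i)\<^sup>2 = 0" using nonneg by (simp add: sum_nonneg_eq_0_iff)
  then show ?thesis using A_pos[OF u, of i] by simp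
qed

text \<open>
  The barrier near the upper boundary stops each coordinate at the larger of the barrier level
  and the initial values.
\<close>

lemma uniform_upper_bound:
  assumes J: "is_interval J" "0 \<in> J" "J \<subseteq> {0..}" and x: "integral_curve_on H J x"
    and neg: "\<And>t. t \<in> J \<Longrightarrow> x t \<in> negative_orthant"
  obtains b where "b < 0" "\<And>t i. t \<in> J \<Longrightarrow> x t $ i \<le> b"
proof -
  obtain b0 where b0: "b0 < 0" "\<And>u i. u \<in> negative_orthant \<Longrightarrow> b0 \<le> u $ i \<Longrightarrow> H u $ i \<le> 0"
    using H_barrier by blast
  define b where "b = Max (insert b0 (range (\<lambda>i. x 0 $ i)))"
  have "b < 0" using neg[OF J(2)] b0 by (simp add: b_def negative_orthant_def)
  moreover have "x t $ i \<le> b" if t: "t \<in> J" for t i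
  proof (rule derivative_barrier[of J 0 t "\<lambda>t. x t $ i" "\<lambda>t. H (x t) $ i" b])
    show "((\<lambda>t. x t $ i) has_vector_derivative H (x s) $ i) (at s within J)" if "s \<in> J" for s
      by (rule bounded_linear.has_vector_derivative[OF bounded_linear_vec_nth])
        (use x that in \<open>auto simp: integral_curve_on_def\<close>)
    show "x 0 $ i \<le> b" by (simp add: b_def max.coboundedI2)
    have "b0 \<le> b" by (simp add: b_def)
    then show "H (x s) $ i \<le> 0" if "s \<in> J" "b \<le> x s $ i" for s
      using b0(2)[OF neg[OF that(1)], of i] that by simp
  qed (use J t in auto)
  ultimately show ?thesis using that by blast
qed

text \<open>
  Truncating the coordinates at the barrier level \<open>b\<close> makes the velocity a bounded continuous
  field on the whole space, to which Peano's theorem applies. A solution of the truncated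
  equation never crosses the level \<open>b\<close>, so it solves the original equation.
\<close>

lemma global_existence:
  assumes u0: "u0 \<in> negative_orthant"
  obtains x where "x 0 = u0" "integral_curve_on H {0..} x" "\<And>t. t \<ge> 0 \<Longrightarrow> x t \<in> negative_orthant"
proof -
  obtain b0 where b0: "b0 < 0" "\<And>u i. u \<in> negative_orthant \<Longrightarrow> b0 \<le> u $ i \<Longrightarrow> H u $ i \<le> 0"
    using H_barrier by blast
  define b where "b = Max (insert b0 (range (\<lambda>i. u0 $ i)))"
  have b: "b < 0" "b0 \<le> b" "\<And>i. u0 $ i \<le> b"
    using u0 b0 by (simp_all add: b_def negative_orthant_def max.coboundedI2)
  define clamp :: "real^'v \<Rightarrow> real^'v" where "clamp u = (\<chi> i. min (u $ i) b)" for u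
  have clamp: "clamp u \<in> negative_orthant" for u
    using b by (simp add: clamp_def negative_orthant_def min_less_iff_disj)
  have "continuous_on UNIV clamp" unfolding clamp_def by (intro continuous_intros)
  then have cont: "continuous_on UNIV (\<lambda>u. H (clamp u))"
    by (rule continuous_on_compose2[OF velocity_continuous]) (use clamp in auto)
  obtain M where M: "\<And>u i. (\<And>i. u $ i \<le> b) \<Longrightarrow> \<bar>H u $ i\<bar> \<le> M" using H_bounded[OF b(1)] by blast
  have bound: "norm (H (clamp u)) \<le> real CARD('v) * M" for u
    using order_trans[OF norm_le_l1_cart sum_mono[OF M]] by (simp add: clamp_def)
  obtain x where x: "x 0 = u0" "integral_curve_on (\<lambda>u. H (clamp u)) {0..} x"
    using peano_half_line[OF cont bound] by blast
  have le: "x t $ i \<le> b" if t: "t \<ge> 0" for t i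
  proof (rule derivative_barrier[of "{0..}" 0 t "\<lambda>t. x t $ i" "\<lambda>t. H (clamp (x t)) $ i" b])
    show "((\<lambda>t. x t $ i) has_vector_derivative H (clamp (x s)) $ i) (at s within {0..})" if "s \<in> {0..}" for s
      by (rule bounded_linear.has_vector_derivative[OF bounded_linear_vec_nth])
        (use x that in \<open>auto simp: integral_curve_on_def\<close>)
    show "H (clamp (x s)) $ i \<le> 0" if "s \<in> {0..}" "b \<le> x s $ i" for s
      by (rule b0(2)[OF clamp]) (use that b in \<open>simp add: clamp_def\<close>)
  qed (use x b t in \<open>auto simp: is_interval_ci\<close>)
  then have "clamp (x t) = x t" if "t \<ge> 0" for t
    using that by (simp add: clamp_def vec_eq_iff min_def antisym)
  then have "integral_curve_on H {0..} x" using x by (simp add: integral_curve_on_def)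
  moreover have "x t \<in> negative_orthant" if "t \<ge> 0" for t
    using le[OF that] b by (auto simp: negative_orthant_def intro: le_less_trans)
  ultimately show ?thesis using that x by blast
qed

text \<open>
  Below the level \<open>b\<close> the velocity is bounded. So the solution is Lipschitz, has a limit
  at \<open>T\<close>, and the limit again lies in the orthant; there a global solution takes over.
\<close>

lemma extension_of_local_solutions:
  assumes T: "T > 0" and s: "integral_curve_on H {0..<T} s"
    and neg: "\<And>t. t \<in> {0..<T} \<Longrightarrow> s t \<in> negative_orthant"
  obtains x where "integral_curve_on H {0..} x" "\<And>t. t \<ge> 0 \<Longrightarrow> x t \<in> negative_orthant"
    "\<And>t. t \<in> {0..<T} \<Longrightarrow> x t = s t"
proof -
  have ivl: "is_interval {0..<T}" by (rule is_interval_co)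
  obtain b where b: "b < 0" "\<And>t i. t \<in> {0..<T} \<Longrightarrow> s t $ i \<le> b"
    by (rule uniform_upper_bound[OF ivl _ _ s neg]) (use T in auto)
  obtain M where M: "\<And>u i. (\<And>i. u $ i \<le> b) \<Longrightarrow> \<bar>H u $ i\<bar> \<le> M" using H_bounded[OF b(1)] by blast
  define L where "L = real CARD('v) * M"
  have bound: "norm (H u) \<le> L" if "\<And>i. u $ i \<le> b" for u
    using order_trans[OF norm_le_l1_cart sum_mono[OF M[OF that]]] by (simp add: L_def)
  have sd: "(s has_vector_derivative H (s t)) (at t within {0..<T})" if "t \<in> {0..<T}" for t
    using s that by (simp add: integral_curve_on_def)
  have lip: "norm (s t - s t') \<le> L * \<bar>t - t'\<bar>" if "t \<in> {0..<T}" "t' \<in> {0..<T}" for t t'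
    using that b by (intro vector_derivative_bound_imp_lipschitz[OF _ sd]) (auto intro!: bound)
  have L0: "L \<ge> 0" using bound[of "s 0"] b T norm_ge_zero[of "H (s 0)"] by (metis atLeastLessThan_iff order_refl order_trans)
  have "L-lipschitz_on {0..<T} s" using lip L0 by (auto simp: lipschitz_on_def dist_norm)
  then have "uniformly_continuous_on {0..<T} s" by (rule lipschitz_on_uniformly_continuous)
  then obtain g where g: "uniformly_continuous_on {0..T} g" "\<And>t. t \<in> {0..<T} \<Longrightarrow> g t = s t"
    by (rule uniformly_continuous_on_extension_on_closure) (use T in auto)
  have gc: "continuous_on {0..T} g" using g(1) uniformly_continuous_imp_continuous by blast
  have gb: "g t $ i \<le> b" if "t \<in> {0..T}" for t i
  proof -
    have "continuous_on (closure {0..<T}) (\<lambda>t. g t $ i)"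
      using gc T by (auto intro!: continuous_intros)
    then show ?thesis
      by (rule continuous_le_on_closure) (use T g(2) b(2) that in auto)
  qed
  have gneg: "g t \<in> negative_orthant" if "t \<in> {0..T}" for t
    using gb[OF that] b by (auto simp: negative_orthant_def intro: le_less_trans)
  have Hgc: "continuous_on {0..T} (\<lambda>t. H (g t))"
    by (rule continuous_on_compose2[OF velocity_continuous gc]) (use gneg in auto)
  have gint: "g t = g 0 + integral {0..t} (\<lambda>t. H (g t))" if t: "t \<in> {0..T}" for t
  proof -
    have "((\<lambda>t. H (g t)) has_integral g t - g 0) {0..t}"
    proof (rule fundamental_theorem_of_calculus_interior)
      show "continuous_on {0..t} g" using gc t by (auto intro: continuous_on_subset)
      fix r assume r: "r \<in> {0<..<t}"
      have "(g has_vector_derivative H (s r)) (at r within {0..<T})"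
        by (rule has_vector_derivative_transform[OF _ _ sd]) (use r t g in auto)
      then have "(g has_vector_derivative H (s r)) (at r within {0<..<T})"
        by (rule has_vector_derivative_within_subset) auto
      then have "(g has_vector_derivative H (s r)) (at r)"
        using r t by (subst (asm) has_vector_derivative_within_open) auto
      then show "(g has_vector_derivative H (g r)) (at r)" using r t g by simp
    qed (use t in auto)
    then show ?thesis by (simp add: integral_unique)
  qed
  have g: "integral_curve_on H {0..T} g" "\<And>t. t \<in> {0..<T} \<Longrightarrow> g t = s t"
    unfolding integral_curve_on_def
  proof
    fix t assume t: "t \<in> {0..T}"
    show "(g has_vector_derivative H (g t)) (at t within {0..T})"
    proof (rule has_vector_derivative_transform[OF t])
      show "((\<lambda>t. g 0 + integral {0..t} (\<lambda>t. H (g t))) has_vector_derivative H (g t)) (at t within {0..T})"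
        using has_vector_derivative_add[OF has_vector_derivative_const integral_has_vector_derivative[OF Hgc t]]
        by simp
    qed (rule gint)
  qed (rule g(2))
  obtain y where y: "y 0 = g T" "integral_curve_on H {0..} y" "\<And>t. t \<ge> 0 \<Longrightarrow> y t \<in> negative_orthant"
    using global_existence[OF gneg[of T]] T by auto
  have "(\<lambda>t::real. t + T) ` {0..} = {T..}" using image_add_atLeast[of T 0] by (simp add: add.commute)
  then have un: "{0..T} \<union> (\<lambda>t::real. t + T) ` {0..} = {0..}" using T by auto
  show ?thesis
  proof (rule that)
    show "integral_curve_on H {0..} (\<lambda>t. if t \<in> {0..T} then g t else y (t - T))"
      using integral_curve_concatenate[of H T g "{0..}" y] g(1) y T un by auto
  qed (use g(2) gneg y T in auto)
qed

lemma segment_in_orthant: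
  assumes "z \<in> negative_orthant" "u \<in> negative_orthant" "0 \<le> s" "s \<le> 1"
  shows "z + s *\<^sub>R (u - z) \<in> negative_orthant"
proof -
  have "z + s *\<^sub>R (u - z) = (1 - s) *\<^sub>R z + s *\<^sub>R u" by (simp add: algebra_simps)
  then show ?thesis using convexD[OF convex_negative_orthant assms(1,2), of "1 - s" s] assms by simp
qed

text \<open>
  The derivative of this function is the quadratic form of the Jacobian of \<open>K\<close> at \<open>v\<close>, that is
  \<open>(\<Sum>i. A\<^sub>i v\<^sub>i\<^sup>2) + (\<Sum>i j. B\<^sub>i\<^sub>j (v\<^sub>i - v\<^sub>j)\<^sup>2) / 2 > 0\<close>. It is the strict convexity of the potential.
\<close>

lemma gradient_pairing_increasing:
  assumes z: "z \<in> negative_orthant" and u: "z + v \<in> negative_orthant" and v: "v \<noteq> 0"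
    and st: "0 \<le> s" "s < t" "t \<le> 1"
  shows "(\<Sum>i\<in>UNIV. K (z + s *\<^sub>R v) i * v $ i) < (\<Sum>i\<in>UNIV. K (z + t *\<^sub>R v) i * v $ i)"
proof -
  have seg: "z + r *\<^sub>R v \<in> negative_orthant" if "0 \<le> r" "r \<le> 1" for r
    using segment_in_orthant[OF z u that] by simp
  define Q where "Q r = (\<Sum>i\<in>UNIV. (A (z + r *\<^sub>R v) i * v $ i
      + (\<Sum>j\<in>UNIV. B (z + r *\<^sub>R v) i j * (v $ i - v $ j))) * v $ i)" for r
  have der: "((\<lambda>r. \<Sum>i\<in>UNIV. K (z + r *\<^sub>R v) i * v $ i) has_real_derivative Q r) (at r within {0..1})"
    if r: "r \<in> {0..1}" for r
  proof -
    have "((\<lambda>r. z + r *\<^sub>R v) has_vector_derivative v) (at r within {0..1})"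
      by (auto intro!: derivative_eq_intros)
    then show ?thesis unfolding Q_def
      by (intro DERIV_sum DERIV_cmult_right K_deriv) (use r seg in auto)
  qed
  have pos: "Q r > 0" if r: "r \<in> {0..1}" for r
  proof -
    let ?w = "z + r *\<^sub>R v"
    have w: "?w \<in> negative_orthant" using r seg by auto
    have "(\<Sum>i\<in>UNIV. \<Sum>j\<in>UNIV. (B ?w i j * (v $ i - v $ j)) * v $ i)
      = (\<Sum>i\<in>UNIV. \<Sum>j\<in>UNIV. (B ?w i j * (v $ i - v $ j)) * (v $ i - v $ j)) / 2"
      by (rule sum_antisymmetric) (subst B_sym, simp add: algebra_simps)
    also have "\<dots> \<ge> 0"
      by (intro divide_nonneg_nonneg sum_nonneg) (use B_nonneg[OF w] in \<open>auto simp: mult.assoc\<close>)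
    finally have "0 \<le> (\<Sum>i\<in>UNIV. \<Sum>j\<in>UNIV. (B ?w i j * (v $ i - v $ j)) * v $ i)" .
    moreover have "(\<Sum>i\<in>UNIV. A ?w i * v $ i * v $ i) > 0"
    proof -
      obtain i where "v $ i \<noteq> 0" using v by (auto simp: vec_eq_iff)
      then have "A ?w i * v $ i * v $ i > 0"
        using A_pos[OF w, of i] by (simp add: mult.assoc zero_less_mult_iff[of "v $ i"] linorder_neq_iff disj_commute)
      moreover have "A ?w i * v $ i * v $ i \<ge> 0" for i
        using A_pos[OF w, of i] by (simp add: mult.assoc)
      ultimately show ?thesis by (intro sum_pos2[of UNIV i]) auto
    qed
    ultimately show ?thesis
      by (simp add: Q_def distrib_right sum.distrib sum_distrib_right)
  qed
  show ?thesis
  proof (rule DERIV_pos_imp_increasing_open[OF st(2)])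
    show "\<exists>y. ((\<lambda>r. \<Sum>i\<in>UNIV. K (z + r *\<^sub>R v) i * v $ i) has_real_derivative y) (at r) \<and> 0 < y"
      if "s < r" "r < t" for r
    proof (intro exI conjI)
      have "r \<in> interior {0..1}" using that st by simp
      then show "((\<lambda>r. \<Sum>i\<in>UNIV. K (z + r *\<^sub>R v) i * v $ i) has_real_derivative Q r) (at r)"
        using der[of r] at_within_interior[of r "{0..1}"] that st by auto
      show "0 < Q r" using pos that st by auto
    qed
    show "continuous_on {s..t} (\<lambda>r. \<Sum>i\<in>UNIV. K (z + r *\<^sub>R v) i * v $ i)"
      by (intro continuous_intros continuous_on_compose2[OF K_cont]) (use seg st in auto)
  qed
qed

text \<open>
  The line integral of \<open>K\<close> along the segment from \<open>z\<close> to \<open>u\<close>.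
\<close>

definition potential :: "real^'v \<Rightarrow> real^'v \<Rightarrow> real" where
  "potential z u = integral {0..1} (\<lambda>s. \<Sum>i\<in>UNIV. K (z + s *\<^sub>R (u - z)) i * (u - z) $ i)"

text \<open>
  The potential is a primitive of \<open>K\<close>: by the symmetry of the Jacobian the derivative of the
  integrand with respect to \<open>t\<close> equals the derivative with respect to \<open>s\<close> of
  \<open>\<Sum>i. s K\<^sub>i x\<^sub>i'(t)\<close>, and the latter integrates to \<open>\<Sum>i. K\<^sub>i x\<^sub>i'(t)\<close>.
\<close>

lemma potential_derivative:
  assumes z: "z \<in> negative_orthant"
    and x: "integral_curve_on H {0..} x" and neg: "\<And>t. t \<ge> 0 \<Longrightarrow> x t \<in> negative_orthant"
    and t0: "t0 \<ge> 0"
  shows "((\<lambda>t. potential z (x t)) has_real_derivative (\<Sum>i\<in>UNIV. K (x t0) i * H (x t0) $ i))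
    (at t0 within {0..})"
proof -
  define c where "c t s = z + s *\<^sub>R (x t - z)" for t s
  have c: "c t s \<in> negative_orthant" if "t \<ge> 0" "s \<in> {0..1}" for t s
    unfolding c_def using that by (intro segment_in_orthant z neg) auto
  \<comment> \<open>The derivative of the integrand with respect to \<open>t\<close>.\<close>
  define f' where "f' t s = (\<Sum>i\<in>UNIV. (A (c t s) i * (s * H (x t) $ i)
      + (\<Sum>j\<in>UNIV. B (c t s) i j * (s * H (x t) $ i - s * H (x t) $ j))) * (x t - z) $ i
      + K (c t s) i * H (x t) $ i)" for t s
  have xd: "(x has_vector_derivative H (x t)) (at t within {0..})" if "t \<ge> 0" for t
    using x that by (simp add: integral_curve_on_def)
  have xc: "continuous_on {0..} x"
    using xd has_vector_derivative_continuous continuous_on_eq_continuous_within by (metis atLeast_iff)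
  have cc: "continuous_on ({0..} \<times> {0..1}) (\<lambda>y. c (fst y) (snd y))"
    unfolding c_def by (intro continuous_intros continuous_on_compose2[OF xc]) auto
  have cn: "(\<lambda>y. c (fst y) (snd y)) ` ({0..} \<times> {0..1}) \<subseteq> negative_orthant" using c by auto
  have Kc: "continuous_on ({0..} \<times> {0..1}) (\<lambda>y. K (c (fst y) (snd y)) i)" for i
    by (rule continuous_on_compose2[OF K_cont cc cn])
  have Ac: "continuous_on ({0..} \<times> {0..1}) (\<lambda>y. A (c (fst y) (snd y)) i)" for i
    by (rule continuous_on_compose2[OF A_cont cc cn])
  have Bc: "continuous_on ({0..} \<times> {0..1}) (\<lambda>y. B (c (fst y) (snd y)) i j)" for i j
    by (rule continuous_on_compose2[OF B_cont cc cn])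
  have Hc: "continuous_on ({0..} \<times> {0..1}) (\<lambda>y. H (x (fst y)))"
    by (rule continuous_on_compose2[OF velocity_continuous], rule continuous_on_compose2[OF xc])
      (auto intro!: continuous_intros neg)
  have "((\<lambda>t. integral (cbox 0 1) (\<lambda>s. \<Sum>i\<in>UNIV. K (c t s) i * (x t - z) $ i)) has_real_derivative
     integral (cbox 0 1) (f' t0)) (at t0 within {0..})"
  proof (rule leibniz_rule_field_derivative)
    fix t s :: real assume "t \<in> {0..}" "s \<in> cbox 0 1"
    then have t: "t \<ge> 0" and s: "s \<in> {0..1}" by auto
    have "(c' has_vector_derivative s *\<^sub>R H (x t)) (at t within {0..})" if "c' = (\<lambda>t. c t s)" for c'
      unfolding that c_def by (auto intro!: derivative_eq_intros xd[OF t])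
    then have cd: "((\<lambda>t. c t s) has_vector_derivative s *\<^sub>R H (x t)) (at t within {0..})" by simp
    have Kd: "((\<lambda>t. K (c t s) i) has_real_derivative (A (c t s) i * (s * H (x t) $ i)
        + (\<Sum>j\<in>UNIV. B (c t s) i j * (s * H (x t) $ i - s * H (x t) $ j)))) (at t within {0..})" for i
      using K_deriv[OF cd _ c[OF t s]] t by simp
    have "((\<lambda>t. (x t - z) $ i) has_vector_derivative (H (x t) - 0) $ i) (at t within {0..})" for i
      by (intro bounded_linear.has_vector_derivative[OF bounded_linear_vec_nth]
          has_vector_derivative_diff xd[OF t] has_vector_derivative_const)
    then have xid: "((\<lambda>t. (x t - z) $ i) has_real_derivative H (x t) $ i) (at t within {0..})" for i
      by (simp add: has_real_derivative_iff_has_vector_derivative)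
    show "((\<lambda>t. \<Sum>i\<in>UNIV. K (c t s) i * (x t - z) $ i) has_real_derivative f' t s) (at t within {0..})"
      unfolding f'_def
      by (rule DERIV_sum, rule DERIV_cong[OF DERIV_mult[OF Kd xid]]) (simp add: algebra_simps)
  next
    fix t :: real assume "t \<in> {0..}"
    then have "continuous_on {0..1} (\<lambda>s. \<Sum>i\<in>UNIV. K (c t s) i * (x t - z) $ i)"
      by (intro continuous_intros continuous_on_compose2[OF K_cont])
        (use c in \<open>auto simp: c_def intro!: continuous_intros\<close>)
    then show "(\<lambda>s. \<Sum>i\<in>UNIV. K (c t s) i * (x t - z) $ i) integrable_on cbox 0 1"
      by (simp add: integrable_continuous_real)
  next
    have "continuous_on ({0..} \<times> {0..1}) (\<lambda>y. x (fst y))"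
      by (rule continuous_on_compose2[OF xc]) (auto intro!: continuous_intros)
    then have "continuous_on ({0..} \<times> {0..1}) (\<lambda>y. f' (fst y) (snd y))"
      unfolding f'_def by (intro continuous_intros Kc Ac Bc Hc)
    then show "continuous_on ({0..} \<times> cbox 0 1) (\<lambda>(t, s). f' t s)"
      by (simp add: case_prod_unfold)
  qed (use t0 in auto)
  moreover have "(f' t0 has_integral (\<Sum>i\<in>UNIV. K (x t0) i * H (x t0) $ i)) {0..1}"
  proof -
    let ?h = "H (x t0)" and ?v = "x t0 - z"
    have "(f' t0 has_integral (\<Sum>i\<in>UNIV. (1 * K (c t0 1) i) * ?h $ i) - (\<Sum>i\<in>UNIV. (0 * K (c t0 0) i) * ?h $ i)) {0..1}"
    proof (rule fundamental_theorem_of_calculus)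
      fix s :: real assume s: "s \<in> {0..1}"
      let ?w = "c t0 s"
      have "(c t0 has_vector_derivative ?v) (at s within {0..1})"
        unfolding c_def[abs_def] by (auto intro!: derivative_eq_intros)
      then have Kd: "((\<lambda>s. K (c t0 s) i) has_real_derivative (A ?w i * ?v $ i
        + (\<Sum>j\<in>UNIV. B ?w i j * (?v $ i - ?v $ j)))) (at s within {0..1})" for i
        by (rule K_deriv) (use s c t0 in auto)
      have "((\<lambda>s. \<Sum>i\<in>UNIV. (s * K (c t0 s) i) * ?h $ i) has_real_derivative
         (\<Sum>i\<in>UNIV. (1 * K ?w i + (A ?w i * ?v $ i
        + (\<Sum>j\<in>UNIV. B ?w i j * (?v $ i - ?v $ j))) * s) * ?h $ i)) (at s within {0..1})"
        by (intro DERIV_sum DERIV_cmult_right DERIV_mult DERIV_ident Kd)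
      moreover have "(\<Sum>i\<in>UNIV. (1 * K ?w i + (A ?w i * ?v $ i
        + (\<Sum>j\<in>UNIV. B ?w i j * (?v $ i - ?v $ j))) * s) * ?h $ i) = f' t0 s"
      proof -
        have "(\<Sum>i\<in>UNIV. \<Sum>j\<in>UNIV. (B ?w i j * (?v $ i - ?v $ j)) * ?h $ i)
          = (\<Sum>i\<in>UNIV. \<Sum>j\<in>UNIV. (B ?w i j * (?v $ i - ?v $ j)) * (?h $ i - ?h $ j)) / 2"
          by (rule sum_antisymmetric) (subst B_sym, simp add: algebra_simps)
        also have "\<dots> = (\<Sum>i\<in>UNIV. \<Sum>j\<in>UNIV. (B ?w i j * (?h $ i - ?h $ j)) * (?v $ i - ?v $ j)) / 2"
          by (simp add: mult_ac)
        also have "\<dots> = (\<Sum>i\<in>UNIV. \<Sum>j\<in>UNIV. (B ?w i j * (?h $ i - ?h $ j)) * ?v $ i)"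
          by (rule sum_antisymmetric[symmetric]) (subst B_sym, simp add: algebra_simps)
        finally have sym: "(\<Sum>i\<in>UNIV. (\<Sum>j\<in>UNIV. B ?w i j * (?v $ i - ?v $ j)) * ?h $ i)
          = (\<Sum>i\<in>UNIV. (\<Sum>j\<in>UNIV. B ?w i j * (?h $ i - ?h $ j)) * ?v $ i)"
          by (simp only: sum_distrib_right)
        have "(\<Sum>i\<in>UNIV. (1 * K ?w i + (A ?w i * ?v $ i
            + (\<Sum>j\<in>UNIV. B ?w i j * (?v $ i - ?v $ j))) * s) * ?h $ i)
          = (\<Sum>i\<in>UNIV. K ?w i * ?h $ i + s * (A ?w i * ?v $ i * ?h $ i)
              + s * ((\<Sum>j\<in>UNIV. B ?w i j * (?v $ i - ?v $ j)) * ?h $ i))"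
          by (rule sum.cong[OF refl]) (simp only: distrib_right distrib_left mult_ac mult_1_left)
        also have "\<dots> = (\<Sum>i\<in>UNIV. K ?w i * ?h $ i) + s * (\<Sum>i\<in>UNIV. A ?w i * ?v $ i * ?h $ i)
            + s * (\<Sum>i\<in>UNIV. (\<Sum>j\<in>UNIV. B ?w i j * (?v $ i - ?v $ j)) * ?h $ i)"
          by (simp only: sum.distrib sum_distrib_left)
        also have "\<dots> = (\<Sum>i\<in>UNIV. K ?w i * ?h $ i + s * (A ?w i * ?v $ i * ?h $ i)
              + s * ((\<Sum>j\<in>UNIV. B ?w i j * (?h $ i - ?h $ j)) * ?v $ i))"
          unfolding sym by (simp only: sum.distrib sum_distrib_left)
        also have "\<dots> = f' t0 s"
          unfolding f'_def right_diff_distrib[of s, symmetric] mult.left_commute[of "B _ _ _" s]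
            sum_distrib_left[symmetric]
          by (rule sum.cong[OF refl]) (simp only: distrib_right distrib_left mult_ac add_ac)
        finally show ?thesis .
      qed
      ultimately show "((\<lambda>s. \<Sum>i\<in>UNIV. (s * K (c t0 s) i) * ?h $ i) has_vector_derivative f' t0 s) (at s within {0..1})"
        by (simp add: has_real_derivative_iff_has_vector_derivative)
    qed simp
    then show ?thesis by (simp add: c_def)
  qed
  ultimately show ?thesis
    by (simp add: potential_def c_def integral_unique)
qed

text \<open>
  The radial derivative of the potential with base point \<open>z\<close>, multiplied by the distance from \<open>z\<close>.
\<close>

definition pairing :: "real^'v \<Rightarrow> real^'v \<Rightarrow> real" where
  "pairing z v = (\<Sum>i\<in>UNIV. K (z + v) i * v $ i)"

lemma pairing_continuous: "continuous_on {v. z + v \<in> negative_orthant} (pairing z)"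
proof -
  have "continuous_on {v. z + v \<in> negative_orthant} (\<lambda>v. K (z + v) i)" for i
    by (rule continuous_on_compose2[OF K_cont]) (auto intro!: continuous_intros)
  then show ?thesis unfolding pairing_def by (intro continuous_intros)
qed

lemma pairing_scale_mono:
  assumes z: "z \<in> negative_orthant" and u: "z + v \<in> negative_orthant"
    and st: "0 < s" "s \<le> t" "t \<le> 1"
  shows "pairing z (s *\<^sub>R v) / s \<le> (\<Sum>i\<in>UNIV. K (z + t *\<^sub>R v) i * v $ i)"
proof -
  have "pairing z (s *\<^sub>R v) / s = (\<Sum>i\<in>UNIV. K (z + s *\<^sub>R v) i * v $ i)"
    using st(1) by (simp add: pairing_def sum_divide_distrib)
  also have "\<dots> \<le> (\<Sum>i\<in>UNIV. K (z + t *\<^sub>R v) i * v $ i)"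
    using gradient_pairing_increasing[OF z u, of s t] st by (cases "v = 0 \<or> s = t") auto
  finally show ?thesis .
qed

context
  fixes z assumes z: "z \<in> negative_orthant" and flat: "\<And>i. K z i = 0"
begin

lemma pairing_nonneg:
  assumes "z + v \<in> negative_orthant" "0 \<le> t" "t \<le> 1"
  shows "(\<Sum>i\<in>UNIV. K (z + t *\<^sub>R v) i * v $ i) \<ge> 0"
  using gradient_pairing_increasing[OF z assms(1), of 0 t] assms flat by (cases "v = 0 \<or> t = 0") auto

lemma pairing_pos:
  assumes "z + v \<in> negative_orthant" "v \<noteq> 0"
  shows "pairing z v > 0"
  using gradient_pairing_increasing[OF z assms, of 0 1] flat by (simp add: pairing_def)

lemma integrand_integrable:
  assumes "u \<in> negative_orthant"
  shows "(\<lambda>s. \<Sum>i\<in>UNIV. K (z + s *\<^sub>R (u - z)) i * (u - z) $ i) integrable_on {0..1}"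
  by (intro integrable_continuous_real continuous_intros continuous_on_compose2[OF K_cont])
    (use segment_in_orthant[OF z assms] in \<open>auto intro!: continuous_intros\<close>)

lemma potential_nonneg:
  assumes "u \<in> negative_orthant" shows "potential z u \<ge> 0"
  unfolding potential_def
  by (rule integral_nonneg[OF integrand_integrable[OF assms]]) (use pairing_nonneg[of "u - z"] assms in auto)

lemma potential_le_pairing:
  assumes u: "u \<in> negative_orthant" shows "potential z u \<le> pairing z (u - z)"
proof -
  have "potential z u \<le> integral {0..1} (\<lambda>s::real. pairing z (u - z))"
    unfolding potential_def
  proof (rule integral_le[OF integrand_integrable[OF u] integrable_const_ivl])
    fix s :: real assume "s \<in> {0..1}"
    then show "(\<Sum>i\<in>UNIV. K (z + s *\<^sub>R (u - z)) i * (u - z) $ i) \<le> pairing z (u - z)"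
      using gradient_pairing_increasing[OF z, of "u - z" s 1] u
      by (cases "u = z \<or> s = 1") (auto simp: pairing_def)
  qed
  then show ?thesis by simp
qed

text \<open>
  Convexity: the radial derivative of the potential at distance at least \<open>\<rho>\<close> is bounded below
  by its positive minimum \<open>pairing z w / \<rho>\<close> over the sphere of radius \<open>\<rho>\<close>. For \<open>\<rho> \<le> \<epsilon> / 2\<close> this applies to
  the outer half of every segment that is longer than \<open>\<epsilon>\<close>.
\<close>

lemma potential_linear_growth:
  assumes e: "\<epsilon> > 0"
  obtains c where "c > 0"
    "\<And>u. u \<in> negative_orthant \<Longrightarrow> \<epsilon> \<le> norm (u - z) \<Longrightarrow> c * norm (u - z) \<le> potential z u"
proof -
  obtain \<rho>0 where \<rho>0: "\<rho>0 > 0" "cball z \<rho>0 \<subseteq> negative_orthant"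
    using open_negative_orthant z open_contains_cball by metis
  define \<rho> where "\<rho> = min \<rho>0 (\<epsilon> / 2)"
  have \<rho>: "\<rho> > 0" "\<rho> \<le> \<rho>0" "2 * \<rho> \<le> \<epsilon>" using \<rho>0 e by (auto simp: \<rho>_def)
  have ball: "z + v \<in> negative_orthant" if "norm v \<le> \<rho>" for v
    using that \<rho>(2) by (intro subsetD[OF \<rho>0(2)]) (simp add: dist_norm)
  have "\<exists>w\<in>sphere 0 \<rho>. \<forall>v\<in>sphere 0 \<rho>. pairing z w \<le> pairing z v"
  proof (rule continuous_attains_inf)
    show "sphere (0 :: real^'v) \<rho> \<noteq> {}" using \<rho>(1) by simp
    show "continuous_on (sphere 0 \<rho>) (pairing z)"
      using ball by (intro continuous_on_subset[OF pairing_continuous]) auto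
  qed simp
  then obtain w where w: "norm w = \<rho>" "\<And>v. norm v = \<rho> \<Longrightarrow> pairing z w \<le> pairing z v" by auto
  have m: "pairing z w > 0" using w(1) \<rho> ball by (intro pairing_pos) auto
  show ?thesis
  proof (rule that)
    show "pairing z w / (2 * \<rho>) > 0" using m \<rho> by simp
    fix u assume u: "u \<in> negative_orthant" and far: "\<epsilon> \<le> norm (u - z)"
    define v where "v = u - z"
    define N where "N = norm v"
    have N: "N > 0" "2 * \<rho> \<le> N" using far \<rho> by (auto simp: N_def v_def)
    have s: "0 < \<rho> / N" "\<rho> / N \<le> 1 / 2" using N \<rho> by (auto simp: field_simps)
    have zv: "z + v \<in> negative_orthant" using u by (simp add: v_def)
    have "pairing z w \<le> pairing z ((\<rho> / N) *\<^sub>R v)"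
      using N \<rho> by (intro w(2)) (simp add: N_def)
    then have low: "pairing z w * N / \<rho> \<le> (\<Sum>i\<in>UNIV. K (z + t *\<^sub>R v) i * v $ i)" if "t \<in> {1/2..1}" for t
    proof -
      have "pairing z w * N / \<rho> \<le> pairing z ((\<rho> / N) *\<^sub>R v) / (\<rho> / N)"
        using \<open>pairing z w \<le> _\<close> N \<rho> by (simp add: field_simps)
      also have "\<dots> \<le> (\<Sum>i\<in>UNIV. K (z + t *\<^sub>R v) i * v $ i)"
      proof (rule pairing_scale_mono[OF z zv s(1)])
        show "\<rho> / N \<le> t" using s(2) that unfolding atLeastAtMost_iff by linarith
      qed (use that in simp)
      finally show ?thesis .
    qed
    have sub: "{1/2..1} \<subseteq> {0..1::real}" by auto
    have int: "(\<lambda>s. \<Sum>i\<in>UNIV. K (z + s *\<^sub>R v) i * v $ i) integrable_on {0..1}"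
      using integrand_integrable[OF u] by (simp add: v_def)
    have int': "(\<lambda>s. \<Sum>i\<in>UNIV. K (z + s *\<^sub>R v) i * v $ i) integrable_on {1/2..1}"
      by (rule integrable_on_subinterval[OF int sub])
    have "pairing z w * N / (2 * \<rho>) = integral {1/2..1::real} (\<lambda>_. pairing z w * N / \<rho>)"
      by (simp add: field_simps)
    also have "\<dots> \<le> integral {1/2..1} (\<lambda>s. \<Sum>i\<in>UNIV. K (z + s *\<^sub>R v) i * v $ i)"
      by (rule integral_le[OF integrable_const_ivl int' low])
    also have "\<dots> \<le> potential z u"
      unfolding potential_def v_def[symmetric]
      by (rule integral_subset_le[OF sub int' int]) (use pairing_nonneg[OF zv] in auto)
    finally show "pairing z w / (2 * \<rho>) * norm (u - z) \<le> potential z u"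
      by (simp add: N_def v_def)
  qed
qed

text \<open>
  The potential decreases along the flow. By its growth the solution stays bounded, hence in
  a compact part of the orthant, where the dissipation is bounded away from zero outside any
  neighbourhood of \<open>z\<close>; so the solution must come close to \<open>z\<close> at some time. At that time the
  potential is small, it remains small, and a small potential keeps the solution close to \<open>z\<close>.
\<close>

theorem convergence_to_flat:
  assumes x: "integral_curve_on H {0..} x" and neg: "\<And>t. t \<ge> 0 \<Longrightarrow> x t \<in> negative_orthant"
  shows "(x \<longlongrightarrow> z) at_top"
proof -
  let ?W = "\<lambda>t. potential z (x t)"
  let ?D = "\<lambda>u. \<Sum>i\<in>UNIV. A u i * (K u i)\<^sup>2"
  have Wd: "(?W has_vector_derivative (\<Sum>i\<in>UNIV. K (x t) i * H (x t) $ i)) (at t within {0..})"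
    if "t \<ge> 0" for t
    using potential_derivative[OF z x neg that] by (simp add: has_real_derivative_iff_has_vector_derivative)
  have diss: "(\<Sum>i\<in>UNIV. K (x t) i * H (x t) $ i) \<le> - ?D (x t)" if "t \<ge> 0" for t
    using energy_dissipation[OF neg[OF that]] .
  have D0: "?D u \<ge> 0" if "u \<in> negative_orthant" for u
    using A_pos[OF that] by (intro sum_nonneg) (simp add: less_imp_le)
  have Wmono: "?W t \<le> ?W s" if "0 \<le> s" "s \<le> t" for s t
  proof (rule derivative_barrier[of "{0..}" s t ?W])
    show "(\<Sum>i\<in>UNIV. K (x r) i * H (x r) $ i) \<le> 0" if "r \<in> {0..}" for r
      using diss[of r] D0[OF neg[of r]] that by simp
  qed (use that Wd in \<open>auto simp: is_interval_ci\<close>)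
  obtain b where b: "b < 0" "\<And>t i. t \<ge> 0 \<Longrightarrow> x t $ i \<le> b"
    by (rule uniform_upper_bound[OF _ _ _ x neg]) (auto simp: is_interval_ci)
  obtain R where R: "\<And>t. t \<ge> 0 \<Longrightarrow> norm (x t - z) \<le> R"
  proof -
    obtain c where c: "c > 0"
      "\<And>u. u \<in> negative_orthant \<Longrightarrow> 1 \<le> norm (u - z) \<Longrightarrow> c * norm (u - z) \<le> potential z u"
      using potential_linear_growth[of 1] by auto
    have "norm (x t - z) \<le> max 1 (?W 0 / c)" if t: "t \<ge> 0" for t
    proof (cases "norm (x t - z) \<le> 1")
      case False
      then have "c * norm (x t - z) \<le> ?W 0"
        using c(2)[OF neg[OF t]] Wmono[of 0 t] t by linarith
      then show ?thesis using c(1) by (simp add: field_simps max.coboundedI2)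
    qed simp
    then show ?thesis using that by blast
  qed
  have enters: "\<exists>t\<ge>0. norm (x t - z) < \<delta>" if \<delta>: "\<delta> > 0" for \<delta>
  proof (rule ccontr)
    assume "\<not> (\<exists>t\<ge>0. norm (x t - z) < \<delta>)"
    then have far: "\<And>t. t \<ge> 0 \<Longrightarrow> \<delta> \<le> norm (x t - z)" by force
    define C where "C = {u. \<delta> \<le> norm (u - z)} \<inter> {u. \<forall>i. u $ i \<le> b} \<inter> cball z R"
    have C: "x t \<in> C" if "t \<ge> 0" for t
      using far R b that by (auto simp: C_def dist_norm norm_minus_commute)
    have Cneg: "C \<subseteq> negative_orthant" using b(1) by (auto simp: C_def negative_orthant_def intro: le_less_trans)
    have "closed {u :: real^'v. \<forall>i. u $ i \<le> b}"
      by (intro closed_Collect_all closed_Collect_le continuous_intros)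
    then have "compact C" unfolding C_def
      by (intro closed_Int_compact closed_Int closed_Collect_le continuous_intros) auto
    moreover have "continuous_on C ?D"
      by (intro continuous_intros continuous_on_subset[OF A_cont Cneg] continuous_on_subset[OF K_cont Cneg])
    ultimately obtain w where w: "w \<in> C" "\<And>u. u \<in> C \<Longrightarrow> ?D w \<le> ?D u"
      using continuous_attains_inf[of C ?D] C[of 0] by auto
    have "w \<noteq> z" using w(1) \<delta> by (auto simp: C_def)
    have wneg: "w \<in> negative_orthant" using w(1) Cneg by auto
    have "\<exists>i. K w i \<noteq> 0"
    proof (rule ccontr)
      assume "\<not> (\<exists>i. K w i \<noteq> 0)"
      then show False using pairing_pos[of "w - z"] \<open>w \<noteq> z\<close> wneg by (simp add: pairing_def)
    qed
    then obtain i where "K w i \<noteq> 0" by blast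
    then have "?D w > 0"
      using A_pos[OF wneg] by (intro sum_pos2[of UNIV i]) (auto simp: less_imp_le)
    define d where "d = ?D w"
    have d: "d > 0" using \<open>?D w > 0\<close> by (simp add: d_def)
    have "?W t + d * t \<le> ?W 0" if t: "t \<ge> 0" for t
    proof (rule derivative_barrier[of "{0..}" 0 t "\<lambda>t. ?W t + d * t"])
      show "((\<lambda>t. ?W t + d * t) has_vector_derivative (\<Sum>i\<in>UNIV. K (x s) i * H (x s) $ i) + d)
        (at s within {0..})" if "s \<in> {0..}" for s
        using that by (auto intro!: derivative_eq_intros Wd)
      show "(\<Sum>i\<in>UNIV. K (x s) i * H (x s) $ i) + d \<le> 0" if "s \<in> {0..}" for s
        using diss[of s] w(2)[OF C[of s]] that by (simp add: d_def)
    qed (use t in \<open>auto simp: is_interval_ci\<close>)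
    from this[of "(?W 0 + 1) / d"] potential_nonneg[OF neg[of 0]] potential_nonneg[OF neg[of "(?W 0 + 1) / d"]]
    show False using d by simp
  qed
  show ?thesis
  proof (rule tendstoI)
    fix \<epsilon> :: real assume \<epsilon>: "\<epsilon> > 0"
    obtain c where c: "c > 0"
      "\<And>u. u \<in> negative_orthant \<Longrightarrow> \<epsilon> \<le> norm (u - z) \<Longrightarrow> c * norm (u - z) \<le> potential z u"
      using potential_linear_growth[OF \<epsilon>] by auto
    have op: "open {v. z + v \<in> negative_orthant}"
      using open_vimage[OF open_negative_orthant, of "\<lambda>v. z + v"] by (simp add: vimage_def continuous_intros)
    have "isCont (pairing z) 0"
      using pairing_continuous[of z] continuous_on_eq_continuous_at[OF op, of "pairing z"] z by simp
    then have "\<forall>\<^sub>F v in at 0. dist (pairing z v) (pairing z 0) < c * \<epsilon>"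
      using c(1) \<epsilon> by (intro tendstoD) (auto simp: isCont_def)
    then obtain \<delta> where \<delta>: "\<delta> > 0" "\<And>v. v \<noteq> 0 \<Longrightarrow> dist v 0 < \<delta> \<Longrightarrow> dist (pairing z v) (pairing z 0) < c * \<epsilon>"
      unfolding eventually_at by blast
    have small: "pairing z v < c * \<epsilon>" if "norm v < \<delta>" for v
      using \<delta>(2)[of v] that c(1) \<epsilon> by (cases "v = 0") (auto simp: pairing_def dist_norm)
    obtain T where T: "T \<ge> 0" "norm (x T - z) < \<delta>" using enters[OF \<delta>(1)] by blast
    have "dist (x t) z < \<epsilon>" if t: "t \<ge> T" for t
    proof (rule ccontr)
      assume "\<not> dist (x t) z < \<epsilon>"
      then have far: "\<epsilon> \<le> norm (x t - z)" by (simp add: dist_norm)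
      have "c * \<epsilon> \<le> c * norm (x t - z)" using c(1) far by simp
      also have "\<dots> \<le> ?W t" using c(2)[OF neg far] t T by simp
      also have "\<dots> \<le> ?W T" using Wmono t T by simp
      also have "\<dots> < c * \<epsilon>" using potential_le_pairing[OF neg[OF T(1)]] small[OF T(2)] by simp
      finally show False by simp
    qed
    then show "\<forall>\<^sub>F t in at_top. dist (x t) z < \<epsilon>"
      using eventually_at_top_linorder by blast
  qed
qed

end

text \<open>
  If \<open>H z $ j \<noteq> 0\<close>, then eventually \<open>x $ j\<close> would change by more than \<open>d = |H z $ j| / 2\<close> during
  each unit of time, although it converges. So the limit is a rest point.
\<close>

lemma limit_is_flat:
  assumes x: "integral_curve_on H {0..} x" and neg: "\<And>t. t \<ge> 0 \<Longrightarrow> x t \<in> negative_orthant"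
    and lim: "(x \<longlongrightarrow> z) at_top" and z: "z \<in> negative_orthant"
  shows "K z i = 0"
proof (rule stationary_imp_flat[OF z])
  have "((\<lambda>t. H (x t)) \<longlongrightarrow> H z) at_top"
    using velocity_continuous continuous_on_eq_continuous_at[OF open_negative_orthant] z lim
    by (intro isCont_tendsto_compose[of _ H]) blast+
  then have Hlim: "((\<lambda>t. H (x t) $ j) \<longlongrightarrow> H z $ j) at_top" for j by (rule tendsto_vec_nth)
  have "H z $ j = 0" for j
  proof (rule ccontr)
    assume nz: "H z $ j \<noteq> 0"
    define d where "d = \<bar>H z $ j\<bar> / 2"
    have d: "d > 0" using nz by (simp add: d_def)
    have xd: "((\<lambda>t. x t $ j) has_vector_derivative H (x t) $ j) (at t within {0..})" if "t \<ge> 0" for t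
      by (rule bounded_linear.has_vector_derivative[OF bounded_linear_vec_nth])
        (use x that in \<open>auto simp: integral_curve_on_def\<close>)
    have "\<forall>\<^sub>F t in at_top. dist (H (x t) $ j) (H z $ j) < d" by (rule tendstoD[OF Hlim d])
    moreover have "\<forall>\<^sub>F t in at_top. dist (x t $ j) (z $ j) < d / 2"
      by (rule tendstoD[OF tendsto_vec_nth[OF lim]]) (use d in simp)
    ultimately have "\<forall>\<^sub>F t in at_top. dist (H (x t) $ j) (H z $ j) < d \<and> dist (x t $ j) (z $ j) < d / 2 \<and> t \<ge> 0"
      using eventually_ge_at_top[of 0] by eventually_elim simp
    then obtain T where T: "\<And>t. t \<ge> T \<Longrightarrow> dist (H (x t) $ j) (H z $ j) < d \<and> dist (x t $ j) (z $ j) < d / 2 \<and> t \<ge> 0"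
      by (auto simp: eventually_at_top_linorder)
    have "\<exists>\<xi>\<in>{T<..<T+1}. x (T + 1) $ j - x T $ j = H (x \<xi>) $ j * (T + 1 - T)"
    proof (rule mvt_simple[of _ _ "\<lambda>t. x t $ j" "\<lambda>t h. H (x t) $ j * h"])
      fix t assume t: "T \<le> t" "t \<le> T + 1"
      have "((\<lambda>t. x t $ j) has_vector_derivative H (x t) $ j) (at t within {T..T+1})"
        by (rule has_vector_derivative_within_subset[OF xd]) (use T t in auto)
      then show "((\<lambda>t. x t $ j) has_derivative (*) (H (x t) $ j)) (at t within {T..T + 1})"
        by (simp add: has_vector_derivative_def mult.commute[of _ "H (x t) $ j"])
    qed simp
    then obtain \<xi> where \<xi>: "\<xi> > T" "x (T + 1) $ j - x T $ j = H (x \<xi>) $ j" by auto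
    have "\<bar>H (x \<xi>) $ j\<bar> < d"
      using T[of T] T[of "T + 1"] \<xi>(2) unfolding dist_real_def by (auto simp: abs_if split: if_splits)
    moreover have "\<bar>H (x \<xi>) $ j - H z $ j\<bar> < d" using T[of \<xi>] \<xi>(1) by (simp add: dist_real_def)
    ultimately show False unfolding d_def by linarith
  qed
  then show "H z = 0" by (simp add: vec_eq_iff)
qed

end

section \<open>Trigonometry in the Klein model\<close>

text \<open>
  The Lorentz product of the points \<open>(1, x)\<close> and \<open>(1, y)\<close> of Minkowski space, which represent
  \<open>x\<close> and \<open>y\<close> in the projective model. All of the trigonometry of the disc is expressed by it.
\<close>

definition lorentz :: "real^2 \<Rightarrow> real^2 \<Rightarrow> real" where
  "lorentz x y = 1 - x \<bullet> y"

definition klein_cosh :: "real^2 \<Rightarrow> real^2 \<Rightarrow> real" where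
  "klein_cosh x y = lorentz x y / (sqrt (lorentz x x) * sqrt (lorentz y y))"

lemma lorentz_commute: "lorentz x y = lorentz y x"
  by (simp add: lorentz_def inner_commute)

lemma klein_cosh_commute: "klein_cosh x y = klein_cosh y x"
  by (simp add: klein_cosh_def lorentz_commute mult.commute)

lemma lorentz_self: "lorentz x x = 1 - (norm x)\<^sup>2"
  by (simp add: lorentz_def power2_norm_eq_inner)

lemma lorentz_self_pos: "norm x < 1 \<Longrightarrow> lorentz x x > 0"
  by (simp add: lorentz_self abs_square_less_1)

lemma lorentz_self_pos_iff: "lorentz x x > 0 \<longleftrightarrow> norm x < 1"
  by (simp add: lorentz_self abs_square_less_1)

lemma lorentz_pos:
  assumes "norm x < 1" "norm y < 1" shows "lorentz x y > 0"
proof -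
  have "x \<bullet> y \<le> norm x * norm y" by (rule norm_cauchy_schwarz)
  also have "\<dots> \<le> norm x" using assms by (simp add: mult_left_le)
  also have "\<dots> < 1" by (rule assms)
  finally show ?thesis by (simp add: lorentz_def)
qed

lemma klein_metric_lorentz:
  assumes "norm x < 1"
  shows "klein_metric x (y - x) (z - x)
    = (lorentz x y * lorentz x z - lorentz x x * lorentz y z) / (lorentz x x)\<^sup>2"
proof -
  have N: "lorentz x x > 0" using lorentz_self_pos[OF assms] .
  have "klein_metric x (y - x) (z - x)
      = (y - x) \<bullet> (z - x) / lorentz x x + (x \<bullet> (y - x)) * (x \<bullet> (z - x)) / (lorentz x x)\<^sup>2"
    by (simp add: klein_metric_def lorentz_self)
  also have "\<dots> = ((y - x) \<bullet> (z - x) * lorentz x x + (x \<bullet> (y - x)) * (x \<bullet> (z - x))) / (lorentz x x)\<^sup>2"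
    using N by (simp add: field_simps power2_eq_square)
  also have "(y - x) \<bullet> (z - x) * lorentz x x + (x \<bullet> (y - x)) * (x \<bullet> (z - x))
      = lorentz x y * lorentz x z - lorentz x x * lorentz y z"
    by (simp add: lorentz_def inner_diff_left inner_diff_right inner_commute[of y x] inner_commute[of z x]
        algebra_simps)
  finally show ?thesis .
qed

text \<open>
  The metric is a positive multiple of the Euclidean one plus a square.
\<close>

lemma klein_metric_pos:
  assumes "norm x < 1" "v \<noteq> 0" shows "klein_metric x v v > 0"
proof -
  have "klein_metric x v v = (v \<bullet> v) / lorentz x x + ((x \<bullet> v) / lorentz x x)\<^sup>2"
    by (simp add: klein_metric_def lorentz_self power_divide power2_eq_square)
  then show ?thesis using assms lorentz_self_pos[OF assms(1)] by (simp add: add_pos_nonneg)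
qed

text \<open>
  By \<open>klein_metric_lorentz\<close> the difference of the two sides is a positive multiple of
  \<open>klein_metric x (y - x) (y - x)\<close>.
\<close>

lemma reversed_cauchy_schwarz:
  assumes "norm x < 1" "x \<noteq> y"
  shows "lorentz x x * lorentz y y < (lorentz x y)\<^sup>2"
  using klein_metric_pos[of x "y - x"] klein_metric_lorentz[of x y y] assms lorentz_self_pos[of x]
  by (simp add: zero_less_divide_iff power2_eq_square)

lemma klein_cosh_self: "norm x < 1 \<Longrightarrow> klein_cosh x x = 1"
  using lorentz_self_pos[of x] by (simp add: klein_cosh_def)

lemma klein_cosh_sq:
  assumes "norm x < 1" "norm y < 1"
  shows "(klein_cosh x y)\<^sup>2 - 1
    = ((lorentz x y)\<^sup>2 - lorentz x x * lorentz y y) / (lorentz x x * lorentz y y)"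
  using lorentz_self_pos[OF assms(1)] lorentz_self_pos[OF assms(2)]
  by (simp add: klein_cosh_def power_divide power_mult_distrib diff_divide_distrib)

lemma klein_cosh_gt_1:
  assumes "norm x < 1" "norm y < 1" "x \<noteq> y" shows "klein_cosh x y > 1"
proof -
  have "(klein_cosh x y)\<^sup>2 - 1 > 0"
    using reversed_cauchy_schwarz[OF assms(1,3)] lorentz_self_pos[OF assms(1)] lorentz_self_pos[OF assms(2)]
    by (subst klein_cosh_sq[OF assms(1,2)]) simp
  moreover have "klein_cosh x y > 0"
    using lorentz_pos[OF assms(1,2)] lorentz_self_pos[OF assms(1)] lorentz_self_pos[OF assms(2)]
    by (simp add: klein_cosh_def)
  ultimately show ?thesis using power_less_imp_less_base[of 1 2 "klein_cosh x y"] by simp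
qed

lemma klein_cosh_ge_1:
  assumes "norm x < 1" "norm y < 1" shows "klein_cosh x y \<ge> 1"
  using klein_cosh_gt_1[OF assms] klein_cosh_self[OF assms(1)] by (cases "x = y") auto

lemma klein_dist_eq_arcosh: "klein_dist x y = arcosh (klein_cosh x y)"
  by (simp add: klein_dist_def klein_cosh_def lorentz_self) (simp add: lorentz_def)

lemma klein_dist_eq_iff:
  assumes "norm x < 1" "norm y < 1" "C \<ge> 1"
  shows "klein_dist x y = arcosh C \<longleftrightarrow> klein_cosh x y = C"
  using klein_cosh_ge_1[OF assms(1,2)] assms(3) cosh_arcosh_real unfolding klein_dist_eq_arcosh by metis

text \<open>
  The angle, in a hyperbolic triangle, between sides with hyperbolic cosines \<open>a\<close> and \<open>b\<close>,
  opposite to a side with hyperbolic cosine \<open>c\<close>.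
\<close>

definition triangle_angle :: "real \<Rightarrow> real \<Rightarrow> real \<Rightarrow> real" where
  "triangle_angle a b c = arccos ((a * b - c) / (sqrt (a\<^sup>2 - 1) * sqrt (b\<^sup>2 - 1)))"

lemma triangle_angle_commute: "triangle_angle a b c = triangle_angle b a c"
  by (simp add: triangle_angle_def mult.commute)

text \<open>
  The factors \<open>(lorentz x x)\<^sup>2\<close> in the denominators of \<open>klein_metric_lorentz\<close> cancel.
\<close>

lemma klein_angle_lorentz:
  assumes x: "norm x < 1"
  shows "klein_angle x y z = arccos ((lorentz x y * lorentz x z - lorentz x x * lorentz y z)
    / (sqrt ((lorentz x y)\<^sup>2 - lorentz x x * lorentz y y) * sqrt ((lorentz x z)\<^sup>2 - lorentz x x * lorentz z z)))"
proof -
  define N P Q R where "N = lorentz x x" and "P = (lorentz x y)\<^sup>2 - lorentz x x * lorentz y y"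
    and "Q = (lorentz x z)\<^sup>2 - lorentz x x * lorentz z z"
    and "R = lorentz x y * lorentz x z - lorentz x x * lorentz y z"
  have N: "N > 0" using lorentz_self_pos[OF x] by (simp add: N_def)
  have m: "klein_metric x (y - x) (y - x) = P / N\<^sup>2" "klein_metric x (z - x) (z - x) = Q / N\<^sup>2"
    "klein_metric x (y - x) (z - x) = R / N\<^sup>2"
    by (simp_all add: klein_metric_lorentz[OF x] P_def Q_def R_def N_def power2_eq_square)
  have "R / N\<^sup>2 / (sqrt (P / N\<^sup>2) * sqrt (Q / N\<^sup>2)) = R / (sqrt P * sqrt Q)"
    using N by (simp add: real_sqrt_divide power2_eq_square)
  then show ?thesis by (simp only: klein_angle_def m P_def Q_def R_def)
qed

lemma klein_law_of_cosines:
  assumes x: "norm x < 1" and y: "norm y < 1" and z: "norm z < 1"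
  shows "klein_angle x y z = triangle_angle (klein_cosh x y) (klein_cosh x z) (klein_cosh y z)"
proof -
  define N Y Z where "N = lorentz x x" and "Y = lorentz y y" and "Z = lorentz z z"
  have pos: "N > 0" "Y > 0" "Z > 0" using assms by (auto simp: N_def Y_def Z_def intro: lorentz_self_pos)
  define P Q R where "P = (lorentz x y)\<^sup>2 - N * Y" and "Q = (lorentz x z)\<^sup>2 - N * Z"
    and "R = lorentz x y * lorentz x z - N * lorentz y z"
  have s: "sqrt ((klein_cosh x y)\<^sup>2 - 1) = sqrt P / (sqrt N * sqrt Y)"
    "sqrt ((klein_cosh x z)\<^sup>2 - 1) = sqrt Q / (sqrt N * sqrt Z)"
    by (simp_all add: klein_cosh_sq x y z P_def Q_def N_def Y_def Z_def real_sqrt_divide real_sqrt_mult)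
  have n: "klein_cosh x y * klein_cosh x z - klein_cosh y z = R / (N * (sqrt Y * sqrt Z))"
    using pos by (simp add: klein_cosh_def R_def N_def[symmetric] Y_def[symmetric] Z_def[symmetric]
        field_simps real_sqrt_mult_self)
  have "R / (N * (sqrt Y * sqrt Z)) / (sqrt P / (sqrt N * sqrt Y) * (sqrt Q / (sqrt N * sqrt Z)))
      = R / (sqrt P * sqrt Q)"
    using pos by (simp add: field_simps)
  then show ?thesis
    unfolding triangle_angle_def s n klein_angle_lorentz[OF x]
    by (simp only: P_def Q_def R_def N_def Y_def Z_def)
qed

text \<open>
  The Gram determinant of three unit timelike vectors with mutual Lorentz products \<open>a\<close>, \<open>b\<close>, \<open>c\<close>.
  It is positive exactly when they are the vertices of a nondegenerate triangle; it plays
  the role of the strict triangle inequalities.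
\<close>

definition gram_det :: "real \<Rightarrow> real \<Rightarrow> real \<Rightarrow> real" where
  "gram_det a b c = 1 + 2 * a * b * c - a\<^sup>2 - b\<^sup>2 - c\<^sup>2"

text \<open>
  \<open>gram_det a b c = (a\<^sup>2 - 1) (b\<^sup>2 - 1) - (a b - c)\<^sup>2\<close>.
\<close>

lemma cosine_in_range:
  assumes "a > 1" "b > 1" "gram_det a b c > 0"
  shows "\<bar>(a * b - c) / (sqrt (a\<^sup>2 - 1) * sqrt (b\<^sup>2 - 1))\<bar> < 1"
proof -
  have ab: "a\<^sup>2 - 1 > 0" "b\<^sup>2 - 1 > 0" using assms by (simp_all add: one_less_power)
  have "(a * b - c)\<^sup>2 < (a\<^sup>2 - 1) * (b\<^sup>2 - 1)"
    using assms(3) by (simp add: gram_det_def power2_eq_square algebra_simps)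
  then have "sqrt ((a * b - c)\<^sup>2) < sqrt ((a\<^sup>2 - 1) * (b\<^sup>2 - 1))" by (rule real_sqrt_less_mono)
  then have "\<bar>a * b - c\<bar> < sqrt (a\<^sup>2 - 1) * sqrt (b\<^sup>2 - 1)" by (simp add: real_sqrt_mult)
  then show ?thesis using ab by (simp add: abs_mult)
qed

text \<open>
  One vertex is the centre of the disc. There the Klein angle is the Euclidean angle, and a
  distance \<open>l\<close> from the centre corresponds to the Euclidean radius \<open>tanh l\<close>.
\<close>

lemma triangle_exists:
  assumes "a > 1" "b > 1" "gram_det a b c > 0"
  obtains y z where "norm y < 1" "norm z < 1" "klein_cosh 0 y = a" "klein_cosh 0 z = b" "klein_cosh y z = c"
proof -
  define k where "k = (a * b - c) / (sqrt (a\<^sup>2 - 1) * sqrt (b\<^sup>2 - 1))"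
  have k: "k\<^sup>2 \<le> 1" using cosine_in_range[OF assms] by (simp add: k_def abs_square_le_1)
  have ab: "a\<^sup>2 - 1 > 0" "b\<^sup>2 - 1 > 0" using assms by (simp_all add: one_less_power)
  \<comment> \<open>With \<open>a = cosh l\<close> the radius is \<open>tanh l = sqrt (a\<^sup>2 - 1) / a\<close>, and \<open>k\<close> is the cosine of the angle at \<open>0\<close>.\<close>
  define y :: "real^2" where "y = vector [sqrt (a\<^sup>2 - 1) / a, 0]"
  define z :: "real^2" where "z = vector [sqrt (b\<^sup>2 - 1) / b * k, sqrt (b\<^sup>2 - 1) / b * sqrt (1 - k\<^sup>2)]"
  have yy: "lorentz y y = 1 / a\<^sup>2"
    using assms(1) ab by (simp add: lorentz_def y_def inner_vec_def sum_2 field_simps power2_eq_square)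
  have "vector [S * k, S * l] \<bullet> (vector [S * k, S * l] :: real^2) = S\<^sup>2 * (k\<^sup>2 + l\<^sup>2)" for S l
    by (simp add: inner_vec_def sum_2 power2_eq_square algebra_simps)
  then have "z \<bullet> z = (sqrt (b\<^sup>2 - 1) / b)\<^sup>2 * (k\<^sup>2 + (sqrt (1 - k\<^sup>2))\<^sup>2)"
    by (simp only: z_def)
  then have "z \<bullet> z = (b\<^sup>2 - 1) / b\<^sup>2" using k ab by (simp add: power_divide)
  then have zz: "lorentz z z = 1 / b\<^sup>2" using assms(2) by (simp add: lorentz_def field_simps)
  have "y \<bullet> z = sqrt (a\<^sup>2 - 1) * sqrt (b\<^sup>2 - 1) * k / (a * b)"
    by (simp add: y_def z_def inner_vec_def sum_2)
  also have "\<dots> = (a * b - c) / (a * b)" using ab by (simp add: k_def)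
  finally have yz: "lorentz y z = c / (a * b)" using assms by (simp add: lorentz_def field_simps)
  show ?thesis
  proof
    show "norm y < 1" "norm z < 1" using yy zz assms by (auto simp flip: lorentz_self_pos_iff)
    show "klein_cosh 0 y = a" "klein_cosh 0 z = b" "klein_cosh y z = c"
      using assms by (simp_all add: klein_cosh_def yy zz yz real_sqrt_divide, simp_all add: lorentz_def)
  qed
qed

section \<open>The Gauss--Bonnet formula for triangles\<close>

definition gauss_bonnet :: "real^2 \<Rightarrow> real^2 \<Rightarrow> real^2 \<Rightarrow> bool" where
  "gauss_bonnet x y z \<longleftrightarrow>
     klein_area (convex hull {x, y, z}) = pi - (klein_angle x y z + klein_angle y x z + klein_angle z x y)"

lemma klein_angle_commute: "klein_angle x y z = klein_angle x z y"
  by (simp add: klein_angle_def klein_metric_def inner_commute mult.commute)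

lemma gauss_bonnet_swap: "gauss_bonnet x y z \<longleftrightarrow> gauss_bonnet x z y"
  unfolding gauss_bonnet_def
  by (simp add: klein_angle_commute[of x z y] insert_commute add_ac)

definition klein_density :: "real^2 \<Rightarrow> real" where
  "klein_density x = (lorentz x x) powr (- 3 / 2)"

lemma klein_area_eq: "klein_area S = integral S klein_density"
  by (simp add: klein_area_def klein_density_def[abs_def] lorentz_self)

lemma klein_density_continuous: "continuous_on (ball 0 1) klein_density"
proof -
  have "x \<bullet> x \<noteq> 1" if "x \<in> ball 0 1" for x :: "real^2"
    using lorentz_self_pos[of x] that by (simp add: lorentz_def)
  then show ?thesis unfolding klein_density_def lorentz_def by (intro continuous_intros) auto
qed

lemma has_derivative_vecI:
  fixes f :: "'a::real_normed_vector \<Rightarrow> real^'n::finite"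
  assumes "\<And>i. ((\<lambda>x. f x $ i) has_derivative (\<lambda>h. f' h $ i)) (at x within S)"
  shows "(f has_derivative f') (at x within S)"
  using assms by (subst has_derivative_componentwise_within) (auto simp: Basis_vec_def inner_axis)

text \<open>
  A projective map \<open>g\<close> that preserves the hyperbolic structure. The weight \<open>\<mu>\<close> is the affine
  function with \<open>\<mu> x (1, g x) = L (1, x)\<close> for a Lorentz transformation \<open>L\<close>: the clause with
  \<open>lorentz\<close> says that \<open>L\<close> preserves the Lorentz product, the last two that \<open>L\<close> is linear.
\<close>

definition klein_isometry :: "(real^2 \<Rightarrow> real^2) \<Rightarrow> (real^2 \<Rightarrow> real) \<Rightarrow> (real^2 \<Rightarrow> real^2 \<Rightarrow> real^2) \<Rightarrow> bool" where
  "klein_isometry g \<mu> g' \<longleftrightarrow> (\<forall>x\<in>ball 0 1. \<mu> x > 0 \<and> (g has_derivative g' x) (at x) \<and>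
      \<bar>det (matrix (g' x))\<bar> * \<mu> x ^ 3 = 1 \<and>
      (\<forall>y\<in>ball 0 1. lorentz (g x) (g y) * (\<mu> x * \<mu> y) = lorentz x y \<and>
         (\<forall>t\<in>{0..1}. \<mu> ((1 - t) *\<^sub>R x + t *\<^sub>R y) = (1 - t) * \<mu> x + t * \<mu> y \<and>
            \<mu> ((1 - t) *\<^sub>R x + t *\<^sub>R y) *\<^sub>R g ((1 - t) *\<^sub>R x + t *\<^sub>R y)
              = ((1 - t) * \<mu> x) *\<^sub>R g x + (t * \<mu> y) *\<^sub>R g y)))"

context
  fixes g \<mu> g' assumes iso: "klein_isometry g \<mu> g'"
begin

lemma isometry_lorentz:
  "norm x < 1 \<Longrightarrow> norm y < 1 \<Longrightarrow> lorentz (g x) (g y) = lorentz x y / (\<mu> x * \<mu> y)"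
  using iso unfolding klein_isometry_def by (auto simp: eq_divide_eq less_imp_neq[symmetric])

lemma isometry_weight_pos: "norm x < 1 \<Longrightarrow> \<mu> x > 0"
  using iso unfolding klein_isometry_def by simp

lemma isometry_disc:
  assumes "norm x < 1" shows "norm (g x) < 1"
  unfolding lorentz_self_pos_iff[symmetric]
  using lorentz_self_pos[OF assms] isometry_weight_pos[OF assms] by (simp add: isometry_lorentz assms)

lemma isometry_cosh:
  assumes "norm x < 1" "norm y < 1" shows "klein_cosh (g x) (g y) = klein_cosh x y"
  using isometry_weight_pos[OF assms(1)] isometry_weight_pos[OF assms(2)]
  by (simp add: klein_cosh_def isometry_lorentz assms real_sqrt_divide)

lemma isometry_angle:
  assumes "norm x < 1" "norm y < 1" "norm z < 1"
  shows "klein_angle (g x) (g y) (g z) = klein_angle x y z"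
  using assms by (simp add: klein_law_of_cosines isometry_disc isometry_cosh)

lemma isometry_inj: "inj_on g (ball 0 1)"
proof (rule inj_onI, rule ccontr)
  fix x y assume xy: "x \<in> ball 0 1" "y \<in> ball 0 1" "g x = g y" "x \<noteq> y"
  then have "klein_cosh (g x) (g y) > 1" using klein_cosh_gt_1[of x y] isometry_cosh[of x y] by simp
  then show False using xy klein_cosh_self[OF isometry_disc[of y]] by simp
qed

text \<open>
  A projective map moves along the image segment with a reparametrization by the weights:
  the point with parameter \<open>t\<close> goes to the point with parameter proportional to \<open>t \<mu> y\<close>.
\<close>

lemma isometry_segment:
  assumes x: "norm x < 1" and y: "norm y < 1"
  shows "g ` closed_segment x y = closed_segment (g x) (g y)"
proof -
  have pos: "\<mu> x > 0" "\<mu> y > 0" using assms by (simp_all add: isometry_weight_pos)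
  have convex: "(1 - t) * \<mu> x + t * \<mu> y > 0" if "t \<in> {0..1}" for t
    using that pos by (cases "t = 0") (auto intro: add_nonneg_pos)
  have g: "g ((1 - t) *\<^sub>R x + t *\<^sub>R y)
      = (1 - t * \<mu> y / ((1 - t) * \<mu> x + t * \<mu> y)) *\<^sub>R g x + (t * \<mu> y / ((1 - t) * \<mu> x + t * \<mu> y)) *\<^sub>R g y"
    if t: "t \<in> {0..1}" for t
  proof -
    define m where "m = (1 - t) * \<mu> x + t * \<mu> y"
    have m: "m > 0" using convex[OF t] by (simp add: m_def)
    have xy: "x \<in> ball 0 1" "y \<in> ball 0 1" using x y by simp_all
    have "\<mu> ((1 - t) *\<^sub>R x + t *\<^sub>R y) *\<^sub>R g ((1 - t) *\<^sub>R x + t *\<^sub>R y)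
        = ((1 - t) * \<mu> x) *\<^sub>R g x + (t * \<mu> y) *\<^sub>R g y"
      and "\<mu> ((1 - t) *\<^sub>R x + t *\<^sub>R y) = m"
      using iso[unfolded klein_isometry_def] xy t unfolding m_def by blast+
    then have "m *\<^sub>R g ((1 - t) *\<^sub>R x + t *\<^sub>R y) = ((1 - t) * \<mu> x) *\<^sub>R g x + (t * \<mu> y) *\<^sub>R g y"
      by simp
    then have "g ((1 - t) *\<^sub>R x + t *\<^sub>R y) = (1 / m) *\<^sub>R (((1 - t) * \<mu> x) *\<^sub>R g x + (t * \<mu> y) *\<^sub>R g y)"
      using m by (simp flip: \<open>m *\<^sub>R _ = _\<close>)
    moreover have "(1 - t) * \<mu> x / m = 1 - t * \<mu> y / m" using m by (simp add: m_def field_simps)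
    ultimately show ?thesis unfolding m_def[symmetric] by (simp add: scaleR_add_right)
  qed
  show ?thesis
  proof (intro equalityI subsetI)
    fix w assume "w \<in> g ` closed_segment x y"
    then obtain t where t: "t \<in> {0..1}" "w = g ((1 - t) *\<^sub>R x + t *\<^sub>R y)" by (auto simp: in_segment)
    have "t * \<mu> y / ((1 - t) * \<mu> x + t * \<mu> y) \<in> {0..1}"
      using convex[OF t(1)] t(1) pos by (simp add: divide_le_eq)
    then show "w \<in> closed_segment (g x) (g y)"
      unfolding in_segment t(2) g[OF t(1)] by fastforce
  next
    fix w assume "w \<in> closed_segment (g x) (g y)"
    then obtain s where s: "s \<in> {0..1}" "w = (1 - s) *\<^sub>R g x + s *\<^sub>R g y" by (auto simp: in_segment)
    define n where "n = (1 - s) * \<mu> y + s * \<mu> x"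
    have n: "n > 0" using s pos by (cases "s = 0") (auto simp: n_def intro: add_nonneg_pos)
    define t where "t = s * \<mu> x / n"
    have t: "t \<in> {0..1}" using s n pos by (simp add: t_def n_def divide_le_eq)
    have "1 - t = (1 - s) * \<mu> y / n" using n by (simp add: t_def n_def field_simps)
    then have "(1 - t) * \<mu> x + t * \<mu> y = \<mu> x * \<mu> y / n"
      by (simp add: t_def flip: add_divide_distrib) (simp add: algebra_simps)
    then have "t * \<mu> y / ((1 - t) * \<mu> x + t * \<mu> y) = s" using n pos by (simp add: t_def)
    then have "w = g ((1 - t) *\<^sub>R x + t *\<^sub>R y)" using g[OF t] s by simp
    moreover have "(1 - t) *\<^sub>R x + t *\<^sub>R y \<in> closed_segment x y" using t by (auto simp: in_segment)
    ultimately show "w \<in> g ` closed_segment x y" by blast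
  qed
qed

lemma isometry_triangle:
  assumes "norm x < 1" "norm y < 1" "norm z < 1"
  shows "g ` (convex hull {x, y, z}) = convex hull {g x, g y, g z}"
proof -
  have "closed_segment y z \<subseteq> ball 0 1" using assms by (intro closed_segment_subset) auto
  then have "g ` (convex hull {x, y, z}) = (\<Union>w\<in>closed_segment y z. g ` closed_segment x w)"
    by (simp add: convex_hull_insert_segments[of x] segment_convex_hull[symmetric] image_UN)
  also have "\<dots> = (\<Union>w\<in>closed_segment y z. closed_segment (g x) (g w))"
    using \<open>closed_segment y z \<subseteq> ball 0 1\<close> assms(1)
    by (intro SUP_cong refl isometry_segment) auto
  also have "\<dots> = (\<Union>w\<in>closed_segment (g y) (g z). closed_segment (g x) w)"
    by (simp flip: isometry_segment[OF assms(2,3)])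
  finally show ?thesis
    by (simp add: convex_hull_insert_segments[of "g x"] segment_convex_hull[symmetric])
qed

text \<open>
  Under \<open>g\<close> the density is multiplied by \<open>\<mu>\<^sup>3\<close>, as \<open>(\<mu>\<^sup>-\<^sup>2)\<^bsup>-3/2\<^esup> = \<mu>\<^sup>3\<close>, and the Jacobian determinant
  is \<open>\<mu>\<^sup>-\<^sup>3\<close>.
\<close>

lemma isometry_area:
  assumes T: "compact T" "T \<subseteq> ball 0 1"
  shows "klein_area (g ` T) = klein_area T"
proof -
  let ?\<rho> = "\<lambda>x. vec (klein_density x) :: real^1"
  have eq: "\<bar>det (matrix (g' x))\<bar> * klein_density (g x) = klein_density x" if "x \<in> T" for x
  proof -
    have x: "norm x < 1" using that T by auto
    have m: "\<mu> x > 0" and d: "\<bar>det (matrix (g' x))\<bar> * \<mu> x ^ 3 = 1"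
      using iso x unfolding klein_isometry_def by auto
    have "(\<mu> x * \<mu> x) powr (- 3 / 2) = (\<mu> x powr 2) powr (- 3 / 2)"
      using m by (simp add: power2_eq_square)
    also have "\<dots> = \<mu> x powr (- 3)" by (simp add: powr_powr)
    also have "\<dots> = 1 / \<mu> x ^ 3" using m by (simp add: powr_minus powr_numeral divide_inverse)
    finally have "klein_density (g x) = klein_density x * \<mu> x ^ 3"
      using m lorentz_self_pos[OF x] by (simp add: klein_density_def isometry_lorentz x powr_divide)
    then show ?thesis using d by (simp add: mult_ac)
  qed
  have "integrable lborel (\<lambda>x. indicator T x *\<^sub>R klein_density x)"
    using T by (intro borel_integrable_compact continuous_on_subset[OF klein_density_continuous])
  then have "klein_density absolutely_integrable_on T"
    unfolding set_integrable_def using integrable_completion borel_measurable_integrable by blast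
  then have "(\<lambda>x. \<bar>det (matrix (g' x))\<bar> *\<^sub>R ?\<rho> (g x)) absolutely_integrable_on T \<and>
      integral T (\<lambda>x. \<bar>det (matrix (g' x))\<bar> *\<^sub>R ?\<rho> (g x)) = vec (integral T klein_density)"
    using eq by (simp add: absolutely_integrable_on_1_iff integral_on_1_eq cong: integral_cong set_integrable_cong)
  then have "?\<rho> absolutely_integrable_on (g ` T) \<and> integral (g ` T) ?\<rho> = vec (integral T klein_density)"
    by (subst (asm) has_absolute_integral_change_of_variables_compact)
      (use T iso inj_on_subset[OF isometry_inj] in
        \<open>auto simp: klein_isometry_def intro: has_derivative_at_withinI\<close>)
  then show ?thesis by (simp add: klein_area_eq integral_on_1_eq)
qed

lemma gauss_bonnet_isometry:
  assumes "norm x < 1" "norm y < 1" "norm z < 1"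
  shows "gauss_bonnet (g x) (g y) (g z) \<longleftrightarrow> gauss_bonnet x y z"
proof -
  have "convex hull {x, y, z} \<subseteq> ball 0 1" using assms by (intro hull_minimal) auto
  then have "klein_area (convex hull {g x, g y, g z}) = klein_area (convex hull {x, y, z})"
    using assms by (subst isometry_triangle[symmetric]) (auto intro!: isometry_area finite_imp_compact_convex_hull)
  then show ?thesis using assms by (simp add: gauss_bonnet_def isometry_angle)
qed

end

definition rotation :: "real \<Rightarrow> real \<Rightarrow> real^2 \<Rightarrow> real^2" where
  "rotation c d x = vector [c * x $ 1 + d * x $ 2, c * x $ 2 - d * x $ 1]"

lemma rotation_isometry:
  assumes "c\<^sup>2 + d\<^sup>2 = 1"
  shows "klein_isometry (rotation c d) (\<lambda>_. 1) (\<lambda>_. rotation c d)"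
proof -
  have lin: "linear (rotation c d)"
    by (rule linearI) (simp_all add: rotation_def vec_eq_iff forall_2 algebra_simps)
  have mat: "det (matrix (rotation c d)) = 1"
    using assms by (simp add: det_2 matrix_def rotation_def axis_def power2_eq_square)
  have "lorentz (rotation c d x) (rotation c d y) = lorentz x y" for x y
  proof -
    have "rotation c d x \<bullet> rotation c d y = (c\<^sup>2 + d\<^sup>2) * (x \<bullet> y)"
      by (simp add: rotation_def inner_vec_def sum_2 algebra_simps power2_eq_square)
    then show ?thesis by (simp add: lorentz_def assms)
  qed
  moreover have "(rotation c d has_derivative rotation c d) (at x)" for x
    using lin by (simp add: linear_imp_has_derivative)
  ultimately show ?thesis
    unfolding klein_isometry_def using mat lin by (simp add: linear_add linear_scale)
qed

text \<open>
  The hyperbolic translation along the first axis that takes \<open>(a, 0)\<close> to the centre.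
\<close>

definition boost :: "real \<Rightarrow> real^2 \<Rightarrow> real^2" where
  "boost a x = vector [(x $ 1 - a) / (1 - a * x $ 1), sqrt (1 - a\<^sup>2) * x $ 2 / (1 - a * x $ 1)]"

lemma boost_isometry:
  assumes a: "\<bar>a\<bar> < 1"
  obtains g' where "klein_isometry (boost a) (\<lambda>x. (1 - a * x $ 1) / sqrt (1 - a\<^sup>2)) g'"
proof -
  define s where "s = sqrt (1 - a\<^sup>2)"
  have "a\<^sup>2 < 1" using a by (simp add: abs_square_less_1)
  then have s: "s > 0" "s\<^sup>2 = 1 - a\<^sup>2" by (simp_all add: s_def)
  have ss: "s * (s * t) = t - a * (a * t)" for t
    using s(2) by (simp add: power2_eq_square left_diff_distrib flip: mult.assoc)
  have pos: "1 - a * x $ 1 > 0" if "norm x < 1" for x :: "real^2"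
  proof -
    have "\<bar>a * x $ 1\<bar> \<le> \<bar>x $ 1\<bar>" using a by (simp add: abs_mult mult_left_le_one_le)
    also have "\<dots> < 1" using component_le_norm_cart[of x 1] that by simp
    finally show ?thesis by simp
  qed
  define g' :: "real^2 \<Rightarrow> real^2 \<Rightarrow> real^2" where
    "g' x h = vector [s\<^sup>2 * h $ 1 / (1 - a * x $ 1)\<^sup>2,
       s * h $ 2 / (1 - a * x $ 1) + s * x $ 2 * (a * h $ 1) / (1 - a * x $ 1)\<^sup>2]" for x h
  have der: "(boost a has_derivative g' x) (at x)" if x: "norm x < 1" for x
  proof -
    have d: "((\<lambda>x :: real^2. x $ i) has_derivative (\<lambda>h. h $ i)) (at x)" for i
      by (rule bounded_linear_imp_has_derivative[OF bounded_linear_vec_nth])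
    have p: "1 - a * x $ 1 \<noteq> 0" using pos[OF x] by simp
    have q: "((\<lambda>x :: real^2. 1 - a * x $ 1) has_derivative (\<lambda>h. - (a * h $ 1))) (at x)"
      by (rule derivative_eq_intros d refl | rule ext)+ simp
    have "((\<lambda>x :: real^2. x $ 1 - a) has_derivative (\<lambda>h. h $ 1)) (at x)"
      by (rule derivative_eq_intros d refl | rule ext)+ simp
    note 1 = has_derivative_divide'[OF this q p]
    have 1: "((\<lambda>x :: real^2. (x $ 1 - a) / (1 - a * x $ 1)) has_derivative (\<lambda>h. s\<^sup>2 * h $ 1 / (1 - a * x $ 1)\<^sup>2)) (at x)"
      by (rule has_derivative_eq_rhs[OF 1]) (simp add: fun_eq_iff ss power2_eq_square algebra_simps)
    have "((\<lambda>x :: real^2. s * x $ 2) has_derivative (\<lambda>h. s * h $ 2)) (at x)"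
      by (rule derivative_eq_intros d refl | rule ext)+ simp
    note 2 = has_derivative_divide'[OF this q p]
    have 2: "((\<lambda>x :: real^2. s * x $ 2 / (1 - a * x $ 1)) has_derivative
        (\<lambda>h. s * h $ 2 / (1 - a * x $ 1) + s * x $ 2 * (a * h $ 1) / (1 - a * x $ 1)\<^sup>2)) (at x)"
      by (rule has_derivative_eq_rhs[OF 2]) (use p in \<open>simp add: fun_eq_iff power2_eq_square add_divide_distrib\<close>)
    have "((\<lambda>x. boost a x $ i) has_derivative (\<lambda>h. g' x h $ i)) (at x)" for i
      using exhaust_2[of i] 1 2 by (auto simp: boost_def g'_def s_def)
    then show ?thesis by (rule has_derivative_vecI)
  qed
  have det: "det (matrix (g' x)) = s ^ 3 / (1 - a * x $ 1) ^ 3" for x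
    by (simp add: det_2 matrix_def g'_def axis_def power2_eq_square power3_eq_cube)
  have lor: "lorentz (boost a x) (boost a y) * ((1 - a * x $ 1) * (1 - a * y $ 1)) = s\<^sup>2 * lorentz x y"
    if "norm x < 1" "norm y < 1" for x y
  proof -
    have "boost a x \<bullet> boost a y = ((x $ 1 - a) * (y $ 1 - a) + s\<^sup>2 * (x $ 2 * y $ 2)) / ((1 - a * x $ 1) * (1 - a * y $ 1))"
      by (simp add: boost_def inner_vec_def sum_2 s_def add_divide_distrib mult_ac power2_eq_square)
    then have "lorentz (boost a x) (boost a y) * ((1 - a * x $ 1) * (1 - a * y $ 1))
      = (1 - a * x $ 1) * (1 - a * y $ 1) - ((x $ 1 - a) * (y $ 1 - a) + s\<^sup>2 * (x $ 2 * y $ 2))"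
      using pos[OF that(1)] pos[OF that(2)] by (simp add: lorentz_def left_diff_distrib)
    also have "\<dots> = s\<^sup>2 * lorentz x y"
      unfolding s(2) by (simp add: lorentz_def inner_vec_def sum_2 algebra_simps power2_eq_square)
    finally show ?thesis .
  qed
  have proj: "((1 - a * x $ 1) / s) *\<^sub>R boost a x = vector [(x $ 1 - a) / s, x $ 2]" if "norm x < 1" for x
    using pos[OF that] s(1) by (simp add: boost_def vec_eq_iff forall_2 s_def[symmetric])
  have "klein_isometry (boost a) (\<lambda>x. (1 - a * x $ 1) / s) g'"
    unfolding klein_isometry_def
  proof (intro ballI conjI)
    fix x :: "real^2" assume "x \<in> ball 0 1"
    then have x: "norm x < 1" by simp
    show "(1 - a * x $ 1) / s > 0" using pos[OF x] s by simp
    show "(boost a has_derivative g' x) (at x)" by (rule der[OF x])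
    show "\<bar>det (matrix (g' x))\<bar> * ((1 - a * x $ 1) / s) ^ 3 = 1"
      using pos[OF x] s(1) by (simp add: det power_divide)
    fix y :: "real^2" assume "y \<in> ball 0 1"
    then have y: "norm y < 1" by simp
    show "lorentz (boost a x) (boost a y) * ((1 - a * x $ 1) / s * ((1 - a * y $ 1) / s)) = lorentz x y"
      using lor[OF x y] s(1) by (simp add: power2_eq_square field_simps)
    fix t :: real assume t: "t \<in> {0..1}"
    let ?w = "(1 - t) *\<^sub>R x + t *\<^sub>R y"
    show "(1 - a * ?w $ 1) / s = (1 - t) * ((1 - a * x $ 1) / s) + t * ((1 - a * y $ 1) / s)"
      using s(1) by (simp add: field_simps)
    have "?w \<in> ball 0 1"
      using convexD[OF convex_ball, of x 0 1 y "1 - t" t] x y t by simp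
    then have w: "norm ?w < 1" by simp
    show "((1 - a * ?w $ 1) / s) *\<^sub>R boost a ?w
        = ((1 - t) * ((1 - a * x $ 1) / s)) *\<^sub>R boost a x + (t * ((1 - a * y $ 1) / s)) *\<^sub>R boost a y"
      unfolding proj[OF w] scaleR_scaleR[symmetric] proj[OF x] proj[OF y]
      using s(1) by (simp add: vec_eq_iff forall_2 field_simps)
  qed
  then show ?thesis using that by (simp add: s_def)
qed



text \<open>
  It identifies \<open>real^2\<close> with \<open>real \<times> real\<close>, where integrals over rectangles are iterated integrals.
  The coordinates are exchanged because the inner integral below runs over the first
  coordinate of the plane.
\<close>

lemma has_integral_swap_coordinates:
  fixes f :: "real \<times> real \<Rightarrow> real"
  assumes "(f has_integral i) (cbox (a, c) (b, d))"
  shows "((\<lambda>v. f (v $ 2, v $ 1)) has_integral i) (cbox (vector [c, a]) (vector [d, b] :: real^2))"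
proof -
  let ?g = "\<lambda>v :: real^2. (v $ 2, v $ 1)" and ?h = "\<lambda>w :: real \<times> real. vector [snd w, fst w] :: real^2"
  have gh: "?g (?h w) = w" for w by simp
  have hg: "?h (?g v) = v" for v by (simp add: vec_eq_iff forall_2)
  have g: "?g ` cbox u v = cbox (u $ 2, u $ 1) (v $ 2, v $ 1)" for u v
  proof (intro equalityI subsetI)
    fix w assume "w \<in> cbox (u $ 2, u $ 1) (v $ 2, v $ 1)"
    then have "?h w \<in> cbox u v" by (cases w) (auto simp: mem_box_cart forall_2)
    then show "w \<in> ?g ` cbox u v" by (intro image_eqI[where x = "?h w"]) (simp_all add: gh)
  qed (auto simp: mem_box_cart)
  have h: "?h ` cbox u v = cbox (?h u) (?h v)" for u v
  proof (intro equalityI subsetI)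
    fix w assume "w \<in> cbox (?h u) (?h v)"
    then have "?g w \<in> cbox u v" by (cases u; cases v) (auto simp: mem_box_cart forall_2)
    then show "w \<in> ?h ` cbox u v" by (intro image_eqI[where x = "?g w"]) (simp_all only: hg)
  next
    fix w assume "w \<in> ?h ` cbox u v"
    then show "w \<in> cbox (?h u) (?h v)" by (cases u; cases v) (auto simp: mem_box_cart forall_2)
  qed
  have "((\<lambda>v. f (?g v)) has_integral (1 / 1) *\<^sub>R i) (?h ` cbox (a, c) (b, d))"
  proof (rule has_integral_twiddle[OF _ hg gh])
    show "continuous (at v) ?g" for v by (intro continuous_intros)
    show "measure lborel (?g ` cbox u v) = 1 * measure lborel (cbox u v)" for u v
    proof (cases "cbox u v = {}")
      case False
      then have "u $ 1 \<le> v $ 1" "u $ 2 \<le> v $ 2" by (auto simp: interval_ne_empty_cart)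
      then show ?thesis unfolding g content_Pair
        using False by (simp add: content_cbox_cart prod.remove UNIV_2)
    qed simp
    show "\<exists>w z. ?g ` cbox u v = cbox w z" for u v using g by blast
    show "\<exists>w z. ?h ` cbox u v = cbox w z" for u v using h by blast
    show "(f has_integral i) (cbox (a, c) (b, d))" by (rule assms)
  qed simp
  then show ?thesis by (simp add: h)
qed

lemma powr_minus_three_halves: "t > 0 \<Longrightarrow> t powr (- 3 / 2) = 1 / (t * sqrt t)" for t :: real
proof -
  assume t: "t > 0"
  have "t powr (- 3 / 2) = t powr (- 1 + - (1 / 2))" by simp
  also have "\<dots> = t powr (- 1) * t powr (- (1 / 2))" by (rule powr_add)
  also have "\<dots> = 1 / (t * sqrt t)"
    using t by (simp only: powr_minus_divide powr_half_sqrt) (simp add: powr_half_sqrt)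
  finally show ?thesis .
qed

text \<open>
  A triangle with one vertex at the centre and the opposite side on the vertical line at
  distance \<open>h\<close>; the other two vertices are \<open>(h, \<alpha> h)\<close> and \<open>(h, \<beta> h)\<close>. Every nondegenerate triangle is
  congruent to one of this kind.
\<close>

context
  fixes h \<alpha> \<beta> :: real
  assumes h: "h > 0" and slopes: "\<alpha> < \<beta>" and in_disc: "h\<^sup>2 * (1 + \<alpha>\<^sup>2) < 1" "h\<^sup>2 * (1 + \<beta>\<^sup>2) < 1"
begin

lemma slope_in_disc:
  assumes "m \<in> {\<alpha>..\<beta>}" "x \<in> {0..h}" shows "x\<^sup>2 * (1 + m\<^sup>2) < 1"
proof -
  have "x\<^sup>2 * (1 + m\<^sup>2) \<le> h\<^sup>2 * (1 + m\<^sup>2)" using assms by (intro mult_right_mono power_mono) auto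
  also have "\<dots> < 1"
  proof (cases "m \<ge> 0")
    case True
    then have "m\<^sup>2 \<le> \<beta>\<^sup>2" using assms by (intro power_mono) auto
    then have "h\<^sup>2 * (1 + m\<^sup>2) \<le> h\<^sup>2 * (1 + \<beta>\<^sup>2)" by (intro mult_left_mono) auto
    then show ?thesis using in_disc by linarith
  next
    case False
    then have "m\<^sup>2 \<le> \<alpha>\<^sup>2" using assms by (simp add: abs_le_square_iff[symmetric])
    then have "h\<^sup>2 * (1 + m\<^sup>2) \<le> h\<^sup>2 * (1 + \<alpha>\<^sup>2)" by (intro mult_left_mono) auto
    then show ?thesis using in_disc by linarith
  qed
  finally show ?thesis .
qed

text \<open>
  The Lorentz norm of the point \<open>(h, m h)\<close>, that is, the square root of its product with itself.
\<close>

definition end_norm :: "real \<Rightarrow> real" where "end_norm m = sqrt (1 - h\<^sup>2 * (1 + m\<^sup>2))"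

lemma end_norm_pos: "m \<in> {\<alpha>..\<beta>} \<Longrightarrow> end_norm m > 0" "m \<in> {\<alpha>..\<beta>} \<Longrightarrow> (end_norm m)\<^sup>2 = 1 - h\<^sup>2 * (1 + m\<^sup>2)"
  using slope_in_disc[of m h] h by (simp_all add: end_norm_def)

text \<open>
  The area in the coordinates \<open>(x, m)\<close> of the point \<open>(x, m x)\<close>. Integration over \<open>x\<close> leaves
  \<open>(1 / end_norm m - 1) / (1 + m\<^sup>2)\<close>, with the primitive \<open>arctan (m / end_norm m) - arctan m\<close>:
  the second term is an angle at the centre, and the first one is, up to its sign, the complement of
  the angle at \<open>(h, m h)\<close>.
\<close>

lemma fan_integral:
  "((\<lambda>w. snd w * (1 - (snd w)\<^sup>2 * (1 + (fst w)\<^sup>2)) powr (- 3 / 2)) has_integral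
     (arctan (\<beta> / end_norm \<beta>) - arctan \<beta>) - (arctan (\<alpha> / end_norm \<alpha>) - arctan \<alpha>)) (cbox (\<alpha>, 0) (\<beta>, h))"
proof -
  let ?f = "\<lambda>w :: real \<times> real. snd w * (1 - (snd w)\<^sup>2 * (1 + (fst w)\<^sup>2)) powr (- 3 / 2)"
  have cont: "continuous_on (cbox (\<alpha>, 0) (\<beta>, h)) ?f"
  proof -
    have "1 - (snd w)\<^sup>2 * (1 + (fst w)\<^sup>2) \<noteq> 0" if "w \<in> cbox (\<alpha>, 0) (\<beta>, h)" for w
      using slope_in_disc[of "fst w" "snd w"] that by (cases w) simp
    then show ?thesis by (intro continuous_intros) auto
  qed
  have inner: "integral {0..h} (\<lambda>x. x * (1 - x\<^sup>2 * (1 + m\<^sup>2)) powr (- 3 / 2)) = (1 / end_norm m - 1) / (1 + m\<^sup>2)"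
    if m: "m \<in> {\<alpha>..\<beta>}" for m
  proof -
    let ?q = "1 + m\<^sup>2"
    have q: "?q > 0" by (simp add: add_pos_nonneg)
    let ?F = "\<lambda>x. 1 / (?q * sqrt (1 - x\<^sup>2 * ?q))"
    have "((\<lambda>x. x * (1 - x\<^sup>2 * ?q) powr (- 3 / 2)) has_integral ?F h - ?F 0) {0..h}"
    proof (rule fundamental_theorem_of_calculus)
      fix x assume x: "x \<in> {0..h}"
      have t: "1 - x\<^sup>2 * ?q > 0" using slope_in_disc[OF m x] by simp
      define T where "T = 1 - x\<^sup>2 * ?q"
      have T: "T > 0" using t by (simp add: T_def)
      have "((\<lambda>x. sqrt (1 - x\<^sup>2 * ?q)) has_real_derivative (- (2 * x * ?q)) * (inverse (sqrt T) / 2)) (at x within {0..h})"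
        using t by (auto intro!: derivative_eq_intros simp: T_def)
      then have "(?F has_real_derivative - (?q * ((- (2 * x * ?q)) * (inverse (sqrt T) / 2))) / (?q * sqrt T)\<^sup>2) (at x within {0..h})"
        using t q by (auto intro!: derivative_eq_intros simp: T_def power2_eq_square)
      also have "- (?q * ((- (2 * x * ?q)) * (inverse (sqrt T) / 2))) / (?q * sqrt T)\<^sup>2 = x * (1 / (T * sqrt T))"
        using T q by (simp add: power_mult_distrib divide_simps power2_eq_square[of ?q])
      also have "1 / (T * sqrt T) = T powr (- 3 / 2)" by (rule powr_minus_three_halves[OF T, symmetric])
      finally show "(?F has_vector_derivative x * (1 - x\<^sup>2 * ?q) powr (- 3 / 2)) (at x within {0..h})"
        by (simp add: T_def has_real_derivative_iff_has_vector_derivative)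
    qed (use h in simp)
    then have "integral {0..h} (\<lambda>x. x * (1 - x\<^sup>2 * ?q) powr (- 3 / 2)) = ?F h - ?F 0" by (rule integral_unique)
    also have "\<dots> = (1 / end_norm m - 1) / ?q" by (simp add: end_norm_def diff_divide_distrib mult.commute)
    finally show ?thesis .
  qed
  have outer: "((\<lambda>m. (1 / end_norm m - 1) / (1 + m\<^sup>2)) has_integral
     (arctan (\<beta> / end_norm \<beta>) - arctan \<beta>) - (arctan (\<alpha> / end_norm \<alpha>) - arctan \<alpha>)) {\<alpha>..\<beta>}"
  proof (rule fundamental_theorem_of_calculus)
    fix m assume m: "m \<in> {\<alpha>..\<beta>}"
    define w where "w = end_norm m"
    have w: "w > 0" "w\<^sup>2 = 1 - h\<^sup>2 * (1 + m\<^sup>2)" using end_norm_pos[OF m] by (simp_all add: w_def)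
    have q: "1 + m\<^sup>2 > 0" by (simp add: add_pos_nonneg)
    have "(end_norm has_real_derivative - (h\<^sup>2 * m) / w) (at m within {\<alpha>..\<beta>})"
      unfolding end_norm_def[abs_def] w_def using slope_in_disc[OF m, of h] h
      by (auto intro!: derivative_eq_intros simp: field_simps)
    then have "((\<lambda>m. arctan (m / end_norm m) - arctan m) has_real_derivative
        (1 * w - m * (- (h\<^sup>2 * m) / w)) / (w * w) * inverse (1 + (m / w)\<^sup>2) - inverse (1 + m\<^sup>2)) (at m within {\<alpha>..\<beta>})"
      using w by (auto intro!: derivative_eq_intros simp: w_def[symmetric])
    also have "(1 * w - m * (- (h\<^sup>2 * m) / w)) / (w * w) * inverse (1 + (m / w)\<^sup>2)
        = (w\<^sup>2 + h\<^sup>2 * m\<^sup>2) / (w * (w\<^sup>2 + m\<^sup>2))"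
    proof -
      have "1 + (m / w)\<^sup>2 = (w\<^sup>2 + m\<^sup>2) / w\<^sup>2"
        using w(1) by (simp add: power_divide add_divide_distrib)
      then have "inverse (1 + (m / w)\<^sup>2) = w\<^sup>2 / (w\<^sup>2 + m\<^sup>2)" by simp
      moreover have "(1 * w - m * (- (h\<^sup>2 * m) / w)) / (w * w) = (w\<^sup>2 + h\<^sup>2 * m\<^sup>2) / (w * w\<^sup>2)"
        using w(1) by (simp add: field_simps power2_eq_square)
      ultimately show ?thesis using w(1) by simp
    qed
    also have "w\<^sup>2 + h\<^sup>2 * m\<^sup>2 = 1 - h\<^sup>2" unfolding w(2) by (simp add: algebra_simps)
    also have "w\<^sup>2 + m\<^sup>2 = (1 - h\<^sup>2) * (1 + m\<^sup>2)" unfolding w(2) by (simp add: algebra_simps)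
    also have "(1 - h\<^sup>2) / (w * ((1 - h\<^sup>2) * (1 + m\<^sup>2))) - inverse (1 + m\<^sup>2) = (1 / w - 1) / (1 + m\<^sup>2)"
    proof -
      have "h\<^sup>2 * 1 \<le> h\<^sup>2 * (1 + m\<^sup>2)" by (intro mult_left_mono) auto
      moreover have "h\<^sup>2 * (1 + m\<^sup>2) < 1" using slope_in_disc[OF m, of h] h by simp
      ultimately have "1 - h\<^sup>2 > 0" by linarith
      then have "D / (w * (D * E)) = 1 / (w * E)" if "D = 1 - h\<^sup>2" for D E using that by simp
      then show ?thesis by (simp add: diff_divide_distrib inverse_eq_divide)
    qed
    finally show "((\<lambda>m. arctan (m / end_norm m) - arctan m) has_vector_derivative (1 / end_norm m - 1) / (1 + m\<^sup>2)) (at m within {\<alpha>..\<beta>})"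
      by (simp add: w_def has_real_derivative_iff_has_vector_derivative)
  qed (use slopes in simp)
  have "integral (cbox (\<alpha>, 0) (\<beta>, h)) ?f = integral {\<alpha>..\<beta>} (\<lambda>m. integral {0..h} (\<lambda>x. ?f (m, x)))"
    using integral_prod_continuous[OF cont] by simp
  also have "\<dots> = integral {\<alpha>..\<beta>} (\<lambda>m. (1 / end_norm m - 1) / (1 + m\<^sup>2))"
    by (rule integral_cong) (use inner in simp)
  also have "\<dots> = (arctan (\<beta> / end_norm \<beta>) - arctan \<beta>) - (arctan (\<alpha> / end_norm \<alpha>) - arctan \<alpha>)"
    by (rule integral_unique[OF outer])
  finally show ?thesis using integrable_integral[OF integrable_continuous[OF cont]] by simp
qed

definition fan :: "real^2 \<Rightarrow> real^2" where "fan v = vector [v $ 1, v $ 1 * v $ 2]"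

lemma fan_image: "fan ` cbox (vector [0, \<alpha>]) (vector [h, \<beta>]) = convex hull {0, vector [h, \<alpha> * h], vector [h, \<beta> * h]}"
proof -
  let ?y = "vector [h, \<alpha> * h] :: real^2" and ?z = "vector [h, \<beta> * h] :: real^2"
  have hull: "convex hull {0, ?y, ?z} = (\<Union>w\<in>closed_segment ?y ?z. closed_segment 0 w)"
    by (simp add: convex_hull_insert_segments[of 0] segment_convex_hull[symmetric])
  have pt: "s *\<^sub>R ((1 - t) *\<^sub>R ?y + t *\<^sub>R ?z) = fan (vector [s * h, (1 - t) * \<alpha> + t * \<beta>])" for s t
    by (simp add: fan_def vec_eq_iff forall_2 algebra_simps)
  show ?thesis unfolding hull
  proof (intro equalityI subsetI)
    fix p assume "p \<in> fan ` cbox (vector [0, \<alpha>]) (vector [h, \<beta>])"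
    then obtain v where v: "p = fan v" "0 \<le> v $ 1" "v $ 1 \<le> h" "\<alpha> \<le> v $ 2" "v $ 2 \<le> \<beta>"
      by (auto simp: mem_box_cart forall_2)
    define s t where "s = v $ 1 / h" and "t = (v $ 2 - \<alpha>) / (\<beta> - \<alpha>)"
    have st: "s \<in> {0..1}" "t \<in> {0..1}" using v h slopes by (auto simp: s_def t_def divide_le_eq)
    have "(1 - t) * \<alpha> + t * \<beta> = \<alpha> + t * (\<beta> - \<alpha>)" by (simp add: algebra_simps)
    also have "\<dots> = v $ 2" using slopes by (simp add: t_def)
    finally have "vector [s * h, (1 - t) * \<alpha> + t * \<beta>] = v"
      using h by (simp add: s_def vec_eq_iff forall_2)
    then have "p = s *\<^sub>R ((1 - t) *\<^sub>R ?y + t *\<^sub>R ?z)" using v pt[of s t] by simp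
    moreover have "(1 - t) *\<^sub>R ?y + t *\<^sub>R ?z \<in> closed_segment ?y ?z" using st by (auto simp: in_segment)
    ultimately show "p \<in> (\<Union>w\<in>closed_segment ?y ?z. closed_segment 0 w)"
      using st by (fastforce simp: in_segment)
  next
    fix p assume "p \<in> (\<Union>w\<in>closed_segment ?y ?z. closed_segment 0 w)"
    then obtain s t where st: "0 \<le> s" "s \<le> 1" "0 \<le> t" "t \<le> 1"
      and "p = s *\<^sub>R ((1 - t) *\<^sub>R ?y + t *\<^sub>R ?z)" by (auto simp: in_segment)
    then have p: "p = fan (vector [s * h, (1 - t) * \<alpha> + t * \<beta>])" by (simp add: pt)
    have "(1 - t) * \<alpha> + t * \<beta> = \<alpha> + t * (\<beta> - \<alpha>)" "(1 - t) * \<alpha> + t * \<beta> = \<beta> - (1 - t) * (\<beta> - \<alpha>)"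
      by (simp_all add: algebra_simps)
    moreover have "0 \<le> t * (\<beta> - \<alpha>)" "0 \<le> (1 - t) * (\<beta> - \<alpha>)" using st slopes by simp_all
    ultimately have "\<alpha> \<le> (1 - t) * \<alpha> + t * \<beta>" "(1 - t) * \<alpha> + t * \<beta> \<le> \<beta>"
      by linarith+
    then have "vector [s * h, (1 - t) * \<alpha> + t * \<beta>] \<in> cbox (vector [0, \<alpha>]) (vector [h, \<beta>] :: real^2)"
      using st h by (simp add: mem_box_cart forall_2 mult_left_le_one_le)
    then show "p \<in> fan ` cbox (vector [0, \<alpha>]) (vector [h, \<beta>])" using p by blast
  qed
qed

text \<open>
  Change of variables from \<open>(x, m)\<close> to \<open>(x, m x)\<close>, with Jacobian determinant \<open>x\<close>.
\<close>

lemma fan_area: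
  "klein_area (convex hull {0, vector [h, \<alpha> * h], vector [h, \<beta> * h]})
    = (arctan (\<beta> / end_norm \<beta>) - arctan \<beta>) - (arctan (\<alpha> / end_norm \<alpha>) - arctan \<alpha>)" (is "_ = ?I")
proof -
  define R where "R = cbox (vector [0, \<alpha>]) (vector [h, \<beta>] :: real^2)"
  \<comment> \<open>The map \<open>fan\<close> collapses the edge \<open>x = 0\<close> of the rectangle to the centre; it is injective on the rest.\<close>
  define S where "S = R - {v. v $ 1 = 0}"
  define f where "f v = v $ 1 * (1 - (v $ 1)\<^sup>2 * (1 + (v $ 2)\<^sup>2)) powr (- 3 / 2)" for v :: "real^2"
  let ?\<rho> = "\<lambda>x. vec (klein_density x) :: real^1"
  define fan' :: "real^2 \<Rightarrow> real^2 \<Rightarrow> real^2" where "fan' v k = vector [k $ 1, v $ 1 * k $ 2 + k $ 1 * v $ 2]" for v k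
  have R: "0 \<le> v $ 1" "v $ 1 \<le> h" "\<alpha> \<le> v $ 2" "v $ 2 \<le> \<beta>" if "v \<in> R" for v
    using that by (auto simp: R_def mem_box_cart forall_2)
  have fR: "(f has_integral ?I) R"
    using has_integral_swap_coordinates[OF fan_integral] by (simp add: f_def[abs_def] R_def)
  have cont: "continuous_on R f"
  proof -
    have "1 - (v $ 1)\<^sup>2 * (1 + (v $ 2)\<^sup>2) \<noteq> 0" if "v \<in> R" for v
      using slope_in_disc[of "v $ 2" "v $ 1"] R[OF that] by simp
    then show ?thesis unfolding f_def by (intro continuous_intros) auto
  qed
  have absR: "f absolutely_integrable_on R"
    using cont unfolding R_def by (rule absolutely_integrable_continuous)
  have z: "f v = 0" if "v \<in> R - S" for v using that by (simp add: S_def f_def)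
  have e1: "{x \<in> R - S. f x \<noteq> 0} = {}" "{x \<in> S - R. f x \<noteq> 0} = {}" using z by (auto simp: S_def)
  have absS: "f absolutely_integrable_on S"
    using absR absolutely_integrable_spike_set_eq[of R S f] unfolding e1 by simp
  have intS: "integral S f = ?I"
    using integral_spike_set[of R S f] integral_unique[OF fR] unfolding e1 by simp
  have eq: "\<bar>det (matrix (fan' v))\<bar> * klein_density (fan v) = f v" if "v \<in> S" for v
  proof -
    have "det (matrix (fan' v)) = v $ 1" by (simp add: det_2 matrix_def fan'_def axis_def)
    moreover have "lorentz (fan v) (fan v) = 1 - (v $ 1)\<^sup>2 * (1 + (v $ 2)\<^sup>2)"
      by (simp add: lorentz_def fan_def inner_vec_def sum_2 power2_eq_square algebra_simps)
    ultimately show ?thesis using R(1)[of v] that by (simp add: klein_density_def f_def S_def)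
  qed
  have "(\<lambda>x. \<bar>det (matrix (fan' x))\<bar> *\<^sub>R ?\<rho> (fan x)) absolutely_integrable_on S \<and>
      integral S (\<lambda>x. \<bar>det (matrix (fan' x))\<bar> *\<^sub>R ?\<rho> (fan x)) = vec ?I"
    using eq absS intS
    by (simp add: absolutely_integrable_on_1_iff integral_on_1_eq cong: integral_cong set_integrable_cong)
  then have "?\<rho> absolutely_integrable_on (fan ` S) \<and> integral (fan ` S) ?\<rho> = vec ?I"
  proof (subst (asm) has_absolute_integral_change_of_variables)
    have "closed {v :: real^2. v $ 1 = 0}" by (intro closed_Collect_eq continuous_intros)
    then show "S \<in> sets lebesgue" unfolding S_def R_def
      by (intro sets.Diff) (auto intro!: sets_completionI_sets borel_closed)
    show "inj_on fan S" by (auto simp: inj_on_def S_def fan_def vec_eq_iff forall_2)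
    have d: "((\<lambda>x :: real^2. x $ i) has_derivative (\<lambda>h. h $ i)) (at x within S)" for i x
      by (rule bounded_linear_imp_has_derivative[OF bounded_linear_vec_nth])
    show "(fan has_derivative fan' v) (at v within S)" for v
    proof -
      have "((\<lambda>x. fan x $ i) has_derivative (\<lambda>k. fan' v k $ i)) (at v within S)" for i
        using exhaust_2[of i] d[where x = v and i = 1] has_derivative_mult[OF d[where x = v and i = 1] d[where x = v and i = 2]]
        by (auto simp: fan_def fan'_def)
      then show ?thesis by (rule has_derivative_vecI)
    qed
  qed
  then have "integral (fan ` S) klein_density = ?I" by (simp add: integral_on_1_eq vec_eq_iff)
  moreover have "integral (fan ` R) klein_density = integral (fan ` S) klein_density"
  proof (rule integral_spike_set)
    have "fan ` R - fan ` S \<subseteq> {0}" by (auto simp: S_def fan_def vec_eq_iff forall_2)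
    then show "negligible {x \<in> fan ` R - fan ` S. klein_density x \<noteq> 0}"
      by (intro negligible_subset[OF negligible_sing[of 0]]) auto
    have "{x \<in> fan ` S - fan ` R. klein_density x \<noteq> 0} = {}" by (auto simp: S_def)
    then show "negligible {x \<in> fan ` S - fan ` R. klein_density x \<noteq> 0}" by (simp only: negligible_empty)
  qed
  ultimately show ?thesis using fan_image by (simp add: klein_area_eq R_def)
qed

text \<open>
  The cosine of this angle is \<open>\<plusminus> m / sqrt ((1 + m\<^sup>2) (1 - h\<^sup>2))\<close>, and
  \<open>(1 + m\<^sup>2) (1 - h\<^sup>2) = (end_norm m)\<^sup>2 + m\<^sup>2\<close>, so that it is \<open>\<plusminus> sin (arctan (m / end_norm m))\<close>.
  The sign tells on which side of \<open>(h, m h)\<close> the third vertex lies.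
\<close>

lemma standard_angle_at_end:
  assumes m: "m \<in> {\<alpha>..\<beta>}" and n: "n \<in> {\<alpha>..\<beta>}" "m \<noteq> n"
  shows "klein_angle (vector [h, m * h]) 0 (vector [h, n * h]) = pi / 2 - sgn (m - n) * arctan (m / end_norm m)"
proof -
  let ?z = "vector [h, m * h] :: real^2" and ?y = "vector [h, n * h] :: real^2"
  define q where "q = 1 + m\<^sup>2"
  have q: "q > 0" by (simp add: q_def add_pos_nonneg)
  have h1: "1 - h\<^sup>2 > 0"
  proof -
    have "h\<^sup>2 * 1 \<le> h\<^sup>2 * (1 + m\<^sup>2)" by (intro mult_left_mono) auto
    moreover have "h\<^sup>2 * (1 + m\<^sup>2) < 1" using slope_in_disc[OF m, of h] h by simp
    ultimately show ?thesis by linarith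
  qed
  have w: "end_norm m > 0" "(end_norm m)\<^sup>2 = 1 - h\<^sup>2 * q" using end_norm_pos[OF m] by (simp_all add: q_def)
  have lz: "lorentz ?z ?z = 1 - h\<^sup>2 * q" and ly: "lorentz ?y ?y = 1 - h\<^sup>2 * (1 + n\<^sup>2)"
    and lzy: "lorentz ?z ?y = 1 - h\<^sup>2 * (1 + m * n)" and l0: "lorentz ?z 0 = 1" "lorentz 0 0 = 1" "lorentz 0 ?y = 1"
    by (simp_all add: lorentz_def inner_vec_def sum_2 power2_eq_square algebra_simps q_def)
  have "lorentz ?z ?z > 0" unfolding lz w(2)[symmetric] using w(1) by simp
  then have zn: "norm ?z < 1" by (simp only: lorentz_self_pos_iff)
  have num: "lorentz ?z 0 * lorentz ?z ?y - lorentz ?z ?z * lorentz 0 ?y = h\<^sup>2 * m * (m - n)"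
    unfolding lz lzy l0 by (simp add: q_def algebra_simps power2_eq_square)
  have d1: "sqrt ((lorentz ?z 0)\<^sup>2 - lorentz ?z ?z * lorentz 0 0) = h * sqrt q"
    unfolding lz l0 using h by (simp add: real_sqrt_mult)
  have "(lorentz ?z ?y)\<^sup>2 - lorentz ?z ?z * lorentz ?y ?y = (h * (m - n))\<^sup>2 * (1 - h\<^sup>2)"
    unfolding lz ly lzy by (simp add: q_def algebra_simps power2_eq_square)
  then have d2: "sqrt ((lorentz ?z ?y)\<^sup>2 - lorentz ?z ?z * lorentz ?y ?y) = h * \<bar>m - n\<bar> * sqrt (1 - h\<^sup>2)"
    using h by (simp add: real_sqrt_mult abs_mult)
  have "klein_angle ?z 0 ?y = arccos (h\<^sup>2 * m * (m - n) / ((h * sqrt q) * (h * \<bar>m - n\<bar> * sqrt (1 - h\<^sup>2))))"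
    by (simp only: klein_angle_lorentz[OF zn] num d1 d2)
  also have "h\<^sup>2 * m * (m - n) / ((h * sqrt q) * (h * \<bar>m - n\<bar> * sqrt (1 - h\<^sup>2)))
      = sgn (m - n) * (m / (sqrt q * sqrt (1 - h\<^sup>2)))"
  proof -
    have "h\<^sup>2 * m * (\<sigma> * a) / ((h * sqrt q) * (h * a * sqrt (1 - h\<^sup>2))) = \<sigma> * (m / (sqrt q * sqrt (1 - h\<^sup>2)))"
      if "a \<noteq> 0" for a \<sigma> using h that by (simp add: power2_eq_square)
    from this[of "\<bar>m - n\<bar>" "sgn (m - n)"] show ?thesis using n(2) by (simp only: sgn_mult_abs abs_eq_0 right_minus_eq simp_thms)
  qed
  also have "m / (sqrt q * sqrt (1 - h\<^sup>2)) = sin (arctan (m / end_norm m))"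
  proof -
    have "1 + (m / end_norm m)\<^sup>2 = ((end_norm m)\<^sup>2 + m\<^sup>2) / (end_norm m)\<^sup>2"
      using w(1) by (simp add: power_divide add_divide_distrib)
    also have "(end_norm m)\<^sup>2 + m\<^sup>2 = q * (1 - h\<^sup>2)" unfolding w(2) by (simp add: q_def algebra_simps)
    finally have "sqrt (1 + (m / end_norm m)\<^sup>2) = sqrt q * sqrt (1 - h\<^sup>2) / end_norm m"
      using w(1) by (simp add: real_sqrt_divide real_sqrt_mult)
    then show ?thesis using w(1) by (simp add: sin_arctan)
  qed
  also have "sgn (m - n) * sin (arctan (m / end_norm m)) = cos (pi / 2 - sgn (m - n) * arctan (m / end_norm m))"
    unfolding cos_diff using n(2) by (simp add: sgn_if)
  also have "arccos \<dots> = pi / 2 - sgn (m - n) * arctan (m / end_norm m)"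
    using arctan_bounded[of "m / end_norm m"] by (intro arccos_cos) (auto simp: sgn_if)
  finally show ?thesis .
qed

lemma standard_angle_at_apex:
  "klein_angle 0 (vector [h, \<alpha> * h]) (vector [h, \<beta> * h]) = arctan \<beta> - arctan \<alpha>"
proof -
  let ?z = "vector [h, \<beta> * h] :: real^2" and ?y = "vector [h, \<alpha> * h] :: real^2"
  have lz: "lorentz ?z ?z = 1 - h\<^sup>2 * (1 + \<beta>\<^sup>2)" and ly: "lorentz ?y ?y = 1 - h\<^sup>2 * (1 + \<alpha>\<^sup>2)"
    and lyz: "lorentz ?y ?z = 1 - h\<^sup>2 * (1 + \<alpha> * \<beta>)" and l0: "lorentz 0 ?z = 1" "lorentz 0 0 = 1" "lorentz 0 ?y = 1"
    by (simp_all add: lorentz_def inner_vec_def sum_2 power2_eq_square algebra_simps)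
  have num: "lorentz 0 ?y * lorentz 0 ?z - lorentz 0 0 * lorentz ?y ?z = h\<^sup>2 * (1 + \<alpha> * \<beta>)"
    unfolding lyz l0 by simp
  have d: "sqrt ((lorentz 0 ?y)\<^sup>2 - lorentz 0 0 * lorentz ?y ?y) = h * sqrt (1 + \<alpha>\<^sup>2)"
    "sqrt ((lorentz 0 ?z)\<^sup>2 - lorentz 0 0 * lorentz ?z ?z) = h * sqrt (1 + \<beta>\<^sup>2)"
    unfolding lz ly l0 using h by (simp_all add: real_sqrt_mult)
  have "klein_angle 0 ?y ?z = arccos (h\<^sup>2 * (1 + \<alpha> * \<beta>) / ((h * sqrt (1 + \<alpha>\<^sup>2)) * (h * sqrt (1 + \<beta>\<^sup>2))))"
    using klein_angle_lorentz[of 0 ?y ?z] by (simp only: num d norm_zero zero_less_one simp_thms)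
  also have "h\<^sup>2 * (1 + \<alpha> * \<beta>) / ((h * sqrt (1 + \<alpha>\<^sup>2)) * (h * sqrt (1 + \<beta>\<^sup>2))) = cos (arctan \<beta> - arctan \<alpha>)"
    using h by (simp add: cos_diff cos_arctan sin_arctan power2_eq_square add_divide_distrib mult.commute)
  also have "arccos \<dots> = arctan \<beta> - arctan \<alpha>"
    using slopes arctan_bounded[of \<beta>] arctan_bounded[of \<alpha>] by (intro arccos_cos) (auto simp: arctan_monotone')
  finally show ?thesis .
qed

lemma gauss_bonnet_standard: "gauss_bonnet 0 (vector [h, \<alpha> * h]) (vector [h, \<beta> * h])"
  unfolding gauss_bonnet_def fan_area
  using standard_angle_at_apex standard_angle_at_end[of \<alpha> \<beta>] standard_angle_at_end[of \<beta> \<alpha>] slopes by simp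

end

text \<open>
  A rotation makes the side opposite to the centre vertical.
\<close>

lemma gauss_bonnet_at_origin:
  assumes y: "norm y < 1" and z: "norm z < 1" and indep: "y $ 1 * z $ 2 - y $ 2 * z $ 1 \<noteq> 0"
  shows "gauss_bonnet 0 y z"
proof -
  define \<delta> where "\<delta> = y $ 1 * z $ 2 - y $ 2 * z $ 1"
  define L where "L = sqrt ((z $ 1 - y $ 1)\<^sup>2 + (z $ 2 - y $ 2)\<^sup>2)"
  have "y \<noteq> z" using indep by auto
  then have "(z $ 1 - y $ 1)\<^sup>2 + (z $ 2 - y $ 2)\<^sup>2 > 0"
    by (auto simp: sum_power2_gt_zero_iff vec_eq_iff forall_2)
  then have L: "L > 0" "L\<^sup>2 = (z $ 1 - y $ 1)\<^sup>2 + (z $ 2 - y $ 2)\<^sup>2" by (simp_all add: L_def)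
  \<comment> \<open>\<open>(c, d)\<close> is the unit normal of the line through \<open>y\<close> and \<open>z\<close> that points away from \<open>0\<close>; the line has distance \<open>h\<close> from \<open>0\<close>.\<close>
  define c d where "c = sgn \<delta> * (z $ 2 - y $ 2) / L" and "d = - sgn \<delta> * (z $ 1 - y $ 1) / L"
  have \<delta>: "\<delta> \<noteq> 0" using indep by (simp add: \<delta>_def)
  have "(sgn \<delta>)\<^sup>2 = 1" using \<delta> by (simp add: sgn_if)
  then have "c\<^sup>2 + d\<^sup>2 = 1"
    using L \<open>y \<noteq> z\<close>
    by (auto simp: c_def d_def power_divide power_mult_distrib add_divide_distrib[symmetric] add.commute
        vec_eq_iff forall_2)
  then have iso: "klein_isometry (rotation c d) (\<lambda>_. 1) (\<lambda>_. rotation c d)" by (rule rotation_isometry)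
  define h where "h = \<bar>\<delta>\<bar> / L"
  have h: "h > 0" using L \<delta> by (simp add: h_def)
  have y1: "rotation c d y $ 1 = h"
  proof -
    have "rotation c d y $ 1 = sgn \<delta> * \<delta> / L"
      using L by (simp add: rotation_def c_def d_def \<delta>_def field_simps)
    then show ?thesis by (simp add: h_def abs_sgn mult.commute)
  qed
  have z1: "rotation c d z $ 1 = h"
  proof -
    have "rotation c d z $ 1 = sgn \<delta> * \<delta> / L"
      using L by (simp add: rotation_def c_def d_def \<delta>_def field_simps)
    then show ?thesis by (simp add: h_def abs_sgn mult.commute)
  qed
  define \<alpha> \<beta> where "\<alpha> = rotation c d y $ 2 / h" and "\<beta> = rotation c d z $ 2 / h"
  have ry: "rotation c d y = vector [h, \<alpha> * h]" and rz: "rotation c d z = vector [h, \<beta> * h]"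
    using h y1 z1 by (simp_all add: vec_eq_iff forall_2 \<alpha>_def \<beta>_def)
  have "\<alpha> \<noteq> \<beta>"
  proof
    assume "\<alpha> = \<beta>"
    then have "rotation c d y = rotation c d z" by (simp add: ry rz)
    then show False using inj_onD[OF isometry_inj[OF iso]] y z \<open>y \<noteq> z\<close> by simp
  qed
  have disc: "h\<^sup>2 * (1 + m\<^sup>2) < 1" if "norm (vector [h, m * h] :: real^2) < 1" for m
  proof -
    have "lorentz (vector [h, m * h]) (vector [h, m * h]) = 1 - h\<^sup>2 * (1 + m\<^sup>2)"
      by (simp add: lorentz_def inner_vec_def sum_2 power2_eq_square algebra_simps)
    then show ?thesis using lorentz_self_pos[OF that] by simp
  qed
  have in_disc: "h\<^sup>2 * (1 + \<alpha>\<^sup>2) < 1" "h\<^sup>2 * (1 + \<beta>\<^sup>2) < 1"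
    using disc isometry_disc[OF iso y] isometry_disc[OF iso z] by (simp_all add: ry rz)
  have "gauss_bonnet 0 (vector [h, \<alpha> * h]) (vector [h, \<beta> * h])"
    using gauss_bonnet_standard[OF h _ in_disc] gauss_bonnet_standard[OF h _ in_disc(2,1)] \<open>\<alpha> \<noteq> \<beta>\<close>
      gauss_bonnet_swap by (cases "\<alpha> < \<beta>") auto
  moreover have "rotation c d 0 = 0" by (simp add: rotation_def vec_eq_iff forall_2)
  ultimately show ?thesis
    using gauss_bonnet_isometry[OF iso, of 0 y z] y z by (simp add: ry rz)
qed

lemma gram_det_klein_cosh:
  assumes "norm x < 1" "norm y < 1" "norm z < 1"
  shows "gram_det (klein_cosh x y) (klein_cosh x z) (klein_cosh y z) =
    (lorentz x x * lorentz y y * lorentz z z + 2 * lorentz x y * lorentz x z * lorentz y z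
     - (lorentz x y)\<^sup>2 * lorentz z z - (lorentz x z)\<^sup>2 * lorentz y y - (lorentz y z)\<^sup>2 * lorentz x x)
     / (lorentz x x * lorentz y y * lorentz z z)"
proof -
  define a b c where "a = lorentz x x" and "b = lorentz y y" and "c = lorentz z z"
  have pos: "a > 0" "b > 0" "c > 0" using assms by (simp_all add: a_def b_def c_def lorentz_self_pos)
  have sq: "(klein_cosh x y)\<^sup>2 = (lorentz x y)\<^sup>2 / (a * b)" "(klein_cosh x z)\<^sup>2 = (lorentz x z)\<^sup>2 / (a * c)"
    "(klein_cosh y z)\<^sup>2 = (lorentz y z)\<^sup>2 / (b * c)"
    using pos by (simp_all add: klein_cosh_def power_divide power_mult_distrib a_def b_def c_def)
  have "klein_cosh x y * klein_cosh x z * klein_cosh y z = lorentz x y * lorentz x z * lorentz y z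
      / ((sqrt a * sqrt a) * (sqrt b * sqrt b) * (sqrt c * sqrt c))"
    by (simp add: klein_cosh_def a_def b_def c_def del: real_sqrt_mult_self)
  then have "klein_cosh x y * klein_cosh x z * klein_cosh y z = lorentz x y * lorentz x z * lorentz y z / (a * b * c)"
    using pos by simp
  then show ?thesis
    using pos unfolding gram_det_def sq a_def[symmetric] b_def[symmetric] c_def[symmetric]
    by (simp add: field_simps)
qed

text \<open>
  A rotation and a boost move \<open>x\<close> to the centre. Then the Gram determinant is a positive multiple
  of the square of the Euclidean determinant of the other two vertices, so these are linearly
  independent.
\<close>

theorem hyperbolic_gauss_bonnet:
  assumes x: "norm x < 1" and y: "norm y < 1" and z: "norm z < 1"
    and nondeg: "gram_det (klein_cosh x y) (klein_cosh x z) (klein_cosh y z) \<noteq> 0"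
  shows "klein_area (convex hull {x, y, z}) = pi - (klein_angle x y z + klein_angle y x z + klein_angle z x y)"
proof -
  define c d where "c = (if x = 0 then 1 else x $ 1 / norm x)" and "d = (if x = 0 then 0 else x $ 2 / norm x)"
  have nx: "(norm x)\<^sup>2 = (x $ 1)\<^sup>2 + (x $ 2)\<^sup>2" by (simp add: norm_vec_def L2_set_def sum_2)
  have "c\<^sup>2 + d\<^sup>2 = 1" by (auto simp: c_def d_def power_divide nx[symmetric] simp flip: add_divide_distrib)
  then have rot: "klein_isometry (rotation c d) (\<lambda>_. 1) (\<lambda>_. rotation c d)" by (rule rotation_isometry)
  have rx: "rotation c d x = vector [norm x, 0]"
  proof (cases "x = 0")
    case False
    then have "c * x $ 1 + d * x $ 2 = ((x $ 1)\<^sup>2 + (x $ 2)\<^sup>2) / norm x"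
      by (simp add: c_def d_def power2_eq_square add_divide_distrib)
    then have "c * x $ 1 + d * x $ 2 = (norm x)\<^sup>2 / norm x" by (simp only: nx)
    then show ?thesis using False by (simp add: rotation_def c_def d_def power2_eq_square)
  qed (simp add: rotation_def vec_eq_iff forall_2)
  obtain g' where boost: "klein_isometry (boost (norm x)) (\<lambda>w. (1 - norm x * w $ 1) / sqrt (1 - (norm x)\<^sup>2)) g'"
    using boost_isometry[of "norm x"] x by auto
  define g where "g = (\<lambda>w. boost (norm x) (rotation c d w))"
  have gx: "g x = 0" by (simp add: g_def rx boost_def vec_eq_iff forall_2)
  have disc: "norm (g w) < 1" if "norm w < 1" for w
    using isometry_disc[OF boost] isometry_disc[OF rot that] by (simp add: g_def)
  have cosh: "klein_cosh (g v) (g w) = klein_cosh v w" if "norm v < 1" "norm w < 1" for v w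
    using isometry_cosh[OF boost] isometry_cosh[OF rot that] isometry_disc[OF rot] that by (simp add: g_def)
  have "g y $ 1 * g z $ 2 - g y $ 2 * g z $ 1 \<noteq> 0"
  proof
    assume collinear: "g y $ 1 * g z $ 2 - g y $ 2 * g z $ 1 = 0"
    have "gram_det (klein_cosh x y) (klein_cosh x z) (klein_cosh y z)
      = gram_det (klein_cosh 0 (g y)) (klein_cosh 0 (g z)) (klein_cosh (g y) (g z))"
      using cosh[OF x y] cosh[OF x z] cosh[OF y z] gx by simp
    also have "\<dots> = (lorentz (g y) (g y) * lorentz (g z) (g z) + 2 * lorentz (g y) (g z)
        - lorentz (g z) (g z) - lorentz (g y) (g y) - (lorentz (g y) (g z))\<^sup>2)
        / (lorentz (g y) (g y) * lorentz (g z) (g z))"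
      using disc[OF y] disc[OF z] by (subst gram_det_klein_cosh) (simp_all add: lorentz_def[of 0])
    also have "lorentz (g y) (g y) * lorentz (g z) (g z) + 2 * lorentz (g y) (g z)
        - lorentz (g z) (g z) - lorentz (g y) (g y) - (lorentz (g y) (g z))\<^sup>2
      = (g y $ 1 * g z $ 2 - g y $ 2 * g z $ 1)\<^sup>2"
      by (simp add: lorentz_def inner_vec_def sum_2 power2_eq_square algebra_simps)
    finally show False using nondeg collinear by simp
  qed
  then have "gauss_bonnet (g x) (g y) (g z)"
    using gauss_bonnet_at_origin disc[OF y] disc[OF z] gx by simp
  then have "gauss_bonnet (rotation c d x) (rotation c d y) (rotation c d z)"
    using gauss_bonnet_isometry[OF boost] isometry_disc[OF rot] x y z by (simp add: g_def)
  then have "gauss_bonnet x y z" using gauss_bonnet_isometry[OF rot] x y z by simp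
  then show ?thesis by (simp add: gauss_bonnet_def)
qed

section \<open>Three circles meeting at prescribed angles\<close>

text \<open>
  Differentiation of the law of cosines; the square root of the Gram determinant is
  \<open>sqrt (a\<^sup>2 - 1) sqrt (b\<^sup>2 - 1)\<close> times the sine of the angle.
\<close>

lemma triangle_angle_derivative:
  fixes a b c :: "real \<Rightarrow> real"
  assumes a: "(a has_real_derivative a') (at t within S)" and b: "(b has_real_derivative b') (at t within S)"
    and c: "(c has_real_derivative c') (at t within S)"
    and pos: "a t > 1" "b t > 1" "gram_det (a t) (b t) (c t) > 0"
  shows "((\<lambda>t. triangle_angle (a t) (b t) (c t)) has_real_derivative
     (c' - a' * (a t * c t - b t) / ((a t)\<^sup>2 - 1) - b' * (b t * c t - a t) / ((b t)\<^sup>2 - 1))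
       / sqrt (gram_det (a t) (b t) (c t))) (at t within S)"
proof -
  define A B D n where "A = sqrt ((a t)\<^sup>2 - 1)" and "B = sqrt ((b t)\<^sup>2 - 1)"
    and "D = sqrt (gram_det (a t) (b t) (c t))" and "n = a t * b t - c t"
  have ab: "(a t)\<^sup>2 - 1 > 0" "(b t)\<^sup>2 - 1 > 0" using pos by (simp_all add: one_less_power)
  then have AB: "A > 0" "B > 0" "D > 0" "A\<^sup>2 = (a t)\<^sup>2 - 1" "B\<^sup>2 = (b t)\<^sup>2 - 1"
    using pos by (simp_all add: A_def B_def D_def)
  define k where "k = n / (A * B)"
  have "\<bar>k\<bar> < 1" using cosine_in_range[OF pos] by (simp only: k_def A_def B_def n_def)
  then have k1: "-1 < k" "k < 1" by auto
  have D2: "D\<^sup>2 = (A * B)\<^sup>2 - n\<^sup>2"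
  proof -
    have "D\<^sup>2 = gram_det (a t) (b t) (c t)" using pos by (simp add: D_def)
    also have "\<dots> = A\<^sup>2 * B\<^sup>2 - n\<^sup>2"
      unfolding AB gram_det_def n_def by (simp add: power2_eq_square algebra_simps)
    finally show ?thesis by (simp add: power_mult_distrib)
  qed
  have "1 - k\<^sup>2 = (D / (A * B))\<^sup>2"
    using AB by (simp add: k_def power_divide D2 diff_divide_distrib)
  then have sk: "sqrt (1 - k\<^sup>2) = D / (A * B)" using AB by simp
  have dA: "((\<lambda>t. sqrt ((a t)\<^sup>2 - 1)) has_real_derivative (a t * a' / A)) (at t within S)"
    using ab by (auto intro!: derivative_eq_intros a simp: A_def field_simps)
  have dB: "((\<lambda>t. sqrt ((b t)\<^sup>2 - 1)) has_real_derivative (b t * b' / B)) (at t within S)"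
    using ab by (auto intro!: derivative_eq_intros b simp: B_def field_simps)
  have dn: "((\<lambda>t. a t * b t - c t) has_real_derivative (a' * b t + b' * a t - c')) (at t within S)"
    by (auto intro!: derivative_eq_intros a b c)
  have "((\<lambda>t. (a t * b t - c t) / (sqrt ((a t)\<^sup>2 - 1) * sqrt ((b t)\<^sup>2 - 1))) has_real_derivative
      ((a' * b t + b' * a t - c') * (A * B) - n * (a t * a' / A * B + b t * b' / B * A)) / ((A * B) * (A * B)))
      (at t within S)" (is "(_ has_real_derivative ?k') _")
    unfolding A_def B_def n_def
    by (rule DERIV_divide[OF dn DERIV_mult[OF dA[unfolded A_def] dB[unfolded B_def]]])
      (use AB in \<open>auto simp: A_def B_def\<close>)
  note dk = this
  have "((\<lambda>t. triangle_angle (a t) (b t) (c t)) has_real_derivative inverse (- sqrt (1 - k\<^sup>2)) * ?k') (at t within S)"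
    unfolding triangle_angle_def k_def n_def A_def B_def
    by (rule DERIV_chain2[OF DERIV_arccos[OF k1[unfolded k_def n_def A_def B_def]] dk[unfolded n_def A_def B_def]])
  also have "inverse (- sqrt (1 - k\<^sup>2)) * ?k'
      = (c' - a' * (a t * c t - b t) / ((a t)\<^sup>2 - 1) - b' * (b t * c t - a t) / ((b t)\<^sup>2 - 1)) / D"
  proof -
    have "?k' = ((a' * b t + b' * a t - c') - n * (a t * a') / A\<^sup>2 - n * (b t * b') / B\<^sup>2) / (A * B)"
      using AB by (simp add: field_simps power2_eq_square)
    also have "(a' * b t + b' * a t - c') - n * (a t * a') / A\<^sup>2 - n * (b t * b') / B\<^sup>2
      = a' * (b t - n * a t / A\<^sup>2) + b' * (a t - n * b t / B\<^sup>2) - c'" by (simp add: algebra_simps)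
    also have "b t - n * a t / A\<^sup>2 = (a t * c t - b t) / A\<^sup>2"
    proof -
      have "b t * A\<^sup>2 - n * a t = a t * c t - b t" unfolding AB n_def by (simp add: algebra_simps power2_eq_square)
      then show ?thesis using AB(1,2) by (simp add: eq_divide_eq left_diff_distrib)
    qed
    also have "a t - n * b t / B\<^sup>2 = (b t * c t - a t) / B\<^sup>2"
    proof -
      have "a t * B\<^sup>2 - n * b t = b t * c t - a t" unfolding AB n_def by (simp add: algebra_simps power2_eq_square)
      then show ?thesis using AB(1,2) by (simp add: eq_divide_eq left_diff_distrib)
    qed
    finally have "?k' = (a' * (a t * c t - b t) / A\<^sup>2 + b' * (b t * c t - a t) / B\<^sup>2 - c') / (A * B)" by simp
    then have "inverse (- sqrt (1 - k\<^sup>2)) * ?k' = - (A * B / D) *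
        ((a' * (a t * c t - b t) / A\<^sup>2 + b' * (b t * c t - a t) / B\<^sup>2 - c') / (A * B))"
      unfolding sk by simp
    also have "- (A * B / D) * (X / (A * B)) = - X / D" for X using AB by simp
    finally show ?thesis by (simp add: AB(4,5))
  qed
  finally show ?thesis by (simp add: D_def)
qed

text \<open>
  The hyperbolic cosine of the distance between the centres of two circles with radii \<open>r\<close> and \<open>s\<close>,
  where \<open>c\<close> is the cosine of the weight of the edge.
\<close>

definition link_cosh :: "real \<Rightarrow> real \<Rightarrow> real \<Rightarrow> real" where
  "link_cosh c r s = cosh r * cosh s + sinh r * sinh s * c"

lemma link_cosh_commute: "link_cosh c r s = link_cosh c s r"
  by (simp add: link_cosh_def mult.commute)

lemma link_cosh_ge:
  assumes "r > 0" "s > 0" "0 \<le> c" shows "link_cosh c r s \<ge> cosh r * cosh s"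
  using assms by (simp add: link_cosh_def)

lemma link_cosh_gt_1:
  assumes "r > 0" "s > 0" "0 \<le> c" shows "link_cosh c r s > 1"
proof -
  have "cosh t > 1" if "t > 0" for t :: real
    using that cosh_real_strict_mono[of 0 t] by simp
  then have "1 < cosh r * cosh s" using assms by (intro less_1_mult) auto
  then show ?thesis using link_cosh_ge[OF assms] by linarith
qed

lemma link_cosh_le:
  assumes "r > 0" "s > 0" "c \<le> 1" shows "link_cosh c r s \<le> 2 * (cosh r * cosh s)"
proof -
  have "sinh r * sinh s * c \<le> sinh r * sinh s * 1" using assms by (intro mult_left_mono) auto
  also have "\<dots> \<le> cosh r * cosh s" using assms by (auto intro!: mult_mono sinh_le_cosh_real)
  finally show ?thesis by (simp add: link_cosh_def)
qed

text \<open>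
  Velocities are measured in the logarithmic coordinates, where \<open>r' = sinh r v\<close>.
\<close>

lemma link_cosh_derivative:
  assumes "(r has_real_derivative sinh (r t) * v) (at t within S)"
    and "(s has_real_derivative sinh (s t) * w) (at t within S)"
  shows "((\<lambda>t. link_cosh c (r t) (s t)) has_real_derivative
     (cosh (r t) * link_cosh c (r t) (s t) - cosh (s t)) * v
     + (cosh (s t) * link_cosh c (r t) (s t) - cosh (r t)) * w) (at t within S)"
proof -
  have "((\<lambda>t. link_cosh c (r t) (s t)) has_real_derivative
     (sinh (r t) * (sinh (r t) * v)) * cosh (s t) + (sinh (s t) * (sinh (s t) * w)) * cosh (r t)
     + ((cosh (r t) * (sinh (r t) * v)) * sinh (s t) + (cosh (s t) * (sinh (s t) * w)) * sinh (r t)) * c) (at t within S)"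
    unfolding link_cosh_def by (auto intro!: derivative_eq_intros assms)
  moreover have sq: "sinh x * (sinh x * y) = (cosh x)\<^sup>2 * y - y" for x y :: real
  proof -
    have "sinh x * (sinh x * y) = (sinh x)\<^sup>2 * y" by (simp add: power2_eq_square)
    also have "(sinh x)\<^sup>2 = (cosh x)\<^sup>2 - 1" by (simp add: cosh_square_eq)
    finally show ?thesis by (simp add: left_diff_distrib)
  qed
  ultimately show ?thesis
    by (elim DERIV_cong) (simp only: sq, simp add: link_cosh_def algebra_simps power2_eq_square)
qed

context
  fixes a b c r1 r2 r3 :: real
  assumes r: "r1 > 0" "r2 > 0" "r3 > 0"
    and w: "0 \<le> a" "a \<le> 1" "0 \<le> b" "b \<le> 1" "0 \<le> c" "c \<le> 1"
begin

text \<open>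
  Expanding the Gram determinant with \<open>cosh\<^sup>2 = 1 + sinh\<^sup>2\<close> gives a sum of terms that are all
  nonnegative for \<open>a, b, c \<in> [0, 1]\<close>. This is where weights in \<open>[0, pi/2]\<close> enter: any three radii yield a
  nondegenerate triangle.
\<close>

lemma gram_det_lower:
  "gram_det (link_cosh c r1 r2) (link_cosh b r1 r3) (link_cosh a r2 r3) \<ge> (sinh r1)\<^sup>2 * (sinh r2)\<^sup>2 * (1 - c\<^sup>2) + (sinh r1)\<^sup>2 * (sinh r3)\<^sup>2 * (1 - b\<^sup>2)
     + (sinh r2)\<^sup>2 * (sinh r3)\<^sup>2 * (1 - a\<^sup>2) + 2 * ((sinh r1)\<^sup>2 * (sinh r2)\<^sup>2 * (sinh r3)\<^sup>2)
     + 2 * (sinh r3)\<^sup>2 * (sinh r1 * sinh r2) * (c + a * b)"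
proof -
  define s1 s2 s3 x1 x2 x3 where "s1 = sinh r1" and "s2 = sinh r2" and "s3 = sinh r3"
    and "x1 = cosh r1" and "x2 = cosh r2" and "x3 = cosh r3"
  have s: "s1 > 0" "s2 > 0" "s3 > 0" using r by (simp_all add: s1_def s2_def s3_def)
  have x: "x1 \<ge> 1" "x2 \<ge> 1" "x3 \<ge> 1" by (simp_all add: x1_def x2_def x3_def cosh_real_ge_1)
  have e: "x1 * x1 = s1 * s1 + 1" "x2 * x2 = s2 * s2 + 1" "x3 * x3 = s3 * s3 + 1"
    using cosh_square_eq[of r1] cosh_square_eq[of r2] cosh_square_eq[of r3]
    by (simp_all add: s1_def s2_def s3_def x1_def x2_def x3_def power2_eq_square)
  have e': "x1 * (x1 * z) = s1 * (s1 * z) + z" "x2 * (x2 * z) = s2 * (s2 * z) + z" "x3 * (x3 * z) = s3 * (s3 * z) + z" for z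
    unfolding mult.assoc[symmetric] e by (simp_all add: distrib_right)
  have "gram_det (link_cosh c r1 r2) (link_cosh b r1 r3) (link_cosh a r2 r3) = s1\<^sup>2 * s2\<^sup>2 * (1 - c\<^sup>2) + s1\<^sup>2 * s3\<^sup>2 * (1 - b\<^sup>2) + s2\<^sup>2 * s3\<^sup>2 * (1 - a\<^sup>2)
      + 2 * (s1\<^sup>2 * s2\<^sup>2 * s3\<^sup>2) * (1 + a * b * c)
      + 2 * s3\<^sup>2 * (s1 * s2) * (x1 * x2) * (c + a * b)
      + 2 * s2\<^sup>2 * (s1 * s3) * (x1 * x3) * (b + a * c)
      + 2 * s1\<^sup>2 * (s2 * s3) * (x2 * x3) * (a + b * c)"
    unfolding gram_det_def link_cosh_def s1_def[symmetric] s2_def[symmetric] s3_def[symmetric]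
      x1_def[symmetric] x2_def[symmetric] x3_def[symmetric]
    by (simp add: power2_eq_square algebra_simps e e')
  moreover have "2 * s3\<^sup>2 * (s1 * s2) * (c + a * b) * 1 \<le> 2 * s3\<^sup>2 * (s1 * s2) * (c + a * b) * (x1 * x2)"
    using s w x by (intro mult_left_mono) (auto intro: mult_ge1_I)
  moreover have "0 \<le> 2 * s2\<^sup>2 * (s1 * s3) * (x1 * x3) * (b + a * c)" "0 \<le> 2 * s1\<^sup>2 * (s2 * s3) * (x2 * x3) * (a + b * c)"
    "0 \<le> 2 * (s1\<^sup>2 * s2\<^sup>2 * s3\<^sup>2) * (a * b * c)"
    using s w x by simp_all
  ultimately show ?thesis
    unfolding s1_def[symmetric] s2_def[symmetric] s3_def[symmetric] by (simp add: algebra_simps)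
qed

lemma gram_det_pos: "gram_det (link_cosh c r1 r2) (link_cosh b r1 r3) (link_cosh a r2 r3) > 0"
proof -
  have "1 - a\<^sup>2 \<ge> 0" "1 - b\<^sup>2 \<ge> 0" "1 - c\<^sup>2 \<ge> 0" using w by (simp_all add: power_le_one)
  then have "(sinh r1)\<^sup>2 * (sinh r2)\<^sup>2 * (1 - c\<^sup>2) + (sinh r1)\<^sup>2 * (sinh r3)\<^sup>2 * (1 - b\<^sup>2)
     + (sinh r2)\<^sup>2 * (sinh r3)\<^sup>2 * (1 - a\<^sup>2) + 2 * ((sinh r1)\<^sup>2 * (sinh r2)\<^sup>2 * (sinh r3)\<^sup>2)
     + 2 * (sinh r3)\<^sup>2 * (sinh r1 * sinh r2) * (c + a * b) > 0"
    using r w by (intro add_pos_nonneg add_nonneg_pos add_nonneg_nonneg mult_nonneg_nonneg mult_pos_pos) auto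
  then show ?thesis using gram_det_lower by linarith
qed

end

text \<open>
  The derivative of the angle at the first circle with respect to the logarithmic coordinate
  of the second one. Here \<open>c\<close>, \<open>b\<close>, \<open>a\<close> are the cosines of the weights of the edges \<open>12\<close>, \<open>13\<close>, \<open>23\<close>.
\<close>

definition coupling :: "real \<Rightarrow> real \<Rightarrow> real \<Rightarrow> real \<Rightarrow> real \<Rightarrow> real \<Rightarrow> real" where
  "coupling c b a r1 r2 r3 =
     (let C12 = link_cosh c r1 r2; C13 = link_cosh b r1 r3; C23 = link_cosh a r2 r3 in
       (cosh r1 * (C12 * C23 - C13) + cosh r2 * (C12 * C13 - C23) - cosh r3 * (C12\<^sup>2 - 1))
         / ((C12\<^sup>2 - 1) * sqrt (gram_det C12 C13 C23)))"

lemma gram_det_commute: "gram_det x y z = gram_det x z y" "gram_det x y z = gram_det y x z"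
  by (simp_all add: gram_det_def algebra_simps)

text \<open>
  The formula is symmetric in the circles \<open>1\<close> and \<open>2\<close>. This makes the Jacobian of the curvature
  symmetric.
\<close>

lemma coupling_commute: "coupling c b a r1 r2 r3 = coupling c a b r2 r1 r3"
  unfolding coupling_def Let_def
  by (simp only: link_cosh_commute[of c r2 r1] gram_det_commute(1)[of _ "link_cosh a r2 r3"]) (simp add: algebra_simps)

definition corner_angle :: "real \<Rightarrow> real \<Rightarrow> real \<Rightarrow> real \<Rightarrow> real \<Rightarrow> real \<Rightarrow> real" where
  "corner_angle c b a r1 r2 r3 = triangle_angle (link_cosh c r1 r2) (link_cosh b r1 r3) (link_cosh a r2 r3)"

lemma corner_angle_commute: "corner_angle c b a r1 r2 r3 = corner_angle b c a r1 r3 r2"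
  unfolding corner_angle_def
  by (subst triangle_angle_commute) (simp only: link_cosh_commute[of a r3 r2])

text \<open>
  The coefficient of \<open>v1\<close> is minus the sum of the couplings, each weighted with the hyperbolic
  cosine of the length of its edge. Together with the symmetry of the couplings this expresses the
  derivative of the area by the couplings as well.
\<close>

lemma corner_angle_derivative:
  assumes d1: "(r1 has_real_derivative sinh (r1 t) * v1) (at t within S)"
    and d2: "(r2 has_real_derivative sinh (r2 t) * v2) (at t within S)"
    and d3: "(r3 has_real_derivative sinh (r3 t) * v3) (at t within S)"
    and r: "r1 t > 0" "r2 t > 0" "r3 t > 0"
    and w: "0 \<le> a" "a \<le> 1" "0 \<le> b" "b \<le> 1" "0 \<le> c" "c \<le> 1"
  shows "((\<lambda>t. corner_angle c b a (r1 t) (r2 t) (r3 t)) has_real_derivative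
      coupling c b a (r1 t) (r2 t) (r3 t) * (v2 - link_cosh c (r1 t) (r2 t) * v1)
      + coupling b c a (r1 t) (r3 t) (r2 t) * (v3 - link_cosh b (r1 t) (r3 t) * v1)) (at t within S)"
proof -
  define p q s where "p = link_cosh c (r1 t) (r2 t)" and "q = link_cosh b (r1 t) (r3 t)" and "s = link_cosh a (r2 t) (r3 t)"
  define x y z where "x = cosh (r1 t)" and "y = cosh (r2 t)" and "z = cosh (r3 t)"
  have pq: "p > 1" "q > 1" "gram_det p q s > 0"
    using link_cosh_gt_1[OF r(1,2) w(5)] link_cosh_gt_1[OF r(1,3) w(3)] gram_det_pos[OF r w]
    by (simp_all add: p_def q_def s_def)
  define E G where "E = p\<^sup>2 - 1" and "G = q\<^sup>2 - 1"
  have EG: "E > 0" "G > 0" using pq by (simp_all add: E_def G_def one_less_power)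
  have "((\<lambda>t. corner_angle c b a (r1 t) (r2 t) (r3 t)) has_real_derivative
     (((y * s - z) * v2 + (z * s - y) * v3)
       - ((x * p - y) * v1 + (y * p - x) * v2) * (p * s - q) / E
       - ((x * q - z) * v1 + (z * q - x) * v3) * (q * s - p) / G) / sqrt (gram_det p q s)) (at t within S)"
    unfolding corner_angle_def p_def q_def s_def x_def y_def z_def E_def G_def
    by (rule triangle_angle_derivative[OF link_cosh_derivative[OF d1 d2] link_cosh_derivative[OF d1 d3] link_cosh_derivative[OF d2 d3]])
      (use pq in \<open>simp_all add: p_def q_def s_def\<close>)
  also have "((y * s - z) * v2 + (z * s - y) * v3)
       - ((x * p - y) * v1 + (y * p - x) * v2) * (p * s - q) / E
       - ((x * q - z) * v1 + (z * q - x) * v3) * (q * s - p) / G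
     = (x * (p * s - q) + y * (p * q - s) - z * E) / E * (v2 - p * v1)
       + (x * (q * s - p) + z * (p * q - s) - y * G) / G * (v3 - q * v1)"
  proof -
    \<comment> \<open>The three coefficients are compared separately: \<open>c2\<close>, \<open>c3\<close> and \<open>c1\<close> are those of \<open>v2\<close>, \<open>v3\<close> and \<open>- v1\<close>.\<close>
    have quot: "R / e = N - M / e" if "N * e - M = R" "e > 0" for N M R e :: real
      using that(2) by (simp flip: that(1) add: diff_divide_distrib)
    have quot': "R / e = u * (N - M / e) + L" if "R = u * (N * e - M) + L * e" "e > 0" for N M R L u e :: real
    proof -
      have "R / e = u * ((N * e - M) / e) + L" using that by (simp add: add_divide_distrib)
      also have "(N * e - M) / e = N - M / e" using that(2) by (simp add: diff_divide_distrib)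
      finally show ?thesis .
    qed
    have "(y * s - z) * E - (y * p - x) * (p * s - q) = x * (p * s - q) + y * (p * q - s) - z * E"
      unfolding E_def by (simp add: algebra_simps power2_eq_square)
    then have c2: "(x * (p * s - q) + y * (p * q - s) - z * E) / E = (y * s - z) - (y * p - x) * (p * s - q) / E"
      by (rule quot[OF _ EG(1)])
    have "(z * s - y) * G - (z * q - x) * (q * s - p) = x * (q * s - p) + z * (p * q - s) - y * G"
      unfolding G_def by (simp add: algebra_simps power2_eq_square)
    then have c3: "(x * (q * s - p) + z * (p * q - s) - y * G) / G = (z * s - y) - (z * q - x) * (q * s - p) / G"
      by (rule quot[OF _ EG(2)])
    have "(x * p - y) * (p * s - q) / E = p * ((y * s - z) - (y * p - x) * (p * s - q) / E) + (p * z - q * y)"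
    proof -
      have "(x * p - y) * (p * s - q) = p * ((y * s - z) * E - (y * p - x) * (p * s - q)) + (p * z - q * y) * E"
        unfolding E_def by (simp add: algebra_simps power2_eq_square)
      then show ?thesis by (rule quot'[OF _ EG(1)])
    qed
    moreover have "(x * q - z) * (q * s - p) / G = q * ((z * s - y) - (z * q - x) * (q * s - p) / G) + (q * y - p * z)"
    proof -
      have "(x * q - z) * (q * s - p) = q * ((z * s - y) * G - (z * q - x) * (q * s - p)) + (q * y - p * z) * G"
        unfolding G_def by (simp add: algebra_simps power2_eq_square)
      then show ?thesis by (rule quot'[OF _ EG(2)])
    qed
    ultimately have c1: "(x * p - y) * (p * s - q) / E + (x * q - z) * (q * s - p) / G
      = p * ((y * s - z) - (y * p - x) * (p * s - q) / E) + q * ((z * s - y) - (z * q - x) * (q * s - p) / G)"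
      by simp
    have "((y * s - z) * v2 + (z * s - y) * v3)
       - ((x * p - y) * v1 + (y * p - x) * v2) * (p * s - q) / E
       - ((x * q - z) * v1 + (z * q - x) * v3) * (q * s - p) / G
      = ((y * s - z) - (y * p - x) * (p * s - q) / E) * v2 + ((z * s - y) - (z * q - x) * (q * s - p) / G) * v3
        - ((x * p - y) * (p * s - q) / E + (x * q - z) * (q * s - p) / G) * v1"
      by (simp add: add_divide_distrib diff_divide_distrib algebra_simps)
    also have "\<dots> = ((y * s - z) - (y * p - x) * (p * s - q) / E) * (v2 - p * v1)
       + ((z * s - y) - (z * q - x) * (q * s - p) / G) * (v3 - q * v1)"
    proof -
      have "X * v2 + Y * v3 - (p * X + q * Y) * v1 = X * (v2 - p * v1) + Y * (v3 - q * v1)" for X Y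
        by (simp add: algebra_simps)
      then show ?thesis unfolding c1 .
    qed
    finally show ?thesis unfolding c2 c3 .
  qed
  also have "(\<dots>) / sqrt (gram_det p q s)
    = coupling c b a (r1 t) (r2 t) (r3 t) * (v2 - p * v1) + coupling b c a (r1 t) (r3 t) (r2 t) * (v3 - q * v1)"
    unfolding coupling_def Let_def link_cosh_commute[of a "r3 t"]
      p_def[symmetric] q_def[symmetric] s_def[symmetric] x_def[symmetric] y_def[symmetric] z_def[symmetric]
      E_def[symmetric] G_def[symmetric] gram_det_commute(2)[of q p]
    by (simp add: add_divide_distrib mult.commute[of q p])
  finally show ?thesis by (simp add: p_def q_def)
qed

context
  fixes a b c r1 r2 r3 :: real
  assumes r: "r1 > 0" "r2 > 0" "r3 > 0"
    and w: "0 \<le> a" "a \<le> 1" "0 \<le> b" "b \<le> 1" "0 \<le> c" "c \<le> 1"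
begin

lemma corner_angle_bounds: "0 < corner_angle c b a r1 r2 r3" "corner_angle c b a r1 r2 r3 < pi"
proof -
  have "\<bar>(link_cosh c r1 r2 * link_cosh b r1 r3 - link_cosh a r2 r3)
      / (sqrt ((link_cosh c r1 r2)\<^sup>2 - 1) * sqrt ((link_cosh b r1 r3)\<^sup>2 - 1))\<bar> < 1"
    by (rule cosine_in_range[OF link_cosh_gt_1 link_cosh_gt_1 gram_det_pos]) (use r w in auto)
  then show "0 < corner_angle c b a r1 r2 r3" "corner_angle c b a r1 r2 r3 < pi"
    unfolding corner_angle_def triangle_angle_def abs_less_iff
    by (simp_all add: arccos_lt_bounded)
qed

lemma link_cosh_sinh_ge: "cosh r2 * sinh r1 \<le> sqrt ((link_cosh c r1 r2)\<^sup>2 - 1)"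
proof (rule real_le_rsqrt)
  have "(cosh r1 * cosh r2)\<^sup>2 \<le> (link_cosh c r1 r2)\<^sup>2"
    using link_cosh_ge[OF r(1,2) w(5)] by (intro power_mono) auto
  moreover have "(cosh r2 * sinh r1)\<^sup>2 + (cosh r2)\<^sup>2 = (cosh r1 * cosh r2)\<^sup>2"
    by (simp add: power_mult_distrib cosh_square_eq[of r1] algebra_simps)
  moreover have "1 \<le> (cosh r2)\<^sup>2" by (simp add: cosh_real_ge_1)
  ultimately show "(cosh r2 * sinh r1)\<^sup>2 \<le> (link_cosh c r1 r2)\<^sup>2 - 1" by linarith
qed

text \<open>
  The numerator is a sum of nonnegative terms. Those with \<open>a\<close> or \<open>b\<close> vanish when both weights
  at the third circle are \<open>pi / 2\<close>, the first one for tangent circles.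
\<close>

lemma coupling_numerator:
  "cosh r1 * (link_cosh c r1 r2 * link_cosh a r2 r3 - link_cosh b r1 r3)
    + cosh r2 * (link_cosh c r1 r2 * link_cosh b r1 r3 - link_cosh a r2 r3)
    - cosh r3 * ((link_cosh c r1 r2)\<^sup>2 - 1)
   = (sinh r1)\<^sup>2 * (sinh r2)\<^sup>2 * (1 - c\<^sup>2) * cosh r3
     + sinh r1 * sinh r2 * sinh r3 * (a * sinh r1) * cosh r2 + sinh r1 * sinh r2 * sinh r3 * (a * c * sinh r2) * cosh r1
     + sinh r1 * sinh r2 * sinh r3 * (b * sinh r2) * cosh r1 + sinh r1 * sinh r2 * sinh r3 * (b * c * sinh r1) * cosh r2"
proof -
  define s1 s2 s3 x1 x2 x3 where "s1 = sinh r1" and "s2 = sinh r2" and "s3 = sinh r3"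
    and "x1 = cosh r1" and "x2 = cosh r2" and "x3 = cosh r3"
  have e: "x1 * x1 = s1 * s1 + 1" "x2 * x2 = s2 * s2 + 1"
    using cosh_square_eq[of r1] cosh_square_eq[of r2]
    by (simp_all add: s1_def s2_def x1_def x2_def power2_eq_square)
  have e': "x1 * (x1 * z) = s1 * (s1 * z) + z" "x2 * (x2 * z) = s2 * (s2 * z) + z" for z
    unfolding mult.assoc[symmetric] e by (simp_all add: distrib_right)
  show ?thesis
    unfolding link_cosh_def s1_def[symmetric] s2_def[symmetric] s3_def[symmetric]
      x1_def[symmetric] x2_def[symmetric] x3_def[symmetric]
    by (simp add: power2_eq_square algebra_simps e e')
qed

lemma coupling_nonneg: "coupling c b a r1 r2 r3 \<ge> 0"
proof -
  have "c\<^sup>2 \<le> 1" using w by (simp add: power_le_one)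
  then show ?thesis
    unfolding coupling_def Let_def coupling_numerator
    using r w link_cosh_gt_1[OF r(1,2) w(5)] gram_det_pos[OF r w]
    by (intro divide_nonneg_nonneg add_nonneg_nonneg mult_nonneg_nonneg) (auto simp: one_le_power less_imp_le)
qed

text \<open>
  A coupling can vanish, but the two couplings of one circle in a face do not vanish both: the
  first would require \<open>b = 0\<close>, the second \<open>b = 1\<close>.
\<close>

lemma coupling_eq_0D:
  assumes "coupling c b a r1 r2 r3 = 0" shows "c = 1" "b = 0"
proof -
  have "c\<^sup>2 \<le> 1" using w by (simp add: power_le_one)
  then have n: "0 \<le> (sinh r1)\<^sup>2 * (sinh r2)\<^sup>2 * (1 - c\<^sup>2) * cosh r3"
    "0 \<le> sinh r1 * sinh r2 * sinh r3 * (a * sinh r1) * cosh r2" "0 \<le> sinh r1 * sinh r2 * sinh r3 * (a * c * sinh r2) * cosh r1"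
    "0 \<le> sinh r1 * sinh r2 * sinh r3 * (b * sinh r2) * cosh r1" "0 \<le> sinh r1 * sinh r2 * sinh r3 * (b * c * sinh r1) * cosh r2"
    using r w by simp_all
  have "(link_cosh c r1 r2)\<^sup>2 - 1 > 0" using link_cosh_gt_1[OF r(1,2) w(5)] by (simp add: one_less_power)
  then have "(sinh r1)\<^sup>2 * (sinh r2)\<^sup>2 * (1 - c\<^sup>2) * cosh r3
     + sinh r1 * sinh r2 * sinh r3 * (a * sinh r1) * cosh r2 + sinh r1 * sinh r2 * sinh r3 * (a * c * sinh r2) * cosh r1
     + sinh r1 * sinh r2 * sinh r3 * (b * sinh r2) * cosh r1 + sinh r1 * sinh r2 * sinh r3 * (b * c * sinh r1) * cosh r2 = 0"
    using assms gram_det_pos[OF r w] unfolding coupling_def Let_def coupling_numerator by simp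
  then have "(sinh r1)\<^sup>2 * (sinh r2)\<^sup>2 * (1 - c\<^sup>2) * cosh r3 = 0"
    "sinh r1 * sinh r2 * sinh r3 * (b * sinh r2) * cosh r1 = 0"
    using n by linarith+
  then have "c\<^sup>2 = 1" "b = 0" using r by simp_all
  then show "c = 1" "b = 0" using w by (auto simp: power2_eq_1_iff)
qed

lemma link_cosh_sq_ge: "(sinh r1)\<^sup>2 + (sinh r2)\<^sup>2 \<le> (link_cosh c r1 r2)\<^sup>2 - 1"
proof -
  have "(cosh r1 * cosh r2)\<^sup>2 \<le> (link_cosh c r1 r2)\<^sup>2"
    using link_cosh_ge[OF r(1,2) w(5)] by (intro power_mono) auto
  moreover have "(cosh r1 * cosh r2)\<^sup>2 = 1 + (sinh r1)\<^sup>2 + (sinh r2)\<^sup>2 + (sinh r1)\<^sup>2 * (sinh r2)\<^sup>2"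
    by (simp add: power_mult_distrib cosh_square_eq algebra_simps)
  moreover have "0 \<le> (sinh r1)\<^sup>2 * (sinh r2)\<^sup>2" by simp
  ultimately show ?thesis by linarith
qed

text \<open>
  The parts of \<open>gram_det_lower\<close> against which the terms of \<open>coupling_numerator\<close> are estimated.
\<close>

lemma gram_det_lower_parts:
  "(sinh r1)\<^sup>2 * (sinh r2)\<^sup>2 * (1 - c\<^sup>2) \<le> gram_det (link_cosh c r1 r2) (link_cosh b r1 r3) (link_cosh a r2 r3)"
  "(sinh r3)\<^sup>2 * ((sinh r1)\<^sup>2 * (1 - b\<^sup>2) + 2 * (sinh r1 * sinh r2) * (a * b))
     \<le> gram_det (link_cosh c r1 r2) (link_cosh b r1 r3) (link_cosh a r2 r3)"
  "(sinh r3)\<^sup>2 * (2 * (sinh r1 * sinh r2) * c) \<le> gram_det (link_cosh c r1 r2) (link_cosh b r1 r3) (link_cosh a r2 r3)"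
proof -
  have sq: "1 - a\<^sup>2 \<ge> 0" "1 - b\<^sup>2 \<ge> 0" "1 - c\<^sup>2 \<ge> 0" using w by (simp_all add: power_le_one)
  have n: "0 \<le> (sinh r1)\<^sup>2 * (sinh r2)\<^sup>2 * (1 - c\<^sup>2)" "0 \<le> (sinh r1)\<^sup>2 * (sinh r3)\<^sup>2 * (1 - b\<^sup>2)"
    "0 \<le> (sinh r2)\<^sup>2 * (sinh r3)\<^sup>2 * (1 - a\<^sup>2)" "0 \<le> 2 * ((sinh r1)\<^sup>2 * (sinh r2)\<^sup>2 * (sinh r3)\<^sup>2)"
    "0 \<le> 2 * (sinh r3)\<^sup>2 * (sinh r1 * sinh r2) * c" "0 \<le> 2 * (sinh r3)\<^sup>2 * (sinh r1 * sinh r2) * (a * b)"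
    using sq r w by simp_all
  have e: "2 * (sinh r3)\<^sup>2 * (sinh r1 * sinh r2) * (c + a * b)
      = 2 * (sinh r3)\<^sup>2 * (sinh r1 * sinh r2) * c + 2 * (sinh r3)\<^sup>2 * (sinh r1 * sinh r2) * (a * b)"
    by (simp add: distrib_left)
  note * = n gram_det_lower[OF r w, unfolded e]
  show "(sinh r1)\<^sup>2 * (sinh r2)\<^sup>2 * (1 - c\<^sup>2) \<le> gram_det (link_cosh c r1 r2) (link_cosh b r1 r3) (link_cosh a r2 r3)"
    using * by linarith
  have "(sinh r3)\<^sup>2 * ((sinh r1)\<^sup>2 * (1 - b\<^sup>2) + 2 * (sinh r1 * sinh r2) * (a * b))
      = (sinh r1)\<^sup>2 * (sinh r3)\<^sup>2 * (1 - b\<^sup>2) + 2 * (sinh r3)\<^sup>2 * (sinh r1 * sinh r2) * (a * b)"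
    by (simp add: distrib_left mult_ac)
  then show "(sinh r3)\<^sup>2 * ((sinh r1)\<^sup>2 * (1 - b\<^sup>2) + 2 * (sinh r1 * sinh r2) * (a * b))
     \<le> gram_det (link_cosh c r1 r2) (link_cosh b r1 r3) (link_cosh a r2 r3)"
    using * by linarith
  have "(sinh r3)\<^sup>2 * (2 * (sinh r1 * sinh r2) * c) = 2 * (sinh r3)\<^sup>2 * (sinh r1 * sinh r2) * c" by simp
  then show "(sinh r3)\<^sup>2 * (2 * (sinh r1 * sinh r2) * c) \<le> gram_det (link_cosh c r1 r2) (link_cosh b r1 r3) (link_cosh a r2 r3)"
    using * by linarith
qed

text \<open>
  Both sides are homogeneous of degree \<open>6\<close> in \<open>(s, t)\<close>. Since \<open>1 - b\<^sup>2 \<ge> 1 - b\<close> and \<open>a \<ge> a\<^sup>2\<close>, the right-hand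
  side dominates \<open>a\<^sup>2\<close> times a convex combination, with weights \<open>1 - b\<close> and \<open>b\<close>, of two expressions that
  both exceed \<open>(s\<^sup>2 t)\<^sup>2\<close>.
\<close>

lemma near_term_bound:
  fixes s t :: real assumes "s > 0" "t > 0"
  shows "(s\<^sup>2 * t * a)\<^sup>2 \<le> (s\<^sup>2 + t\<^sup>2)\<^sup>2 * (s\<^sup>2 * (1 - b\<^sup>2) + 2 * (s * t) * (a * b))"
proof -
  have "b\<^sup>2 \<le> b" "a\<^sup>2 \<le> a" "a\<^sup>2 \<le> 1" using w by (simp_all add: power2_eq_square mult_left_le mult_le_one)
  have amgm: "2 * (s * t) \<le> s\<^sup>2 + t\<^sup>2" using sum_squares_bound[of s t] by simp
  have m1: "(s\<^sup>2 * t)\<^sup>2 \<le> (s\<^sup>2 + t\<^sup>2)\<^sup>2 * s\<^sup>2"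
  proof -
    have "s\<^sup>2 * t\<^sup>2 \<le> (s\<^sup>2 + t\<^sup>2) * (s\<^sup>2 + t\<^sup>2)" using assms by (intro mult_mono) auto
    from mult_right_mono[OF this, of "s\<^sup>2"] show ?thesis by (simp add: power2_eq_square mult_ac)
  qed
  have m2: "(s\<^sup>2 * t)\<^sup>2 \<le> (s\<^sup>2 + t\<^sup>2)\<^sup>2 * (2 * (s * t))"
  proof -
    have "s * t \<le> 2 * (s * t)" using assms by simp
  also note amgm
  also have "s\<^sup>2 + t\<^sup>2 \<le> 2 * (s\<^sup>2 + t\<^sup>2)" by simp
  finally have "s * t \<le> 2 * (s\<^sup>2 + t\<^sup>2)" .
    then have "s\<^sup>2 * (s * t) \<le> (s\<^sup>2 + t\<^sup>2) * (2 * (s\<^sup>2 + t\<^sup>2))"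
      using assms by (intro mult_mono[of "s\<^sup>2" "s\<^sup>2 + t\<^sup>2" "s * t"]) auto
    from mult_right_mono[OF this, of "s * t"] assms show ?thesis by (simp add: power2_eq_square mult_ac)
  qed
  have "(s\<^sup>2 * t * a)\<^sup>2 = (1 - b) * ((s\<^sup>2 * t)\<^sup>2 * a\<^sup>2) + b * ((s\<^sup>2 * t)\<^sup>2 * a\<^sup>2)"
    by (simp add: power_mult_distrib algebra_simps)
  also have "\<dots> \<le> (1 - b) * ((s\<^sup>2 + t\<^sup>2)\<^sup>2 * s\<^sup>2 * 1) + b * ((s\<^sup>2 + t\<^sup>2)\<^sup>2 * (2 * (s * t)) * a)"
    using w m1 m2 \<open>a\<^sup>2 \<le> a\<close> \<open>a\<^sup>2 \<le> 1\<close> assms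
    by (intro add_mono mult_left_mono mult_mono) auto
  also have "\<dots> = (s\<^sup>2 + t\<^sup>2)\<^sup>2 * (s\<^sup>2 * (1 - b) + 2 * (s * t) * (a * b))" by (simp add: algebra_simps)
  also have "\<dots> \<le> (s\<^sup>2 + t\<^sup>2)\<^sup>2 * (s\<^sup>2 * (1 - b\<^sup>2) + 2 * (s * t) * (a * b))"
    using \<open>b\<^sup>2 \<le> b\<close> by (intro mult_left_mono add_right_mono) auto
  finally show ?thesis .
qed

lemma far_term_bound:
  fixes s t :: real assumes "s > 0" "t > 0"
  shows "(s * t\<^sup>2 * (a * c))\<^sup>2 \<le> (s\<^sup>2 + t\<^sup>2)\<^sup>2 * (2 * (s * t) * c)"
proof -
  have amgm: "2 * (s * t) \<le> s\<^sup>2 + t\<^sup>2" using sum_squares_bound[of s t] by simp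
  have "s * t \<le> 2 * (s * t)" using assms by simp
  also note amgm
  also have "s\<^sup>2 + t\<^sup>2 \<le> 2 * (s\<^sup>2 + t\<^sup>2)" by simp
  finally have "s * t \<le> 2 * (s\<^sup>2 + t\<^sup>2)" .
  then have "t\<^sup>2 * (s * t) \<le> (s\<^sup>2 + t\<^sup>2) * (2 * (s\<^sup>2 + t\<^sup>2))"
    using assms by (intro mult_mono[of "t\<^sup>2" "s\<^sup>2 + t\<^sup>2" "s * t"]) auto
  from mult_right_mono[OF this, of "s * t"] assms
  have m: "(s * t\<^sup>2)\<^sup>2 \<le> (s\<^sup>2 + t\<^sup>2)\<^sup>2 * (2 * (s * t))" by (simp add: power2_eq_square mult_ac)
  have "(a * c)\<^sup>2 \<le> 1 * c" unfolding power_mult_distrib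
    using w by (intro mult_mono) (auto simp: power2_eq_square mult_left_le mult_le_one)
  then have "(s * t\<^sup>2)\<^sup>2 * (a * c)\<^sup>2 \<le> ((s\<^sup>2 + t\<^sup>2)\<^sup>2 * (2 * (s * t))) * c"
    using m w assms by (intro mult_mono) auto
  then show ?thesis by (simp add: power_mult_distrib mult_ac)
qed

text \<open>
  Each term of \<open>coupling_numerator\<close>, without the hyperbolic cosines, is at most the denominator
  of the coupling; the powers of the radii cancel, however small the radii are and whatever their
  ratios. After squaring, \<open>(sinh r1)\<^sup>2 + (sinh r2)\<^sup>2\<close> is a lower bound for the first factor of the denominator
  and one of the parts of the Gram determinant for the second.
\<close>

lemma coupling_term_bounds:
  defines "M \<equiv> ((link_cosh c r1 r2)\<^sup>2 - 1) * sqrt (gram_det (link_cosh c r1 r2) (link_cosh b r1 r3) (link_cosh a r2 r3))"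
  shows "(sinh r1)\<^sup>2 * (sinh r2)\<^sup>2 * (1 - c\<^sup>2) \<le> M"
    and "sinh r1 * sinh r2 * sinh r3 * (a * sinh r1) \<le> M"
    and "sinh r1 * sinh r2 * sinh r3 * (a * c * sinh r2) \<le> M"
proof -
  define E D where "E = (link_cosh c r1 r2)\<^sup>2 - 1"
    and "D = gram_det (link_cosh c r1 r2) (link_cosh b r1 r3) (link_cosh a r2 r3)"
  define s t q where "s = sinh r1" and "t = sinh r2" and "q = sinh r3"
  have pos: "s > 0" "t > 0" "q > 0" using r by (simp_all add: s_def t_def q_def)
  have E: "s\<^sup>2 + t\<^sup>2 \<le> E" using link_cosh_sq_ge by (simp add: E_def s_def t_def)
  have amgm: "2 * (s * t) \<le> s\<^sup>2 + t\<^sup>2" using sum_squares_bound[of s t] by simp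
  have E0: "0 \<le> E" "s * t \<le> E" using E amgm pos mult_pos_pos[OF pos(1,2)] by linarith+
  have D0: "D > 0" using gram_det_pos[OF r w] by (simp add: D_def)
  have M: "M = E * sqrt D" by (simp add: M_def E_def D_def)
  have key: "X \<le> M" if "X\<^sup>2 \<le> E\<^sup>2 * D" for X
  proof -
    have "X \<le> sqrt (E\<^sup>2 * D)" using that by (rule real_le_rsqrt)
    then show ?thesis using E0 by (simp add: M real_sqrt_mult)
  qed
  have E2: "(s\<^sup>2 + t\<^sup>2)\<^sup>2 \<le> E\<^sup>2" using E by (intro power_mono) auto
  have c2: "0 \<le> 1 - c\<^sup>2" "1 - c\<^sup>2 \<le> 1" using w by (simp_all add: power_le_one)
  show "(sinh r1)\<^sup>2 * (sinh r2)\<^sup>2 * (1 - c\<^sup>2) \<le> M"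
  proof (rule key)
    have "((sinh r1)\<^sup>2 * (sinh r2)\<^sup>2 * (1 - c\<^sup>2))\<^sup>2 = ((s * t)\<^sup>2 * (1 - c\<^sup>2)) * (s\<^sup>2 * t\<^sup>2 * (1 - c\<^sup>2))"
      by (simp add: s_def t_def power2_eq_square mult_ac)
    also have "\<dots> \<le> (E\<^sup>2 * 1) * D"
      using gram_det_lower_parts(1) c2 E0 pos
      by (intro mult_mono power_mono) (auto simp: D_def s_def t_def)
    finally show "((sinh r1)\<^sup>2 * (sinh r2)\<^sup>2 * (1 - c\<^sup>2))\<^sup>2 \<le> E\<^sup>2 * D" by simp
  qed
  show "sinh r1 * sinh r2 * sinh r3 * (a * sinh r1) \<le> M"
  proof (rule key)
    have "(sinh r1 * sinh r2 * sinh r3 * (a * sinh r1))\<^sup>2 = (s\<^sup>2 * t * a)\<^sup>2 * q\<^sup>2"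
      by (simp add: s_def t_def q_def power2_eq_square mult_ac)
    also have "\<dots> \<le> ((s\<^sup>2 + t\<^sup>2)\<^sup>2 * (s\<^sup>2 * (1 - b\<^sup>2) + 2 * (s * t) * (a * b))) * q\<^sup>2"
      by (intro mult_right_mono near_term_bound pos) auto
    also have "\<dots> = (s\<^sup>2 + t\<^sup>2)\<^sup>2 * (q\<^sup>2 * (s\<^sup>2 * (1 - b\<^sup>2) + 2 * (s * t) * (a * b)))" by simp
    also have "\<dots> \<le> E\<^sup>2 * D"
      using gram_det_lower_parts(2) E2 w pos
      by (intro mult_mono) (auto simp: D_def s_def t_def q_def power_le_one)
    finally show "(sinh r1 * sinh r2 * sinh r3 * (a * sinh r1))\<^sup>2 \<le> E\<^sup>2 * D" .
  qed
  show "sinh r1 * sinh r2 * sinh r3 * (a * c * sinh r2) \<le> M"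
  proof (rule key)
    have "(sinh r1 * sinh r2 * sinh r3 * (a * c * sinh r2))\<^sup>2 = (s * t\<^sup>2 * (a * c))\<^sup>2 * q\<^sup>2"
      by (simp add: s_def t_def q_def power2_eq_square mult_ac)
    also have "\<dots> \<le> ((s\<^sup>2 + t\<^sup>2)\<^sup>2 * (2 * (s * t) * c)) * q\<^sup>2"
      by (intro mult_right_mono far_term_bound pos) auto
    also have "\<dots> = (s\<^sup>2 + t\<^sup>2)\<^sup>2 * (q\<^sup>2 * (2 * (s * t) * c))" by simp
    also have "\<dots> \<le> E\<^sup>2 * D"
      using gram_det_lower_parts(3) E2 w pos
      by (intro mult_mono) (auto simp: D_def s_def t_def q_def)
    finally show "(sinh r1 * sinh r2 * sinh r3 * (a * c * sinh r2))\<^sup>2 \<le> E\<^sup>2 * D" .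
  qed
qed

end

text \<open>
  Of the five terms of \<open>coupling_numerator\<close>, the last two are handled by exchanging the circles \<open>1\<close> and \<open>2\<close>.
\<close>

lemma coupling_le:
  assumes r: "r1 > 0" "r2 > 0" "r3 > 0"
    and w: "0 \<le> a" "a \<le> 1" "0 \<le> b" "b \<le> 1" "0 \<le> c" "c \<le> 1"
    and R: "r1 \<le> R" "r2 \<le> R" "r3 \<le> R"
  shows "coupling c b a r1 r2 r3 \<le> 5 * cosh R"
proof -
  define M where "M = ((link_cosh c r1 r2)\<^sup>2 - 1) * sqrt (gram_det (link_cosh c r1 r2) (link_cosh b r1 r3) (link_cosh a r2 r3))"
  have "(link_cosh c r1 r2)\<^sup>2 - 1 > 0" using link_cosh_gt_1[OF r(1,2) w(5)] by (simp add: one_less_power)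
  then have M: "M > 0" using gram_det_pos[OF r w] by (simp add: M_def)
  have sw: "((link_cosh c r2 r1)\<^sup>2 - 1) * sqrt (gram_det (link_cosh c r2 r1) (link_cosh a r2 r3) (link_cosh b r1 r3)) = M"
    unfolding M_def link_cosh_commute[of c r2 r1] by (simp only: gram_det_commute(1)[of _ "link_cosh a r2 r3"])
  have ch: "cosh r1 \<le> cosh R" "cosh r2 \<le> cosh R" "cosh r3 \<le> cosh R"
    using r R by (simp_all add: cosh_real_nonneg_le_iff)
  have c2: "0 \<le> 1 - c\<^sup>2" using w by (simp add: power_le_one)
  have "(sinh r1)\<^sup>2 * (sinh r2)\<^sup>2 * (1 - c\<^sup>2) * cosh r3
     + sinh r1 * sinh r2 * sinh r3 * (a * sinh r1) * cosh r2 + sinh r1 * sinh r2 * sinh r3 * (a * c * sinh r2) * cosh r1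
     + sinh r1 * sinh r2 * sinh r3 * (b * sinh r2) * cosh r1 + sinh r1 * sinh r2 * sinh r3 * (b * c * sinh r1) * cosh r2
    \<le> M * cosh R + M * cosh R + M * cosh R + M * cosh R + M * cosh R"
  proof (intro add_mono mult_mono ch)
    show "(sinh r1)\<^sup>2 * (sinh r2)\<^sup>2 * (1 - c\<^sup>2) \<le> M" "sinh r1 * sinh r2 * sinh r3 * (a * sinh r1) \<le> M"
      "sinh r1 * sinh r2 * sinh r3 * (a * c * sinh r2) \<le> M"
      using coupling_term_bounds[OF r w] by (simp_all add: M_def)
    have "sinh r2 * sinh r1 * sinh r3 * (b * sinh r2) \<le> M" "sinh r2 * sinh r1 * sinh r3 * (b * c * sinh r1) \<le> M"
      using coupling_term_bounds(2,3)[OF r(2,1,3) w(3,4,1,2,5,6)] unfolding sw by simp_all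
    then show "sinh r1 * sinh r2 * sinh r3 * (b * sinh r2) \<le> M" "sinh r1 * sinh r2 * sinh r3 * (b * c * sinh r1) \<le> M"
      by (simp_all add: mult_ac)
  qed (use M in auto)
  also have "\<dots> = 5 * cosh R * M" by simp
  finally show ?thesis
    unfolding coupling_def Let_def coupling_numerator[OF r w] M_def[symmetric]
    using M by (simp add: divide_le_eq)
qed

text \<open>
  The angle at a large circle is small, uniformly in the other two radii: in the law of cosines
  the product \<open>cosh r2 cosh r3\<close> cancels, up to a factor \<open>2\<close>.
\<close>

lemma cos_corner_angle:
  assumes r: "r1 > 0" "r2 > 0" "r3 > 0"
    and w: "0 \<le> a" "a \<le> 1" "0 \<le> b" "b \<le> 1" "0 \<le> c" "c \<le> 1"
  shows "1 - 2 / (sinh r1)\<^sup>2 \<le> cos (corner_angle c b a r1 r2 r3)"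
proof -
  define p q s where "p = link_cosh c r1 r2" and "q = link_cosh b r1 r3" and "s = link_cosh a r2 r3"
  define A B where "A = sqrt (p\<^sup>2 - 1)" and "B = sqrt (q\<^sup>2 - 1)"
  have p: "p > 1" "q > 1" using link_cosh_gt_1[OF r(1,2) w(5)] link_cosh_gt_1[OF r(1,3) w(3)] by (simp_all add: p_def q_def)
  have A: "cosh r2 * sinh r1 \<le> A" using link_cosh_sinh_ge[OF r w] by (simp add: A_def p_def)
  have B: "cosh r3 * sinh r1 \<le> B" using link_cosh_sinh_ge[OF r(1,3,2) w(1,2,5,6,3,4)] by (simp add: B_def q_def)
  have s1: "sinh r1 > 0" using r by simp
  have low: "0 < (cosh r2 * sinh r1) * (cosh r3 * sinh r1)" using s1 by simp
  have AB: "(cosh r2 * sinh r1) * (cosh r3 * sinh r1) \<le> A * B"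
    using A B s1 by (intro mult_mono) (auto intro: order_trans[rotated])
  have "A \<le> p" "B \<le> q" using p by (simp_all add: A_def B_def real_le_lsqrt)
  then have "A * B \<le> p * q" using p by (intro mult_mono) (auto simp: B_def)
  then have "1 \<le> p * q / (A * B)" using low AB by (simp add: le_divide_eq)
  then have "1 - (p * q - s) / (A * B) \<le> s / (A * B)" by (simp add: diff_divide_distrib)
  also have "\<dots> \<le> (2 * (cosh r2 * cosh r3)) / ((cosh r2 * sinh r1) * (cosh r3 * sinh r1))"
    using low AB link_cosh_le[OF r(2,3) w(2)] by (intro frac_le) (auto simp: s_def)
  also have "\<dots> = 2 / (sinh r1)\<^sup>2" using s1 by (simp add: power2_eq_square)
  finally have "1 - 2 / (sinh r1)\<^sup>2 \<le> (p * q - s) / (A * B)" by simp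
  moreover have "cos (corner_angle c b a r1 r2 r3) = (p * q - s) / (A * B)"
  proof -
    have "\<bar>(p * q - s) / (A * B)\<bar> < 1"
      using cosine_in_range[OF p] gram_det_pos[OF r w] by (simp only: p_def q_def s_def A_def B_def)
    then show ?thesis unfolding corner_angle_def triangle_angle_def
      by (simp add: p_def[symmetric] q_def[symmetric] s_def[symmetric] A_def[symmetric] B_def[symmetric] cos_arccos_abs)
  qed
  ultimately show ?thesis by simp
qed

lemma continuous_on_link_cosh:
  assumes "continuous_on S f" "continuous_on S g"
  shows "continuous_on S (\<lambda>x. link_cosh c (f x) (g x))"
  unfolding link_cosh_def by (intro continuous_intros assms)

lemma continuous_on_gram_det:
  assumes "continuous_on S f" "continuous_on S g" "continuous_on S h"
  shows "continuous_on S (\<lambda>x. gram_det (f x) (g x) (h x))"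
  unfolding gram_det_def by (intro continuous_intros assms)

context
  fixes a b c :: real and f g h :: "'a::topological_space \<Rightarrow> real" and S
  assumes w: "0 \<le> a" "a \<le> 1" "0 \<le> b" "b \<le> 1" "0 \<le> c" "c \<le> 1"
    and cont: "continuous_on S f" "continuous_on S g" "continuous_on S h"
    and pos: "\<And>x. x \<in> S \<Longrightarrow> f x > 0" "\<And>x. x \<in> S \<Longrightarrow> g x > 0" "\<And>x. x \<in> S \<Longrightarrow> h x > 0"
begin

lemma continuous_on_links: "continuous_on S (\<lambda>x. link_cosh c (f x) (g x))" "continuous_on S (\<lambda>x. link_cosh b (f x) (h x))"
  "continuous_on S (\<lambda>x. link_cosh a (g x) (h x))"
  by (rule continuous_on_link_cosh; rule cont)+

lemma continuous_on_corner_angle: "continuous_on S (\<lambda>x. corner_angle c b a (f x) (g x) (h x))"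
proof -
  have gt: "link_cosh c (f x) (g x) > 1" "link_cosh b (f x) (h x) > 1" if "x \<in> S" for x
    using link_cosh_gt_1[OF pos(1,2)[OF that] w(5)] link_cosh_gt_1[OF pos(1,3)[OF that] w(3)] by auto
  have nz: "(link_cosh c (f x) (g x))\<^sup>2 \<noteq> 1" "(link_cosh b (f x) (h x))\<^sup>2 \<noteq> 1" if "x \<in> S" for x
    using gt[OF that] by (auto simp: power2_eq_1_iff)
  have "\<bar>(link_cosh c (f x) (g x) * link_cosh b (f x) (h x) - link_cosh a (g x) (h x))
      / (sqrt ((link_cosh c (f x) (g x))\<^sup>2 - 1) * sqrt ((link_cosh b (f x) (h x))\<^sup>2 - 1))\<bar> < 1" if "x \<in> S" for x
    using cosine_in_range[OF gt[OF that] gram_det_pos[OF pos[OF that] w]] .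
  moreover have "\<bar>k\<bar> < 1 \<Longrightarrow> - 1 \<le> k \<and> k \<le> 1" for k :: real by auto
  ultimately have range: "\<forall>x\<in>S. - 1 \<le> (link_cosh c (f x) (g x) * link_cosh b (f x) (h x) - link_cosh a (g x) (h x))
      / (sqrt ((link_cosh c (f x) (g x))\<^sup>2 - 1) * sqrt ((link_cosh b (f x) (h x))\<^sup>2 - 1)) \<and>
      (link_cosh c (f x) (g x) * link_cosh b (f x) (h x) - link_cosh a (g x) (h x))
      / (sqrt ((link_cosh c (f x) (g x))\<^sup>2 - 1) * sqrt ((link_cosh b (f x) (h x))\<^sup>2 - 1)) \<le> 1"
    by blast
  show ?thesis
    unfolding corner_angle_def triangle_angle_def
  proof (rule continuous_on_arccos[OF _ range], rule continuous_on_divide)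
    show "continuous_on S (\<lambda>x. link_cosh c (f x) (g x) * link_cosh b (f x) (h x) - link_cosh a (g x) (h x))"
      by (intro continuous_on_diff continuous_on_mult continuous_on_links)
    show "continuous_on S (\<lambda>x. sqrt ((link_cosh c (f x) (g x))\<^sup>2 - 1) * sqrt ((link_cosh b (f x) (h x))\<^sup>2 - 1))"
      by (intro continuous_on_diff continuous_on_mult continuous_on_real_sqrt continuous_on_power continuous_on_const continuous_on_links)
  qed (use nz in simp)
qed

lemma continuous_on_coupling: "continuous_on S (\<lambda>x. coupling c b a (f x) (g x) (h x))"
proof -
  have "(link_cosh c (f x) (g x))\<^sup>2 \<noteq> 1" if "x \<in> S" for x
    using link_cosh_gt_1[OF pos(1,2)[OF that] w(5)] by (auto simp: power2_eq_1_iff)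
  moreover have "gram_det (link_cosh c (f x) (g x)) (link_cosh b (f x) (h x)) (link_cosh a (g x) (h x)) \<noteq> 0"
    if "x \<in> S" for x
    using gram_det_pos[OF pos[OF that] w] by simp
  ultimately show ?thesis
    unfolding coupling_def Let_def
    by (intro continuous_on_divide continuous_on_add continuous_on_mult continuous_on_diff
        continuous_on_real_sqrt continuous_on_power continuous_on_const continuous_on_gram_det
        continuous_on_cosh continuous_on_links cont) auto
qed

end

section \<open>Logarithmic coordinates for the radii\<close>

text \<open>
  The inverse of \<open>r \<mapsto> ln (tanh (r / 2))\<close>, since \<open>tanh (r / 2) = (exp r - 1) / (exp r + 1)\<close>.
\<close>

definition radius_of_log :: "real \<Rightarrow> real" where
  "radius_of_log u = ln (1 + exp u) - ln (1 - exp u)"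

definition log_of_radius :: "real \<Rightarrow> real" where
  "log_of_radius r = ln (exp r - 1) - ln (exp r + 1)"

lemma radius_of_log_pos: "u < 0 \<Longrightarrow> radius_of_log u > 0"
  by (simp add: radius_of_log_def add_pos_pos)

lemma log_of_radius_neg: "r > 0 \<Longrightarrow> log_of_radius r < 0"
  by (simp add: log_of_radius_def add_pos_pos)

lemma exp_radius_of_log: "u < 0 \<Longrightarrow> exp (radius_of_log u) = (1 + exp u) / (1 - exp u)"
  by (simp add: radius_of_log_def exp_diff add_pos_pos)

lemma exp_log_of_radius: "r > 0 \<Longrightarrow> exp (log_of_radius r) = (exp r - 1) / (exp r + 1)"
  by (simp add: log_of_radius_def exp_diff add_pos_pos)

lemma radius_of_log_inverse: "r > 0 \<Longrightarrow> radius_of_log (log_of_radius r) = r"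
proof -
  assume r: "r > 0"
  define e where "e = exp r"
  have e: "e > 1" using r by (simp add: e_def)
  have "exp (radius_of_log (log_of_radius r)) = (1 + (e - 1) / (e + 1)) / (1 - (e - 1) / (e + 1))"
    using r by (simp add: exp_radius_of_log log_of_radius_neg exp_log_of_radius e_def)
  also have "\<dots> = e" using e by (simp add: field_simps)
  finally show ?thesis by (simp add: e_def)
qed

lemma log_of_radius_inverse: "u < 0 \<Longrightarrow> log_of_radius (radius_of_log u) = u"
proof -
  assume u: "u < 0"
  define e where "e = exp u"
  have e: "e > 0" "e < 1" using u by (simp_all add: e_def)
  have "exp (log_of_radius (radius_of_log u)) = ((1 + e) / (1 - e) - 1) / ((1 + e) / (1 - e) + 1)"
    using u by (simp add: exp_log_of_radius radius_of_log_pos exp_radius_of_log e_def)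
  also have "\<dots> = e" using e by (simp add: field_simps)
  finally show ?thesis by (simp add: e_def)
qed

lemma radius_of_log_derivative:
  assumes "u < 0" shows "(radius_of_log has_real_derivative sinh (radius_of_log u)) (at u within S)"
proof -
  define e where "e = exp u"
  have e: "e > 0" "e < 1" using assms by (simp_all add: e_def)
  have "sinh (radius_of_log u) = ((1 + e) / (1 - e) - (1 - e) / (1 + e)) / 2"
    using assms by (simp add: sinh_field_def exp_minus exp_radius_of_log e_def)
  also have "\<dots> = e / (1 + e) + e / (1 - e)"
  proof -
    have "(q / p - p / q) / 2 = (q * q - p * p) / (2 * (p * q))" "e / q + e / p = 2 * (e * p + e * q) / (2 * (p * q))"
      if "p > 0" "q > 0" for p q using that by (simp_all add: field_simps)
    moreover have "(1 + e) * (1 + e) - (1 - e) * (1 - e) = 2 * (e * (1 - e) + e * (1 + e))"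
      by (simp add: algebra_simps)
    ultimately show ?thesis using e by (metis add.commute add_pos_pos diff_gt_0_iff_gt zero_less_one)
  qed
  finally have "sinh (radius_of_log u) = e / (1 + e) + e / (1 - e)" .
  moreover have "(radius_of_log has_real_derivative e / (1 + e) + e / (1 - e)) (at u within S)"
    unfolding radius_of_log_def[abs_def] using e
    by (auto intro!: derivative_eq_intros simp: e_def add_pos_pos)
  ultimately show ?thesis by simp
qed

lemma log_of_radius_derivative:
  assumes "r > 0" shows "(log_of_radius has_real_derivative 1 / sinh r) (at r within S)"
proof -
  define e where "e = exp r"
  have e: "e > 1" using assms by (simp add: e_def)
  have "sinh r = (e - 1 / e) / 2" by (simp add: sinh_field_def exp_minus e_def inverse_eq_divide)
  also have "\<dots> = (e * e - 1) / (2 * e)" using e by (simp add: field_simps)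
  finally have "1 / sinh r = 2 * e / (e * e - 1)" by simp
  also have "e * e - 1 = (e - 1) * (e + 1)" by (simp add: algebra_simps)
  also have "2 * e / ((e - 1) * (e + 1)) = e / (e - 1) - e / (e + 1)" using e by (simp add: field_simps)
  finally have "1 / sinh r = e / (e - 1) - e / (e + 1)" .
  moreover have "(log_of_radius has_real_derivative e / (e - 1) - e / (e + 1)) (at r within S)"
    unfolding log_of_radius_def[abs_def] using e
    by (auto intro!: derivative_eq_intros simp: e_def add_pos_pos)
  ultimately show ?thesis by simp
qed

lemma radius_of_log_mono: "u \<le> v \<Longrightarrow> v < 0 \<Longrightarrow> radius_of_log u \<le> radius_of_log v"
  unfolding radius_of_log_def by (intro diff_mono ln_mono) (auto simp: add_pos_pos)

lemma continuous_on_radius_of_log: "continuous_on {..<0} radius_of_log"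
  by (rule DERIV_continuous_on, rule radius_of_log_derivative) simp

lemma continuous_on_log_of_radius: "continuous_on {0<..} log_of_radius"
  by (rule DERIV_continuous_on, rule log_of_radius_derivative) simp

definition radii :: "real^'v \<Rightarrow> real^'v" where "radii u = (\<chi> i. radius_of_log (u $ i))"
definition logs :: "real^'v \<Rightarrow> real^'v" where "logs r = (\<chi> i. log_of_radius (r $ i))"

lemma radii_packing: "u \<in> negative_orthant \<Longrightarrow> circle_packing_metric (radii u)"
  by (simp add: negative_orthant_def circle_packing_metric_def radii_def radius_of_log_pos)

lemma logs_negative: "circle_packing_metric r \<Longrightarrow> logs r \<in> negative_orthant"
  by (simp add: negative_orthant_def circle_packing_metric_def logs_def log_of_radius_neg)

lemma radii_logs: "circle_packing_metric r \<Longrightarrow> radii (logs r) = r"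
  by (simp add: circle_packing_metric_def logs_def radii_def vec_eq_iff radius_of_log_inverse)

lemma logs_radii: "u \<in> negative_orthant \<Longrightarrow> logs (radii u) = u"
  by (simp add: negative_orthant_def logs_def radii_def vec_eq_iff log_of_radius_inverse)

lemma continuous_on_radii: "continuous_on negative_orthant (radii :: real^'v::finite \<Rightarrow> real^'v)"
  unfolding radii_def
proof (rule continuous_on_vec_lambda)
  show "continuous_on negative_orthant (\<lambda>u :: real^'v. radius_of_log (u $ i))" for i
    by (rule continuous_on_compose2[OF continuous_on_radius_of_log])
      (auto simp: negative_orthant_def intro!: continuous_intros)
qed

lemma tendsto_logs:
  fixes r :: "'a \<Rightarrow> real^'v::finite"
  assumes "(r \<longlongrightarrow> r') G" "circle_packing_metric r'"
  shows "((\<lambda>t. logs (r t)) \<longlongrightarrow> logs r') G"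
proof -
  have "isCont log_of_radius (r' $ i)" for i
    using assms(2) continuous_on_log_of_radius continuous_on_eq_continuous_at[OF open_greaterThan]
    by (auto simp: circle_packing_metric_def)
  then show ?thesis unfolding logs_def
    by (intro tendsto_vec_lambda isCont_tendsto_compose[of _ log_of_radius] tendsto_vec_nth assms(1))
qed

lemma tendsto_radii:
  fixes u :: "'a \<Rightarrow> real^'v::finite"
  assumes "(u \<longlongrightarrow> z) G" "z \<in> negative_orthant"
  shows "((\<lambda>t. radii (u t)) \<longlongrightarrow> radii z) G"
  using continuous_on_radii continuous_on_eq_continuous_at[OF open_negative_orthant] assms
  by (intro isCont_tendsto_compose[of _ radii]) blast+

lemma has_vector_derivative_vec_iff:
  fixes x :: "real \<Rightarrow> real^'n::finite"
  shows "(x has_vector_derivative x') (at t within S) \<longleftrightarrow>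
    (\<forall>i. ((\<lambda>t. x t $ i) has_real_derivative x' $ i) (at t within S))"
proof
  assume "(x has_vector_derivative x') (at t within S)"
  then show "\<forall>i. ((\<lambda>t. x t $ i) has_real_derivative x' $ i) (at t within S)"
    using bounded_linear.has_vector_derivative[OF bounded_linear_vec_nth]
    by (auto simp: has_real_derivative_iff_has_vector_derivative)
next
  assume "\<forall>i. ((\<lambda>t. x t $ i) has_real_derivative x' $ i) (at t within S)"
  then show "(x has_vector_derivative x') (at t within S)"
    unfolding has_vector_derivative_def has_real_derivative_iff_has_vector_derivative
    by (intro has_derivative_vecI) simp
qed

section \<open>Angles and areas of the faces\<close>

definition third_vertex :: "'v set \<Rightarrow> 'v \<Rightarrow> 'v \<Rightarrow> 'v" where
  "third_vertex f i j = (THE k. k \<in> f - {i, j})"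

lemma third_vertex_commute: "third_vertex f i j = third_vertex f j i"
  by (simp add: third_vertex_def insert_commute)

lemma third_vertex_eq: "i \<noteq> j \<Longrightarrow> k \<noteq> i \<Longrightarrow> k \<noteq> j \<Longrightarrow> third_vertex {i, j, k} i j = k"
  unfolding third_vertex_def by (rule the_equality) auto

lemma face_at_vertex:
  assumes "card f = 3" "i \<in> f"
  obtains j k where "f = {i, j, k}" "i \<noteq> j" "i \<noteq> k" "j \<noteq> k"
proof -
  obtain x y z where f: "f = {x, y, z}" "x \<noteq> y" "x \<noteq> z" "y \<noteq> z"
    using assms(1) by (auto simp: card_3_iff)
  then consider "i = x" | "i = y" | "i = z" using assms(2) by auto
  then show ?thesis
  proof cases
    case 1 show ?thesis by (rule that[of y z]) (use 1 f in auto)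
  next
    case 2 show ?thesis by (rule that[of x z]) (use 2 f in auto)
  next
    case 3 show ?thesis by (rule that[of x y]) (use 3 f in auto)
  qed
qed

lemma face_at_edge:
  assumes "card f = 3" "i \<in> f" "j \<in> f" "i \<noteq> j"
  obtains k where "f = {i, j, k}" "k \<noteq> i" "k \<noteq> j"
proof -
  obtain x y where f: "f = {i, x, y}" "i \<noteq> x" "i \<noteq> y" "x \<noteq> y"
    using face_at_vertex[OF assms(1,2)] by metis
  then consider "j = x" | "j = y" using assms(3,4) by auto
  then show ?thesis
  proof cases
    case 1 show ?thesis by (rule that[of y]) (use 1 f in auto)
  next
    case 2 show ?thesis by (rule that[of x]) (use 2 f in auto)
  qed
qed

locale weighted_complex =
  fixes F :: "'v::finite set set" and \<Phi> :: "'v set \<Rightarrow> real"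
  assumes face_card: "f \<in> F \<Longrightarrow> card f = 3"
    and cover: "\<Union>F = UNIV"
    and weights: "e \<in> edges F \<Longrightarrow> 0 \<le> \<Phi> e \<and> \<Phi> e \<le> pi / 2"
begin

definition weight :: "'v \<Rightarrow> 'v \<Rightarrow> real" where "weight i j = cos (\<Phi> {i, j})"

lemma weight_commute: "weight i j = weight j i"
  by (simp add: weight_def insert_commute)

lemma weight_bounds:
  assumes "f \<in> F" "i \<in> f" "j \<in> f" "i \<noteq> j" shows "0 \<le> weight i j" "weight i j \<le> 1"
proof -
  have "{i, j} \<in> edges F" using assms by (auto simp: edges_def)
  then have "0 \<le> \<Phi> {i, j}" "\<Phi> {i, j} \<le> pi / 2" using weights by blast+
  then show "0 \<le> weight i j" "weight i j \<le> 1"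
    using pi_gt_zero unfolding weight_def by (auto intro!: cos_ge_zero elim: order_trans[rotated])
qed

definition edge_cosh :: "real^'v \<Rightarrow> 'v \<Rightarrow> 'v \<Rightarrow> real" where
  "edge_cosh r i j = link_cosh (weight i j) (r $ i) (r $ j)"

lemma edge_cosh_commute: "edge_cosh r i j = edge_cosh r j i"
  by (simp add: edge_cosh_def weight_commute[of i j] link_cosh_commute[of _ "r $ i"])

lemma edge_length_eq: "edge_length \<Phi> r i j = arcosh (edge_cosh r i j)"
  by (simp add: edge_length_def edge_cosh_def link_cosh_def weight_def)

lemma edge_cosh_gt_1:
  assumes "circle_packing_metric r" "f \<in> F" "i \<in> f" "j \<in> f" "i \<noteq> j" shows "edge_cosh r i j > 1"
  unfolding edge_cosh_def
  using assms weight_bounds by (intro link_cosh_gt_1) (auto simp: circle_packing_metric_def)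

lemma face_gram_det_pos:
  assumes "circle_packing_metric r" "f \<in> F" "f = {i, j, k}" "i \<noteq> j" "i \<noteq> k" "j \<noteq> k"
  shows "gram_det (edge_cosh r i j) (edge_cosh r i k) (edge_cosh r j k) > 0"
  unfolding edge_cosh_def
  using assms weight_bounds[OF assms(2)] by (intro gram_det_pos) (auto simp: circle_packing_metric_def)

text \<open>
  The inner angle by the law of cosines, which is defined for all radii and chooses an order of
  the other two vertices.
\<close>

definition angle :: "real^'v \<Rightarrow> 'v set \<Rightarrow> 'v \<Rightarrow> real" where
  "angle r f i = (let j = SOME j. j \<in> f - {i}; k = third_vertex f i j in
     corner_angle (weight i j) (weight i k) (weight j k) (r $ i) (r $ j) (r $ k))"

lemma angle_eq:
  assumes "i \<noteq> j" "i \<noteq> k" "j \<noteq> k"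
  shows "angle r {i, j, k} i = corner_angle (weight i j) (weight i k) (weight j k) (r $ i) (r $ j) (r $ k)"
proof -
  define j' where "j' = (SOME j'. j' \<in> {i, j, k} - {i})"
  have "j' \<in> {i, j, k} - {i}" unfolding j'_def by (rule someI[of _ j]) (use assms in auto)
  then consider "j' = j" | "j' = k" by auto
  then show ?thesis
  proof cases
    case 1
    then show ?thesis using assms third_vertex_eq[of i j k] unfolding angle_def Let_def j'_def[symmetric] by simp
  next
    case 2
    have "third_vertex {i, j, k} i k = j" using assms third_vertex_eq[of i k j] by (simp add: insert_commute)
    then show ?thesis using 2 unfolding angle_def Let_def j'_def[symmetric]
      by (simp add: corner_angle_commute[of "weight i k"] weight_commute[of k j])
  qed
qed

lemma angle_eq_triangle_angle:
  assumes "i \<noteq> j" "i \<noteq> k" "j \<noteq> k"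
  shows "angle r {i, j, k} i = triangle_angle (edge_cosh r i j) (edge_cosh r i k) (edge_cosh r j k)"
  using assms by (simp add: angle_eq corner_angle_def edge_cosh_def)

context
  fixes r :: "real^'v" and f :: "'v set" assumes r: "circle_packing_metric r" and f: "f \<in> F"
begin

text \<open>
  Both lengths are values of \<open>arcosh\<close> at arguments that are at least \<open>1\<close>, where it is injective.
\<close>

lemma realizes_face_iff:
  "realizes_face \<Phi> r f P \<longleftrightarrow> (\<forall>i\<in>f. norm (P i) < 1) \<and>
    (\<forall>i\<in>f. \<forall>j\<in>f. i \<noteq> j \<longrightarrow> klein_cosh (P i) (P j) = edge_cosh r i j)"
proof -
  have "klein_dist (P i) (P j) = arcosh (edge_cosh r i j) \<longleftrightarrow> klein_cosh (P i) (P j) = edge_cosh r i j"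
    if "norm (P i) < 1" "norm (P j) < 1" "i \<in> f" "j \<in> f" "i \<noteq> j" for i j
    using klein_dist_eq_iff[OF that(1,2)] edge_cosh_gt_1[OF r f that(3-5)] by simp
  then show ?thesis unfolding realizes_face_def edge_length_eq by auto
qed

text \<open>
  One vertex is put at the centre of the disc; the positivity of the Gram determinant is the condition
  in \<open>triangle_exists\<close>.
\<close>

lemma face_realization_exists:
  obtains P where "realizes_face \<Phi> r f P"
proof -
  obtain i where "i \<in> f" using face_card[OF f] by fastforce
  then obtain j k where ijk: "f = {i, j, k}" "i \<noteq> j" "i \<noteq> k" "j \<noteq> k"
    using face_at_vertex[OF face_card[OF f]] by metis
  have gt: "edge_cosh r i j > 1" "edge_cosh r i k > 1"
    using edge_cosh_gt_1[OF r f] ijk by auto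
  obtain y z where yz: "norm y < 1" "norm z < 1" "klein_cosh 0 y = edge_cosh r i j"
    "klein_cosh 0 z = edge_cosh r i k" "klein_cosh y z = edge_cosh r j k"
    using triangle_exists[OF gt face_gram_det_pos[OF r f ijk]] by metis
  have "realizes_face \<Phi> r f (\<lambda>v. if v = i then 0 else if v = j then y else z)"
    unfolding realizes_face_iff using yz ijk
    by (auto simp: klein_cosh_commute[of y 0] klein_cosh_commute[of z 0] klein_cosh_commute[of z y]
        edge_cosh_commute[of r j i] edge_cosh_commute[of r k i] edge_cosh_commute[of r k j])
  then show ?thesis by (rule that)
qed

lemma realized_angle:
  assumes P: "realizes_face \<Phi> r f P" and ijk: "f = {i, j, k}"
  shows "klein_angle (P i) (P j) (P k) = angle r f i"
proof -
  have d: "i \<noteq> j" "i \<noteq> k" "j \<noteq> k" using face_card[OF f] unfolding ijk by (auto simp: card_insert_if split: if_splits)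
  then have "klein_cosh (P i) (P j) = edge_cosh r i j" "klein_cosh (P i) (P k) = edge_cosh r i k"
    "klein_cosh (P j) (P k) = edge_cosh r j k" "norm (P i) < 1" "norm (P j) < 1" "norm (P k) < 1"
    using P[unfolded realizes_face_iff] by (auto simp: ijk)
  then show ?thesis using d by (simp add: klein_law_of_cosines angle_eq_triangle_angle ijk)
qed

text \<open>
  Every realization, and every order of the other two vertices, gives the value of the law of
  cosines; so the definite description denotes it.
\<close>

lemma inner_angle_eq: "i \<in> f \<Longrightarrow> inner_angle \<Phi> r f i = angle r f i"
proof -
  assume "i \<in> f"
  then obtain j k where ijk: "f = {i, j, k}" using face_at_vertex[OF face_card[OF f]] by metis
  obtain P where P: "realizes_face \<Phi> r f P" by (rule face_realization_exists)
  show ?thesis unfolding inner_angle_def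
    by (rule the_equality) (use P ijk realized_angle in metis)+
qed

lemma face_area_eq: "face_area \<Phi> r f = pi - (\<Sum>l\<in>f. angle r f l)"
proof -
  obtain i where "i \<in> f" using face_card[OF f] by fastforce
  then obtain j k where ijk: "f = {i, j, k}" "i \<noteq> j" "i \<noteq> k" "j \<noteq> k"
    using face_at_vertex[OF face_card[OF f]] by metis
  have area: "klein_area (convex hull (P ` f)) = pi - (\<Sum>l\<in>f. angle r f l)" if P: "realizes_face \<Phi> r f P" for P
  proof -
    have c: "klein_cosh (P i) (P j) = edge_cosh r i j" "klein_cosh (P i) (P k) = edge_cosh r i k"
      "klein_cosh (P j) (P k) = edge_cosh r j k" "norm (P i) < 1" "norm (P j) < 1" "norm (P k) < 1"
      using P ijk unfolding realizes_face_iff by auto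
    have "klein_area (convex hull {P i, P j, P k})
      = pi - (klein_angle (P i) (P j) (P k) + klein_angle (P j) (P i) (P k) + klein_angle (P k) (P i) (P j))"
      using face_gram_det_pos[OF r f ijk] by (intro hyperbolic_gauss_bonnet c(4-6)) (simp add: c)
    also have "klein_angle (P i) (P j) (P k) = angle r f i" by (rule realized_angle[OF P ijk(1)])
    also have "klein_angle (P j) (P i) (P k) = angle r f j"
      by (rule realized_angle[OF P]) (use ijk in auto)
    also have "klein_angle (P k) (P i) (P j) = angle r f k"
      by (rule realized_angle[OF P]) (use ijk in auto)
    also have "angle r f i + angle r f j + angle r f k = (\<Sum>l\<in>f. angle r f l)"
      using ijk(2-4) by (simp add: ijk(1))
    finally show ?thesis using ijk(1) by simp
  qed
  obtain P where P: "realizes_face \<Phi> r f P" by (rule face_realization_exists)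
  show ?thesis unfolding face_area_def
    by (rule the_equality) (use P area in metis)+
qed

end

text \<open>
  The contribution of the face \<open>f\<close> to the coefficient \<open>B\<close> of its edge \<open>{i, j}\<close>.
\<close>

definition face_coupling :: "real^'v \<Rightarrow> 'v set \<Rightarrow> 'v \<Rightarrow> 'v \<Rightarrow> real" where
  "face_coupling r f i j = (let k = third_vertex f i j in
     coupling (weight i j) (weight i k) (weight j k) (r $ i) (r $ j) (r $ k))"

lemma face_coupling_commute: "face_coupling r f i j = face_coupling r f j i"
  unfolding face_coupling_def Let_def third_vertex_commute[of f i]
  by (subst coupling_commute) (simp only: weight_commute[of i j])

lemma face_coupling_eq:
  assumes "i \<noteq> j" "i \<noteq> k" "j \<noteq> k"
  shows "face_coupling r {i, j, k} i j = coupling (weight i j) (weight i k) (weight j k) (r $ i) (r $ j) (r $ k)"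
    and "face_coupling r {i, j, k} i k = coupling (weight i k) (weight i j) (weight j k) (r $ i) (r $ k) (r $ j)"
proof -
  show "face_coupling r {i, j, k} i j = coupling (weight i j) (weight i k) (weight j k) (r $ i) (r $ j) (r $ k)"
    using assms third_vertex_eq[of i j k] by (simp add: face_coupling_def)
  have "third_vertex {i, j, k} i k = j" using assms third_vertex_eq[of i k j] by (simp add: insert_commute)
  then show "face_coupling r {i, j, k} i k = coupling (weight i k) (weight i j) (weight j k) (r $ i) (r $ k) (r $ j)"
    by (simp add: face_coupling_def weight_commute[of k j])
qed

lemma face_coupling_bounds:
  assumes r: "circle_packing_metric r" and f: "f \<in> F" and ij: "i \<in> f" "j \<in> f" "i \<noteq> j"
  shows "face_coupling r f i j \<ge> 0"
    and "(\<And>l. r $ l \<le> R) \<Longrightarrow> face_coupling r f i j \<le> 5 * cosh R"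
    and "face_coupling r f i j = 0 \<Longrightarrow> k \<in> f \<Longrightarrow> k \<noteq> i \<Longrightarrow> k \<noteq> j \<Longrightarrow> weight i j = 1 \<and> weight i k = 0"
proof -
  obtain l where l: "f = {i, j, l}" "l \<noteq> i" "l \<noteq> j" using face_at_edge[OF face_card[OF f] ij] by metis
  have eq: "face_coupling r f i j = coupling (weight i j) (weight i l) (weight j l) (r $ i) (r $ j) (r $ l)"
    using face_coupling_eq(1)[of i j l r] l ij by auto
  have rp: "r $ i > 0" "r $ j > 0" "r $ l > 0" using r by (auto simp: circle_packing_metric_def)
  have w: "0 \<le> weight j l" "weight j l \<le> 1" "0 \<le> weight i l" "weight i l \<le> 1" "0 \<le> weight i j" "weight i j \<le> 1"
    using weight_bounds[OF f] l ij by auto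
  show "face_coupling r f i j \<ge> 0" unfolding eq by (rule coupling_nonneg[OF rp w])
  show "face_coupling r f i j \<le> 5 * cosh R" if "\<And>l. r $ l \<le> R"
    unfolding eq by (rule coupling_le[OF rp w that that that])
  show "weight i j = 1 \<and> weight i k = 0" if "face_coupling r f i j = 0" "k \<in> f" "k \<noteq> i" "k \<noteq> j"
    using coupling_eq_0D[OF rp w] that l eq by auto
qed

lemma angle_derivative:
  assumes c: "\<And>j. ((\<lambda>t. c t $ j) has_real_derivative sinh (c t $ j) * v $ j) (at t within S)"
    and pos: "circle_packing_metric (c t)" and f: "f \<in> F" and i: "i \<in> f"
  shows "((\<lambda>t. angle (c t) f i) has_real_derivative
     (\<Sum>j\<in>f - {i}. face_coupling (c t) f i j * (v $ j - edge_cosh (c t) i j * v $ i))) (at t within S)"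
proof -
  obtain j k where ijk: "f = {i, j, k}" "i \<noteq> j" "i \<noteq> k" "j \<noteq> k"
    using face_at_vertex[OF face_card[OF f] i] by metis
  have p: "c t $ i > 0" "c t $ j > 0" "c t $ k > 0" using pos by (auto simp: circle_packing_metric_def)
  have w: "0 \<le> weight j k" "weight j k \<le> 1" "0 \<le> weight i k" "weight i k \<le> 1" "0 \<le> weight i j" "weight i j \<le> 1"
    using weight_bounds[OF f] ijk by auto
  have fi: "f - {i} = {j, k}" using ijk by auto
  show ?thesis
    unfolding fi using corner_angle_derivative[OF c[of i] c[of j] c[of k] p w] ijk(2-4)
    by (simp add: ijk(1) angle_eq face_coupling_eq edge_cosh_def)
qed

lemma angle_bounds:
  assumes r: "circle_packing_metric r" and f: "f \<in> F" and i: "i \<in> f"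
  shows "0 < angle r f i" "angle r f i < pi" "1 - 2 / (sinh (r $ i))\<^sup>2 \<le> cos (angle r f i)"
proof -
  obtain j k where ijk: "f = {i, j, k}" "i \<noteq> j" "i \<noteq> k" "j \<noteq> k"
    using face_at_vertex[OF face_card[OF f] i] by metis
  have p: "r $ i > 0" "r $ j > 0" "r $ k > 0" using r by (auto simp: circle_packing_metric_def)
  have w: "0 \<le> weight j k" "weight j k \<le> 1" "0 \<le> weight i k" "weight i k \<le> 1" "0 \<le> weight i j" "weight i j \<le> 1"
    using weight_bounds[OF f] ijk by auto
  show "0 < angle r f i" "angle r f i < pi" "1 - 2 / (sinh (r $ i))\<^sup>2 \<le> cos (angle r f i)"
    using corner_angle_bounds[OF p w] cos_corner_angle[OF p w] ijk(2-4) by (simp_all add: ijk(1) angle_eq)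
qed

lemma continuous_on_angle:
  assumes "f \<in> F" "i \<in> f"
  shows "continuous_on {r. circle_packing_metric r} (\<lambda>r. angle r f i)"
proof -
  obtain j k where ijk: "f = {i, j, k}" "i \<noteq> j" "i \<noteq> k" "j \<noteq> k"
    using face_at_vertex[OF face_card[OF assms(1)] assms(2)] by metis
  show ?thesis unfolding ijk(1) angle_eq[OF ijk(2-4)]
    using weight_bounds[OF assms(1)] ijk
    by (intro continuous_on_corner_angle continuous_intros) (auto simp: circle_packing_metric_def)
qed

lemma continuous_on_face_coupling:
  assumes "f \<in> F" "i \<in> f" "j \<in> f" "i \<noteq> j"
  shows "continuous_on {r. circle_packing_metric r} (\<lambda>r. face_coupling r f i j)"
proof -
  obtain k where ijk: "f = {i, j, k}" "k \<noteq> i" "k \<noteq> j" using face_at_edge[OF face_card[OF assms(1)] assms(2-4)] by metis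
  show ?thesis unfolding ijk(1) face_coupling_eq(1)[OF assms(4) ijk(2)[symmetric] ijk(3)[symmetric]]
    using weight_bounds[OF assms(1)] ijk assms
    by (intro continuous_on_coupling continuous_intros) (auto simp: circle_packing_metric_def)
qed

end

section \<open>The Calabi flow in logarithmic coordinates\<close>

context weighted_complex
begin

definition faces_at :: "'v \<Rightarrow> 'v set set" where "faces_at i = {f \<in> F. i \<in> f}"

definition total_curvature :: "real^'v \<Rightarrow> 'v \<Rightarrow> real" where
  "total_curvature r i = 2 * pi - (\<Sum>f\<in>faces_at i. angle r f i)"

text \<open>
  The coefficient \<open>B\<close>; see \<open>coeff_B_eq\<close>.
\<close>

definition edge_coupling :: "real^'v \<Rightarrow> 'v \<Rightarrow> 'v \<Rightarrow> real" where
  "edge_coupling r i j = (if i = j then 0 else \<Sum>f\<in>{f \<in> F. {i, j} \<subseteq> f}. face_coupling r f i j)"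

text \<open>
  The coefficient \<open>A\<close>; see \<open>coeff_A_eq\<close>.
\<close>

definition area_rate :: "real^'v \<Rightarrow> 'v \<Rightarrow> real" where
  "area_rate r i = (\<Sum>f\<in>faces_at i. \<Sum>j\<in>f - {i}. face_coupling r f i j * (edge_cosh r i j - 1))"

lemma sum_faces_at:
  fixes g :: "'v set \<Rightarrow> 'v \<Rightarrow> real"
  shows "(\<Sum>f\<in>faces_at i. \<Sum>j\<in>f - {i}. g f j) = (\<Sum>j\<in>UNIV. if i = j then 0 else \<Sum>f\<in>{f \<in> F. {i, j} \<subseteq> f}. g f j)"
proof -
  have star: "(\<Sum>j\<in>UNIV. if j \<in> f - {i} then g f j else 0) = (\<Sum>j\<in>f - {i}. g f j)" for f
    by (rule sum.mono_neutral_cong_right) auto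
  have "(\<Sum>f\<in>faces_at i. \<Sum>j\<in>f - {i}. g f j) = (\<Sum>f\<in>F. if i \<in> f then \<Sum>j\<in>f - {i}. g f j else 0)"
    unfolding faces_at_def by (rule sum.inter_filter) simp
  also have "\<dots> = (\<Sum>f\<in>F. if i \<in> f then \<Sum>j\<in>UNIV. if j \<in> f - {i} then g f j else 0 else 0)"
    by (simp only: star)
  also have "\<dots> = (\<Sum>f\<in>F. \<Sum>j\<in>UNIV. if i \<in> f \<and> j \<in> f \<and> i \<noteq> j then g f j else 0)"
    by (intro sum.cong refl) (auto intro!: sum.cong)
  also have "\<dots> = (\<Sum>j\<in>UNIV. \<Sum>f\<in>F. if i \<in> f \<and> j \<in> f \<and> i \<noteq> j then g f j else 0)"
    by (rule sum.swap)
  also have "\<dots> = (\<Sum>j\<in>UNIV. if i = j then 0 else \<Sum>f\<in>{f \<in> F. {i, j} \<subseteq> f}. g f j)"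
  proof (intro sum.cong refl)
    fix j
    show "(\<Sum>f\<in>F. if i \<in> f \<and> j \<in> f \<and> i \<noteq> j then g f j else 0) = (if i = j then 0 else \<Sum>f\<in>{f \<in> F. {i, j} \<subseteq> f}. g f j)"
      by (cases "i = j") (simp_all add: sum.inter_filter[symmetric] conj_commute)
  qed
  finally show ?thesis .
qed

lemma sum_edge_coupling:
  "(\<Sum>j\<in>UNIV. edge_coupling r i j * x j) = (\<Sum>f\<in>faces_at i. \<Sum>j\<in>f - {i}. face_coupling r f i j * x j)"
  unfolding sum_faces_at edge_coupling_def by (intro sum.cong refl) (simp add: sum_distrib_right)

lemma edge_coupling_commute: "edge_coupling r i j = edge_coupling r j i"
  unfolding edge_coupling_def by (simp add: face_coupling_commute[of r _ i] insert_commute)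

text \<open>
  In \<open>angle_derivative\<close>, \<open>v\<^sub>j - cosh l\<^sub>i\<^sub>j v\<^sub>i = - (v\<^sub>i - v\<^sub>j) - (cosh l\<^sub>i\<^sub>j - 1) v\<^sub>i\<close>: the first part
  gives the Laplacian of \<open>v\<close>, the second one \<open>A\<^sub>i v\<^sub>i\<close>.
\<close>

lemma total_curvature_derivative:
  assumes c: "\<And>j. ((\<lambda>t. c t $ j) has_real_derivative sinh (c t $ j) * v $ j) (at t within S)"
    and pos: "circle_packing_metric (c t)"
  shows "((\<lambda>t. total_curvature (c t) i) has_real_derivative
     area_rate (c t) i * v $ i + (\<Sum>j\<in>UNIV. edge_coupling (c t) i j * (v $ i - v $ j))) (at t within S)"
proof -
  have "((\<lambda>t. total_curvature (c t) i) has_real_derivative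
     0 - (\<Sum>f\<in>faces_at i. \<Sum>j\<in>f - {i}. face_coupling (c t) f i j * (v $ j - edge_cosh (c t) i j * v $ i))) (at t within S)"
    unfolding total_curvature_def
    by (intro DERIV_diff DERIV_const DERIV_sum angle_derivative[OF c pos]) (auto simp: faces_at_def)
  also have "0 - (\<Sum>f\<in>faces_at i. \<Sum>j\<in>f - {i}. face_coupling (c t) f i j * (v $ j - edge_cosh (c t) i j * v $ i))
    = area_rate (c t) i * v $ i + (\<Sum>j\<in>UNIV. edge_coupling (c t) i j * (v $ i - v $ j))"
    unfolding sum_edge_coupling area_rate_def sum_distrib_right sum.distrib[symmetric] diff_0 sum_negf[symmetric]
    by (intro sum.cong refl) (simp add: algebra_simps)
  finally show ?thesis .
qed

context
  fixes r :: "real^'v" assumes r: "circle_packing_metric r"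
begin

lemma coupling_term_nonneg:
  assumes "f \<in> F" "i \<in> f" "j \<in> f - {i}"
  shows "0 \<le> face_coupling r f i j * (edge_cosh r i j - 1)"
  using face_coupling_bounds(1)[OF r assms(1,2)] edge_cosh_gt_1[OF r assms(1,2), of j] assms
  by (intro mult_nonneg_nonneg) auto

text \<open>
  In a face at \<open>i\<close> the two couplings of \<open>i\<close> are not both zero.
\<close>

lemma area_rate_pos: "area_rate r i > 0"
proof -
  have "i \<in> \<Union>F" using cover by simp
  then obtain f where f: "f \<in> F" "i \<in> f" by blast
  obtain j k where ijk: "f = {i, j, k}" "i \<noteq> j" "i \<noteq> k" "j \<noteq> k"
    using face_at_vertex[OF face_card[OF f(1)] f(2)] by metis
  have "face_coupling r f i j \<noteq> 0 \<or> face_coupling r f i k \<noteq> 0"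
    using face_coupling_bounds(3)[OF r f(1), of i j k] face_coupling_bounds(3)[OF r f(1), of i k j] ijk by auto
  then obtain l where l: "l \<in> f - {i}" "face_coupling r f i l \<noteq> 0" using ijk by auto
  have "face_coupling r f i l * (edge_cosh r i l - 1) > 0"
    using l face_coupling_bounds(1)[OF r f, of l] edge_cosh_gt_1[OF r f, of l]
    by (intro mult_pos_pos) auto
  then have "(\<Sum>j\<in>f - {i}. face_coupling r f i j * (edge_cosh r i j - 1)) > 0"
    using l(1) coupling_term_nonneg[OF f] by (intro sum_pos2[of _ l]) auto
  then show ?thesis unfolding area_rate_def
    using f by (intro sum_pos2[of _ f] sum_nonneg coupling_term_nonneg) (auto simp: faces_at_def)
qed

lemma edge_coupling_nonneg: "edge_coupling r i j \<ge> 0"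
  unfolding edge_coupling_def using face_coupling_bounds(1)[OF r] by (auto intro!: sum_nonneg)

lemma total_curvature_bounds:
  "total_curvature r i \<le> 2 * pi" "2 * pi - real (card F) * pi \<le> total_curvature r i"
proof -
  have "0 \<le> (\<Sum>f\<in>faces_at i. angle r f i)"
    by (intro sum_nonneg) (use angle_bounds(1)[OF r] in \<open>auto simp: faces_at_def less_imp_le\<close>)
  then show "total_curvature r i \<le> 2 * pi" by (simp add: total_curvature_def)
  have "(\<Sum>f\<in>faces_at i. angle r f i) \<le> real (card (faces_at i)) * pi"
    by (rule sum_bounded_above) (use angle_bounds(2)[OF r] in \<open>auto simp: faces_at_def less_imp_le\<close>)
  also have "\<dots> \<le> real (card F) * pi"
    by (intro mult_right_mono) (auto simp: faces_at_def intro!: card_mono)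
  finally show "2 * pi - real (card F) * pi \<le> total_curvature r i" by (simp add: total_curvature_def)
qed

lemma coefficient_bounds:
  assumes R: "\<And>l. r $ l \<le> R"
  shows "edge_coupling r i j \<le> real (card F) * (5 * cosh R)"
    and "area_rate r i \<le> real (card F) * (3 * (5 * cosh R * (2 * (cosh R * cosh R))))"
proof -
  have c: "face_coupling r f i j \<le> 5 * cosh R" if "f \<in> F" "i \<in> f" "j \<in> f" "i \<noteq> j" for f i j
    using face_coupling_bounds(2)[OF r that R] .
  have "edge_coupling r i j \<le> real (card {f \<in> F. {i, j} \<subseteq> f}) * (5 * cosh R)"
    unfolding edge_coupling_def using c by (auto intro!: sum_bounded_above)
  also have "\<dots> \<le> real (card F) * (5 * cosh R)"
    by (intro mult_right_mono) (auto intro!: card_mono)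
  finally show "edge_coupling r i j \<le> real (card F) * (5 * cosh R)" .
  have pos: "0 < r $ l" for l using r by (simp add: circle_packing_metric_def)
  have "(\<Sum>j\<in>f - {i}. face_coupling r f i j * (edge_cosh r i j - 1)) \<le> 3 * (5 * cosh R * (2 * (cosh R * cosh R)))"
    if f: "f \<in> F" "i \<in> f" for f
  proof -
    have "face_coupling r f i j * (edge_cosh r i j - 1) \<le> 5 * cosh R * (2 * (cosh R * cosh R))" if j: "j \<in> f - {i}" for j
    proof (rule mult_mono)
      show "face_coupling r f i j \<le> 5 * cosh R" using c f j by auto
      have "edge_cosh r i j \<le> 2 * (cosh (r $ i) * cosh (r $ j))"
        unfolding edge_cosh_def using weight_bounds[OF f(1)] f j pos by (intro link_cosh_le) auto
      also have "\<dots> \<le> 2 * (cosh R * cosh R)"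
      proof -
        have "0 \<le> R" using R[of i] pos[of i] by linarith
        then show ?thesis
          using R less_imp_le[OF pos] by (intro mult_left_mono mult_mono) (auto simp: cosh_real_nonneg_le_iff)
      qed
      finally show "edge_cosh r i j - 1 \<le> 2 * (cosh R * cosh R)" by simp
      show "0 \<le> edge_cosh r i j - 1" using edge_cosh_gt_1[OF r f, of j] j by auto
    qed simp
    then have "(\<Sum>j\<in>f - {i}. face_coupling r f i j * (edge_cosh r i j - 1))
        \<le> real (card (f - {i})) * (5 * cosh R * (2 * (cosh R * cosh R)))" by (rule sum_bounded_above)
    also have "\<dots> \<le> 3 * (5 * cosh R * (2 * (cosh R * cosh R)))"
      using face_card[OF f(1)] card_Diff1_le[of f i] by (intro mult_right_mono) auto
    finally show ?thesis .
  qed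
  then have "area_rate r i \<le> real (card (faces_at i)) * (3 * (5 * cosh R * (2 * (cosh R * cosh R))))"
    unfolding area_rate_def by (intro sum_bounded_above) (auto simp: faces_at_def)
  also have "\<dots> \<le> real (card F) * (3 * (5 * cosh R * (2 * (cosh R * cosh R))))"
    by (intro mult_right_mono) (auto simp: faces_at_def intro!: card_mono)
  finally show "area_rate r i \<le> real (card F) * (3 * (5 * cosh R * (2 * (cosh R * cosh R))))" .
qed

text \<open>
  \<open>cosh l\<^sub>i\<^sub>j \<ge> cosh r\<^sub>i\<close> for every edge at \<open>i\<close>.
\<close>

lemma area_rate_lower:
  assumes "0 \<le> R" "R \<le> r $ i"
  shows "(cosh R - 1) * (\<Sum>j\<in>UNIV. edge_coupling r i j) \<le> area_rate r i"
proof -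
  have "(\<Sum>j\<in>UNIV. edge_coupling r i j * (cosh R - 1)) \<le> area_rate r i"
    unfolding sum_edge_coupling area_rate_def
  proof (intro sum_mono mult_left_mono)
    fix f j assume fj: "f \<in> faces_at i" "j \<in> f - {i}"
    then have f: "f \<in> F" "i \<in> f" "j \<in> f" "i \<noteq> j" by (auto simp: faces_at_def)
    have pos: "0 < r $ l" for l using r by (simp add: circle_packing_metric_def)
    have "cosh R * 1 \<le> cosh (r $ i) * cosh (r $ j)"
      using assms less_imp_le[OF pos] by (intro mult_mono) (auto simp: cosh_real_nonneg_le_iff cosh_real_ge_1)
    also have "\<dots> \<le> edge_cosh r i j"
      unfolding edge_cosh_def using weight_bounds[OF f] pos by (intro link_cosh_ge) auto
    finally show "cosh R - 1 \<le> edge_cosh r i j - 1" by simp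
    show "0 \<le> face_coupling r f i j" by (rule face_coupling_bounds(1)[OF r f])
  qed
  then show ?thesis by (simp add: sum_distrib_left mult.commute)
qed

lemma curvature_eq: "curvature F \<Phi> r i = total_curvature r i"
proof -
  have "(\<Sum>f\<in>{f \<in> F. i \<in> f}. inner_angle \<Phi> r f i) = (\<Sum>f\<in>{f \<in> F. i \<in> f}. angle r f i)"
    by (rule sum.cong[OF refl]) (auto intro: inner_angle_eq[OF r])
  then show ?thesis unfolding curvature_def total_curvature_def faces_at_def by (simp only:)
qed

end

definition set_radius :: "real^'v \<Rightarrow> 'v \<Rightarrow> real \<Rightarrow> real^'v" where
  "set_radius r j s = (\<chi> v. if v = j then s else r $ v)"

lemma set_radius_packing: "circle_packing_metric r \<Longrightarrow> s > 0 \<Longrightarrow> circle_packing_metric (set_radius r j s)"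
  by (simp add: circle_packing_metric_def set_radius_def)

lemma set_radius_self: "set_radius r j (r $ j) = r"
  by (simp add: set_radius_def vec_eq_iff)

text \<open>
  The definite descriptions are evaluated for positive radii only; as a derivative is local, it may be
  computed from any formula that holds for these.
\<close>

lemma partial_deriv_eqI:
  assumes r: "circle_packing_metric r"
    and eq: "\<And>r. circle_packing_metric r \<Longrightarrow> g r = h r"
    and d: "((\<lambda>s. h (set_radius r j s)) has_real_derivative D) (at (r $ j))"
  shows "partial_deriv j g r = D"
proof -
  have "\<forall>\<^sub>F s in nhds (r $ j). s > 0"
    using r by (intro order_tendstoD(1)[OF filterlim_ident]) (simp add: circle_packing_metric_def)
  then have "\<forall>\<^sub>F s in nhds (r $ j). g (set_radius r j s) = h (set_radius r j s)"
    by eventually_elim (rule eq[OF set_radius_packing[OF r]])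
  then have "((\<lambda>s. g (set_radius r j s)) has_real_derivative D) (at (r $ j))"
    using d by (subst DERIV_cong_ev[OF refl _ refl])
  then show ?thesis unfolding partial_deriv_def set_radius_def by (rule DERIV_imp_deriv)
qed

lemma angle_partial_derivative:
  assumes r: "circle_packing_metric r" and f: "f \<in> F" "i \<in> f"
  shows "((\<lambda>s. angle (set_radius r j s) f i) has_real_derivative
    (\<Sum>l\<in>f - {i}. face_coupling r f i l * ((if l = j then 1 else 0) - edge_cosh r i l * (if i = j then 1 else 0)))
      / sinh (r $ j)) (at (r $ j))"
proof -
  define v :: "real^'v" where "v = (\<chi> l. if l = j then 1 / sinh (r $ j) else 0)"
  have pj: "r $ j > 0" using r by (simp add: circle_packing_metric_def)
  have "((\<lambda>s. set_radius r j s $ l) has_real_derivative sinh (set_radius r j (r $ j) $ l) * v $ l) (at (r $ j))" for l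
    using pj by (cases "l = j") (simp_all add: set_radius_def v_def)
  then have "((\<lambda>s. angle (set_radius r j s) f i) has_real_derivative
     (\<Sum>l\<in>f - {i}. face_coupling r f i l * (v $ l - edge_cosh r i l * v $ i))) (at (r $ j))"
    using angle_derivative[of "set_radius r j" "r $ j" v UNIV f i] r f by (simp add: set_radius_self)
  also have "(\<Sum>l\<in>f - {i}. face_coupling r f i l * (v $ l - edge_cosh r i l * v $ i))
    = (\<Sum>l\<in>f - {i}. face_coupling r f i l * ((if l = j then 1 else 0) - edge_cosh r i l * (if i = j then 1 else 0)))
      / sinh (r $ j)"
    unfolding sum_divide_distrib by (intro sum.cong refl) (auto simp: v_def diff_divide_distrib right_diff_distrib)
  finally show ?thesis .
qed

lemma coeff_B_eq:
  assumes r: "circle_packing_metric r" and ij: "i \<noteq> j"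
  shows "coeff_B F \<Phi> r i j = edge_coupling r i j"
proof -
  have pj: "sinh (r $ j) > 0" using r by (simp add: circle_packing_metric_def)
  have "partial_deriv j (\<lambda>r. \<Sum>f\<in>{f \<in> F. {i, j} \<subseteq> f}. inner_angle \<Phi> r f i) r
    = (\<Sum>f\<in>{f \<in> F. {i, j} \<subseteq> f}. face_coupling r f i j / sinh (r $ j))"
  proof (rule partial_deriv_eqI[OF r])
    fix r :: "real^'v" assume "circle_packing_metric r"
    then show "(\<Sum>f\<in>{f \<in> F. {i, j} \<subseteq> f}. inner_angle \<Phi> r f i) = (\<Sum>f\<in>{f \<in> F. {i, j} \<subseteq> f}. angle r f i)"
      by (intro sum.cong refl) (simp add: inner_angle_eq)
  next
    show "((\<lambda>s. \<Sum>f\<in>{f \<in> F. {i, j} \<subseteq> f}. angle (set_radius r j s) f i) has_real_derivative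
        (\<Sum>f\<in>{f \<in> F. {i, j} \<subseteq> f}. face_coupling r f i j / sinh (r $ j))) (at (r $ j))"
    proof (rule DERIV_sum)
      fix f assume "f \<in> {f \<in> F. {i, j} \<subseteq> f}"
      then have f: "f \<in> F" "i \<in> f" "j \<in> f - {i}" using ij by auto
      have "(\<Sum>l\<in>f - {i}. face_coupling r f i l * ((if l = j then 1 else 0) - edge_cosh r i l * (if i = j then 1 else 0)))
        = (\<Sum>l\<in>f - {i}. if l = j then face_coupling r f i l else 0)"
        using ij by (intro sum.cong) auto
      also have "\<dots> = face_coupling r f i j" using f by (simp add: sum.delta)
      finally show "((\<lambda>s. angle (set_radius r j s) f i) has_real_derivative face_coupling r f i j / sinh (r $ j)) (at (r $ j))"
        using angle_partial_derivative[OF r f(1,2), of j] by simp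
    qed
  qed
  then show ?thesis using pj ij by (simp add: coeff_B_def edge_coupling_def sum_distrib_right)
qed

text \<open>
  By \<open>face_area_eq\<close> the derivative of the area is minus that of the sum of the angles: the angle
  at \<open>i\<close> contributes the couplings times \<open>cosh l\<^sub>i\<^sub>j\<close>, the angle at another vertex \<open>l\<close> of the face
  the coupling of \<open>l\<close> and \<open>i\<close>, with the opposite sign.
\<close>

lemma coeff_A_eq:
  assumes r: "circle_packing_metric r"
  shows "coeff_A F \<Phi> r i = area_rate r i"
proof -
  have pi: "sinh (r $ i) > 0" using r by (simp add: circle_packing_metric_def)
  have "partial_deriv i (\<lambda>r. \<Sum>f\<in>{f \<in> F. i \<in> f}. face_area \<Phi> r f) r
    = (\<Sum>f\<in>faces_at i. (\<Sum>j\<in>f - {i}. face_coupling r f i j * (edge_cosh r i j - 1)) / sinh (r $ i))"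
  proof (rule partial_deriv_eqI[OF r])
    fix r :: "real^'v" assume "circle_packing_metric r"
    then show "(\<Sum>f\<in>{f \<in> F. i \<in> f}. face_area \<Phi> r f) = (\<Sum>f\<in>faces_at i. pi - (\<Sum>l\<in>f. angle r f l))"
      unfolding faces_at_def by (intro sum.cong refl) (simp add: face_area_eq)
  next
    show "((\<lambda>s. \<Sum>f\<in>faces_at i. pi - (\<Sum>l\<in>f. angle (set_radius r i s) f l)) has_real_derivative
        (\<Sum>f\<in>faces_at i. (\<Sum>j\<in>f - {i}. face_coupling r f i j * (edge_cosh r i j - 1)) / sinh (r $ i))) (at (r $ i))"
    proof (rule DERIV_sum)
      fix f assume "f \<in> faces_at i"
      then have f: "f \<in> F" "i \<in> f" by (auto simp: faces_at_def)
      let ?d = "\<lambda>l. \<Sum>k\<in>f - {l}. face_coupling r f l k * ((if k = i then 1 else 0) - edge_cosh r l k * (if l = i then 1 else 0))"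
      have "((\<lambda>s. pi - (\<Sum>l\<in>f. angle (set_radius r i s) f l)) has_real_derivative 0 - (\<Sum>l\<in>f. ?d l / sinh (r $ i))) (at (r $ i))"
        by (intro DERIV_diff DERIV_const DERIV_sum angle_partial_derivative[OF r f(1)])
      moreover have "0 - (\<Sum>l\<in>f. ?d l / sinh (r $ i)) = (\<Sum>j\<in>f - {i}. face_coupling r f i j * (edge_cosh r i j - 1)) / sinh (r $ i)"
      proof -
        have at_i: "?d i = (\<Sum>j\<in>f - {i}. - (face_coupling r f i j * edge_cosh r i j))"
          by (intro sum.cong) auto
        have off_i: "?d l = face_coupling r f i l" if "l \<in> f - {i}" for l
        proof -
          have "?d l = (\<Sum>k\<in>f - {l}. if k = i then face_coupling r f l k else 0)"
            using that by (intro sum.cong) auto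
          also have "\<dots> = face_coupling r f l i" using that f by (auto simp: sum.delta)
          finally show ?thesis by (simp add: face_coupling_commute)
        qed
        have "(\<Sum>l\<in>f. ?d l) = ?d i + (\<Sum>l\<in>f - {i}. ?d l)" by (rule sum.remove) (use f in auto)
        also have "(\<Sum>l\<in>f - {i}. ?d l) = (\<Sum>l\<in>f - {i}. face_coupling r f i l)"
          by (rule sum.cong[OF refl off_i])
        also note at_i
        also have "(\<Sum>j\<in>f - {i}. - (face_coupling r f i j * edge_cosh r i j)) + (\<Sum>l\<in>f - {i}. face_coupling r f i l)
            = - (\<Sum>j\<in>f - {i}. face_coupling r f i j * (edge_cosh r i j - 1))"
          unfolding sum.distrib[symmetric] sum_negf[symmetric] by (intro sum.cong) (auto simp: algebra_simps)
        finally show ?thesis by (simp add: sum_divide_distrib[symmetric])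
      qed
      ultimately show "((\<lambda>s. pi - (\<Sum>l\<in>f. angle (set_radius r i s) f l)) has_real_derivative
        (\<Sum>j\<in>f - {i}. face_coupling r f i j * (edge_cosh r i j - 1)) / sinh (r $ i)) (at (r $ i))" by simp
    qed
  qed
  then have "partial_deriv i (\<lambda>r. \<Sum>f\<in>{f \<in> F. i \<in> f}. face_area \<Phi> r f) r = area_rate r i / sinh (r $ i)"
    by (simp only: sum_divide_distrib[symmetric] area_rate_def)
  then show ?thesis using pi by (simp add: coeff_A_def)
qed

text \<open>
  The right-hand side of the flow in the coordinates \<open>u\<close>; see \<open>calabi_field_eq\<close>.
\<close>

definition log_velocity :: "real \<Rightarrow> real^'v \<Rightarrow> real^'v" where
  "log_velocity p u = (\<chi> i. (\<Sum>j\<in>UNIV. edge_coupling (radii u) i j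
      * signed_power p (total_curvature (radii u) j - total_curvature (radii u) i))
    - area_rate (radii u) i * total_curvature (radii u) i)"

lemma calabi_field_eq:
  assumes r: "circle_packing_metric r"
  shows "calabi_field F \<Phi> p r $ i = log_velocity p (logs r) $ i * sinh (r $ i)"
proof -
  have "p_laplace F \<Phi> p r (curvature F \<Phi> r) i
    = (\<Sum>j\<in>{j. {i, j} \<in> edges F}. edge_coupling r i j * signed_power p (total_curvature r j - total_curvature r i))"
    unfolding p_laplace_def signed_power_def
  proof (rule sum.cong[OF refl])
    fix j assume "j \<in> {j. {i, j} \<in> edges F}"
    then have "i \<noteq> j" by (auto simp: edges_def)
    then show "coeff_B F \<Phi> r i j * (\<bar>curvature F \<Phi> r j - curvature F \<Phi> r i\<bar> powr (p - 2) * (curvature F \<Phi> r j - curvature F \<Phi> r i))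
      = edge_coupling r i j * (\<bar>total_curvature r j - total_curvature r i\<bar> powr (p - 2) * (total_curvature r j - total_curvature r i))"
      by (simp add: coeff_B_eq[OF r] curvature_eq[OF r])
  qed
  also have "\<dots> = (\<Sum>j\<in>UNIV. edge_coupling r i j * signed_power p (total_curvature r j - total_curvature r i))"
  proof (rule sum.mono_neutral_left)
    show "\<forall>j\<in>UNIV - {j. {i, j} \<in> edges F}. edge_coupling r i j * signed_power p (total_curvature r j - total_curvature r i) = 0"
    proof
      fix j assume j: "j \<in> UNIV - {j. {i, j} \<in> edges F}"
      have "edge_coupling r i j = 0"
      proof (cases "i = j")
        case False
        then have "{f \<in> F. {i, j} \<subseteq> f} = {}" using j by (auto simp: edges_def)
        then show ?thesis by (simp only: edge_coupling_def sum.empty if_cancel)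
      qed (simp add: edge_coupling_def)
      then show "edge_coupling r i j * signed_power p (total_curvature r j - total_curvature r i) = 0" by simp
    qed
  qed auto
  finally show ?thesis
    by (simp add: calabi_field_def log_velocity_def radii_logs[OF r] coeff_A_eq[OF r] curvature_eq[OF r])
qed

lemma radii_curve_derivative:
  assumes "(c has_vector_derivative v) (at t within S)" "c t \<in> negative_orthant"
  shows "((\<lambda>t. radii (c t) $ j) has_real_derivative sinh (radii (c t) $ j) * v $ j) (at t within S)"
proof -
  have "((\<lambda>t. c t $ j) has_real_derivative v $ j) (at t within S)"
    using assms(1) by (simp add: has_vector_derivative_vec_iff)
  moreover have "(radius_of_log has_real_derivative sinh (radius_of_log (c t $ j))) (at (c t $ j))"
    using assms(2) by (intro radius_of_log_derivative) (simp add: negative_orthant_def)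
  ultimately show ?thesis unfolding radii_def vec_lambda_beta by (rule DERIV_chain2[rotated])
qed

lemma logs_curve_derivative:
  assumes "(c has_vector_derivative v) (at t within S)" "circle_packing_metric (c t)"
  shows "((\<lambda>t. logs (c t) $ j) has_real_derivative v $ j / sinh (c t $ j)) (at t within S)"
proof -
  have "((\<lambda>t. c t $ j) has_real_derivative v $ j) (at t within S)"
    using assms(1) by (simp add: has_vector_derivative_vec_iff)
  moreover have "(log_of_radius has_real_derivative 1 / sinh (c t $ j)) (at (c t $ j))"
    using assms(2) by (intro log_of_radius_derivative) (simp add: circle_packing_metric_def)
  ultimately have "((\<lambda>t. log_of_radius (c t $ j)) has_real_derivative 1 / sinh (c t $ j) * v $ j) (at t within S)"
    by (rule DERIV_chain2[rotated])
  then show ?thesis by (simp add: logs_def)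
qed

lemma flow_of_integral_curve:
  assumes "integral_curve_on (log_velocity p) J x" "\<And>t. t \<in> J \<Longrightarrow> x t \<in> negative_orthant"
  shows "calabi_flow_on J F \<Phi> p (\<lambda>t. radii (x t))"
  unfolding calabi_flow_on_def has_vector_derivative_vec_iff
proof (intro ballI conjI allI)
  fix t i assume t: "t \<in> J"
  show pk: "circle_packing_metric (radii (x t))" by (rule radii_packing[OF assms(2)[OF t]])
  have "(x has_vector_derivative log_velocity p (x t)) (at t within J)"
    using assms(1) t by (simp add: integral_curve_on_def)
  from radii_curve_derivative[OF this assms(2)[OF t], of i]
  show "((\<lambda>t. radii (x t) $ i) has_real_derivative calabi_field F \<Phi> p (radii (x t)) $ i) (at t within J)"
    by (simp add: calabi_field_eq[OF pk] logs_radii[OF assms(2)[OF t]] mult.commute)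
qed

lemma integral_curve_of_flow:
  assumes "calabi_flow_on J F \<Phi> p r"
  shows "integral_curve_on (log_velocity p) J (\<lambda>t. logs (r t))" "\<And>t. t \<in> J \<Longrightarrow> logs (r t) \<in> negative_orthant"
proof -
  have pk: "circle_packing_metric (r t)" if "t \<in> J" for t using assms that by (simp add: calabi_flow_on_def)
  then show "logs (r t) \<in> negative_orthant" if "t \<in> J" for t using logs_negative that by blast
  show "integral_curve_on (log_velocity p) J (\<lambda>t. logs (r t))"
    unfolding integral_curve_on_def has_vector_derivative_vec_iff
  proof (intro ballI allI)
    fix t i assume t: "t \<in> J"
    have "(r has_vector_derivative calabi_field F \<Phi> p (r t)) (at t within J)"
      using assms t by (simp add: calabi_flow_on_def)
    note d = logs_curve_derivative[OF this pk[OF t], of i]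
    show "((\<lambda>t. logs (r t) $ i) has_real_derivative log_velocity p (logs (r t)) $ i) (at t within J)"
    proof -
      have "sinh (r t $ i) > 0" using pk[OF t] by (simp add: circle_packing_metric_def)
      then show ?thesis using d by (simp add: calabi_field_eq[OF pk[OF t]])
    qed
  qed
qed

text \<open>
  If \<open>r\<^sub>i \<ge> R\<close>, each of the at most \<open>n\<close> angles at \<open>i\<close> is at most \<open>pi / n\<close>, hence \<open>K\<^sub>i \<ge> pi\<close>. As
  \<open>K\<^sub>j \<le> 2 pi\<close>, the flux along each edge is at most \<open>B\<^sub>i\<^sub>j\<close> times \<open>pi powr (p - 1)\<close>, whereas
  \<open>A\<^sub>i K\<^sub>i \<ge> (cosh R - 1) pi (\<Sum>j. B\<^sub>i\<^sub>j)\<close>.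
\<close>

lemma large_circle_shrinks:
  assumes p: "p > 1"
  shows "\<exists>b<0. \<forall>u\<in>negative_orthant. \<forall>i. b \<le> u $ i \<longrightarrow> log_velocity p u $ i \<le> 0"
proof -
  define n where "n = real (card F)"
  have "F \<noteq> {}" using cover by auto
  then have n: "n \<ge> 1" by (simp add: n_def Suc_le_eq card_gt_0_iff)
  have cn: "cos (pi / n) < 1"
    using n pi_gt_zero cos_monotone_0_pi[of 0 "pi / n"] by (simp add: divide_le_eq)
  \<comment> \<open>The three summands ensure \<open>R > 0\<close>, that \<open>A\<^sub>i K\<^sub>i\<close> exceeds the flux, and that the angles are at most \<open>pi / n\<close>.\<close>
  define C where "C = 2 + pi powr (p - 1) / pi + 2 / (1 - cos (pi / n))"
  define R where "R = arcosh C"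
  have C: "C \<ge> 2" "C - 1 \<ge> pi powr (p - 1) / pi" "C - 1 \<ge> 2 / (1 - cos (pi / n))"
    using cn by (simp_all add: C_def)
  have R: "R > 0" "cosh R = C" using C(1) by (simp_all add: R_def)
  have "(C - 1) * 1 \<le> (C - 1) * (C + 1)" using C(1) by (intro mult_left_mono) auto
  then have "2 / (1 - cos (pi / n)) \<le> C\<^sup>2 - 1" using C(3) by (simp add: power2_eq_square algebra_simps)
  then have shR: "2 / (1 - cos (pi / n)) \<le> (sinh R)\<^sup>2" using R(2) by (simp add: sinh_square_eq)
  have "log_velocity p u $ i \<le> 0" if u: "u \<in> negative_orthant" and i: "log_of_radius R \<le> u $ i" for u i
  proof -
    define r where "r = radii u"
    have r: "circle_packing_metric r" using radii_packing[OF u] by (simp add: r_def)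
    have "radius_of_log (log_of_radius R) \<le> r $ i"
      using radius_of_log_mono[OF i] u by (simp add: r_def radii_def negative_orthant_def)
    then have ri: "R \<le> r $ i" using R(1) by (simp add: radius_of_log_inverse)
    have "angle r f i \<le> pi / n" if f: "f \<in> faces_at i" for f
    proof -
      have f: "f \<in> F" "i \<in> f" using f by (auto simp: faces_at_def)
      have "(sinh R)\<^sup>2 \<le> (sinh (r $ i))\<^sup>2" using R(1) ri by (intro power_mono) auto
      then have "2 / (1 - cos (pi / n)) \<le> (sinh (r $ i))\<^sup>2" using shR by linarith
      moreover have "(sinh (r $ i))\<^sup>2 > 0" using R(1) ri by simp
      ultimately have "2 / (sinh (r $ i))\<^sup>2 \<le> 1 - cos (pi / n)"
        using cn by (simp add: divide_le_eq mult.commute)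
      then have "cos (pi / n) \<le> cos (angle r f i)" using angle_bounds(3)[OF r f] by linarith
      moreover have "pi / n \<le> pi" using n by (simp add: divide_le_eq)
      ultimately show ?thesis
        using angle_bounds(1,2)[OF r f] n by (subst (asm) cos_mono_le_eq) (auto simp: less_imp_le)
    qed
    then have "(\<Sum>f\<in>faces_at i. angle r f i) \<le> real (card (faces_at i)) * (pi / n)" by (rule sum_bounded_above)
    also have "\<dots> \<le> n * (pi / n)"
      using n by (intro mult_right_mono) (auto simp: faces_at_def n_def intro!: card_mono)
    also have "\<dots> = pi" using n by simp
    finally have Ki: "total_curvature r i \<ge> pi" by (simp add: total_curvature_def)
    have flux: "signed_power p (total_curvature r j - total_curvature r i) \<le> pi powr (p - 1)" for j
    proof (cases "total_curvature r j \<le> total_curvature r i")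
      case True
      then have "signed_power p (total_curvature r j - total_curvature r i) \<le> 0"
        by (simp add: signed_power_def mult_nonneg_nonpos)
      then show ?thesis by (rule order_trans) simp
    next
      case False
      have "signed_power p (total_curvature r j - total_curvature r i) \<le> \<bar>total_curvature r j - total_curvature r i\<bar> powr (p - 1)"
        by (simp flip: abs_signed_power)
      also have "\<dots> \<le> pi powr (p - 1)"
        using False Ki total_curvature_bounds(1)[OF r, of j] p by (intro powr_mono2) auto
      finally show ?thesis .
    qed
    let ?b = "\<Sum>j\<in>UNIV. edge_coupling r i j"
    have b0: "?b \<ge> 0" by (intro sum_nonneg edge_coupling_nonneg[OF r])
    have "(\<Sum>j\<in>UNIV. edge_coupling r i j * signed_power p (total_curvature r j - total_curvature r i)) \<le> ?b * pi powr (p - 1)"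
      unfolding sum_distrib_right by (intro sum_mono mult_left_mono flux edge_coupling_nonneg[OF r])
    also have "\<dots> \<le> ?b * ((C - 1) * pi)"
      using C(2) b0 by (intro mult_left_mono) (auto simp: divide_le_eq)
    also have "\<dots> = (C - 1) * ?b * pi" by simp
    also have "\<dots> \<le> area_rate r i * total_curvature r i"
      using area_rate_lower[OF r _ ri] R Ki area_rate_pos[OF r, of i] by (intro mult_mono) auto
    finally show ?thesis by (simp add: log_velocity_def r_def[symmetric])
  qed
  then show ?thesis using log_of_radius_neg[OF R(1)] by blast
qed

text \<open>
  Radii that are bounded above bound the couplings, hence \<open>A\<close> and \<open>B\<close>; the curvatures are bounded
  because there are finitely many faces.
\<close>

lemma log_velocity_bounded:
  assumes b: "b < 0" and p: "p > 1"
  shows "\<exists>M. \<forall>u. (\<forall>i. u $ i \<le> b) \<longrightarrow> (\<forall>i. \<bar>log_velocity p u $ i\<bar> \<le> M)"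
proof -
  define R where "R = radius_of_log b"
  \<comment> \<open>A bound for the absolute value of the curvatures.\<close>
  define Q where "Q = 2 * pi + real (card F) * pi"
  define M where "M = real CARD('v) * (real (card F) * (5 * cosh R) * (2 * Q) powr (p - 1))
    + real (card F) * (3 * (5 * cosh R * (2 * (cosh R * cosh R)))) * Q"
  have "\<bar>log_velocity p u $ i\<bar> \<le> M" if u: "\<forall>i. u $ i \<le> b" for u i
  proof -
    have neg: "u \<in> negative_orthant" using u b by (auto simp: negative_orthant_def intro: le_less_trans)
    define r where "r = radii u"
    have r: "circle_packing_metric r" using radii_packing[OF neg] by (simp add: r_def)
    have rR: "r $ l \<le> R" for l
      using radius_of_log_mono[of "u $ l" b] u b by (simp add: r_def radii_def R_def)
    have K: "\<bar>total_curvature r l\<bar> \<le> Q" for l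
    proof -
      have "0 \<le> real (card F) * pi" by simp
      then show ?thesis
        using total_curvature_bounds[OF r, of l] pi_gt_zero unfolding Q_def by (intro abs_leI) linarith+
    qed
    have flux: "\<bar>edge_coupling r i j * signed_power p (total_curvature r j - total_curvature r i)\<bar>
        \<le> real (card F) * (5 * cosh R) * (2 * Q) powr (p - 1)" for j
      unfolding abs_mult
    proof (rule mult_mono)
      show "\<bar>edge_coupling r i j\<bar> \<le> real (card F) * (5 * cosh R)"
        using coefficient_bounds(1)[OF r rR] edge_coupling_nonneg[OF r] by simp
      have "\<bar>total_curvature r j - total_curvature r i\<bar> \<le> 2 * Q" using K[of i] K[of j] by linarith
      then show "\<bar>signed_power p (total_curvature r j - total_curvature r i)\<bar> \<le> (2 * Q) powr (p - 1)"
        unfolding abs_signed_power using p by (intro powr_mono2) auto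
    qed auto
    have "\<bar>log_velocity p u $ i\<bar>
      \<le> \<bar>\<Sum>j\<in>UNIV. edge_coupling r i j * signed_power p (total_curvature r j - total_curvature r i)\<bar>
        + \<bar>area_rate r i * total_curvature r i\<bar>"
      unfolding log_velocity_def r_def[symmetric] by (simp add: abs_triangle_ineq4)
    also have "\<dots> \<le> M" unfolding M_def
    proof (rule add_mono)
      have "\<bar>\<Sum>j\<in>UNIV. edge_coupling r i j * signed_power p (total_curvature r j - total_curvature r i)\<bar>
        \<le> (\<Sum>j\<in>(UNIV :: 'v set). real (card F) * (5 * cosh R) * (2 * Q) powr (p - 1))"
        by (rule order_trans[OF sum_abs sum_mono[OF flux]])
      then show "\<bar>\<Sum>j\<in>UNIV. edge_coupling r i j * signed_power p (total_curvature r j - total_curvature r i)\<bar>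
        \<le> real CARD('v) * (real (card F) * (5 * cosh R) * (2 * Q) powr (p - 1))" by simp
      show "\<bar>area_rate r i * total_curvature r i\<bar> \<le> real (card F) * (3 * (5 * cosh R * (2 * (cosh R * cosh R)))) * Q"
        unfolding abs_mult
        using coefficient_bounds(2)[OF r rR, of i] area_rate_pos[OF r, of i] K by (intro mult_mono) auto
    qed
    finally show ?thesis .
  qed
  then show ?thesis by blast
qed

lemma calabi_curvature_flow:
  assumes p: "p > 1"
  shows "curvature_flow (\<lambda>u. total_curvature (radii u)) (\<lambda>u. area_rate (radii u))
    (\<lambda>u. edge_coupling (radii u)) p (log_velocity p)"
proof
  have pk: "radii ` negative_orthant \<subseteq> {r :: real^'v. circle_packing_metric r}" using radii_packing by auto
  note comp = continuous_on_compose2[OF _ continuous_on_radii pk]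
  have edge: "continuous_on {r. circle_packing_metric r} (\<lambda>r. edge_cosh r i j)" for i j
    unfolding edge_cosh_def by (intro continuous_on_link_cosh continuous_intros)
  show "continuous_on negative_orthant (\<lambda>u. total_curvature (radii u) i)" for i
    unfolding total_curvature_def
    by (rule comp) (intro continuous_intros continuous_on_angle; simp add: faces_at_def)
  show "continuous_on negative_orthant (\<lambda>u. area_rate (radii u) i)" for i
    unfolding area_rate_def
    by (rule comp) (intro continuous_intros continuous_on_face_coupling edge; auto simp: faces_at_def)
  show "continuous_on negative_orthant (\<lambda>u. edge_coupling (radii u) i j)" for i j
  proof (cases "i = j")
    case False
    have "continuous_on negative_orthant (\<lambda>u. \<Sum>f\<in>{f \<in> F. {i, j} \<subseteq> f}. face_coupling (radii u) f i j)"
      by (rule comp) (intro continuous_intros continuous_on_face_coupling; use False in auto)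
    then show ?thesis using False by (simp add: edge_coupling_def)
  qed (simp add: edge_coupling_def)
  show "((\<lambda>t. total_curvature (radii (c t)) i) has_real_derivative area_rate (radii (c t)) i * v $ i +
      (\<Sum>j\<in>UNIV. edge_coupling (radii (c t)) i j * (v $ i - v $ j))) (at t within S)"
    if "(c has_vector_derivative v) (at t within S)" "c t \<in> negative_orthant" for c v t S i
    by (rule total_curvature_derivative[OF radii_curve_derivative[OF that] radii_packing[OF that(2)]])
  show "\<exists>M. \<forall>u. (\<forall>i. u $ i \<le> b) \<longrightarrow> (\<forall>i. \<bar>log_velocity p u $ i\<bar> \<le> M)" if "b < 0" for b
    by (rule log_velocity_bounded[OF that p])
  show "area_rate (radii u) i > 0" if "u \<in> negative_orthant" for u i
    by (rule area_rate_pos[OF radii_packing[OF that]])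
  show "edge_coupling (radii u) i j \<ge> 0" if "u \<in> negative_orthant" for u i j
    by (rule edge_coupling_nonneg[OF radii_packing[OF that]])
  show "edge_coupling (radii u) i j = edge_coupling (radii u) j i" for u i j
    by (rule edge_coupling_commute)
  show "\<exists>b<0. \<forall>u\<in>negative_orthant. \<forall>i. b \<le> u $ i \<longrightarrow> log_velocity p u $ i \<le> 0"
    by (rule large_circle_shrinks[OF p])
qed (simp_all add: p log_velocity_def)

text \<open>
  The results of \<open>curvature_flow\<close>, carried over to the radii by the homeomorphism \<open>radii\<close>
  from the negative orthant to the circle packing metrics.
\<close>

theorem calabi_flow_behaviour:
  assumes p: "p > 1" and r0: "circle_packing_metric r0"
  shows "\<exists>r. calabi_flow_on {0..} F \<Phi> p r \<and> r 0 = r0"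
    and "\<And>T s. T > 0 \<Longrightarrow> calabi_flow_on {0..<T} F \<Phi> p s \<Longrightarrow>
       \<exists>r. calabi_flow_on {0..} F \<Phi> p r \<and> (\<forall>t\<in>{0..<T}. r t = s t)"
    and "\<And>r. calabi_flow_on {0..} F \<Phi> p r \<Longrightarrow>
      (\<exists>r'. circle_packing_metric r' \<and> (r \<longlongrightarrow> r') at_top) \<longleftrightarrow> (\<exists>rze. zero_curvature_metric F \<Phi> rze)"
proof -
  interpret flow: curvature_flow "\<lambda>u. total_curvature (radii u)" "\<lambda>u. area_rate (radii u)"
    "\<lambda>u. edge_coupling (radii u)" p "log_velocity p"
    by (rule calabi_curvature_flow[OF p])
  obtain x where x: "x 0 = logs r0" "integral_curve_on (log_velocity p) {0..} x"
    "\<And>t. t \<ge> 0 \<Longrightarrow> x t \<in> negative_orthant"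
    using flow.global_existence[OF logs_negative[OF r0]] by blast
  have "calabi_flow_on {0..} F \<Phi> p (\<lambda>t. radii (x t))"
    by (rule flow_of_integral_curve) (use x in auto)
  moreover have "radii (x 0) = r0" using x(1) radii_logs[OF r0] by simp
  ultimately show "\<exists>r. calabi_flow_on {0..} F \<Phi> p r \<and> r 0 = r0" by (intro exI[of _ "\<lambda>t. radii (x t)"]) simp
  show "\<exists>r. calabi_flow_on {0..} F \<Phi> p r \<and> (\<forall>t\<in>{0..<T}. r t = s t)"
    if T: "T > 0" and s: "calabi_flow_on {0..<T} F \<Phi> p s" for T s
  proof -
    obtain y where y: "integral_curve_on (log_velocity p) {0..} y" "\<And>t. t \<ge> 0 \<Longrightarrow> y t \<in> negative_orthant"
      "\<And>t. t \<in> {0..<T} \<Longrightarrow> y t = logs (s t)"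
      using flow.extension_of_local_solutions[OF T integral_curve_of_flow[OF s]] by blast
    have "calabi_flow_on {0..} F \<Phi> p (\<lambda>t. radii (y t))"
      by (rule flow_of_integral_curve) (use y in auto)
    moreover have "radii (y t) = s t" if "t \<in> {0..<T}" for t
    proof -
      have "circle_packing_metric (s t)" using s that unfolding calabi_flow_on_def by blast
      then show ?thesis using y(3)[OF that] by (simp add: radii_logs)
    qed
    ultimately show ?thesis by (intro exI[of _ "\<lambda>t. radii (y t)"]) simp
  qed
  show "(\<exists>r'. circle_packing_metric r' \<and> (r \<longlongrightarrow> r') at_top) \<longleftrightarrow> (\<exists>rze. zero_curvature_metric F \<Phi> rze)"
    if flow: "calabi_flow_on {0..} F \<Phi> p r" for r
  proof
    have curve: "integral_curve_on (log_velocity p) {0..} (\<lambda>t. logs (r t))"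
      and neg: "\<And>t. t \<ge> 0 \<Longrightarrow> logs (r t) \<in> negative_orthant"
      using integral_curve_of_flow[OF flow] by auto
    {
      assume "\<exists>r'. circle_packing_metric r' \<and> (r \<longlongrightarrow> r') at_top"
      then obtain r' where r': "circle_packing_metric r'" "(r \<longlongrightarrow> r') at_top" by blast
      have "total_curvature (radii (logs r')) i = 0" for i
        by (rule flow.limit_is_flat[OF curve neg tendsto_logs[OF r'(2,1)] logs_negative[OF r'(1)]])
      then have "zero_curvature_metric F \<Phi> r'"
        using r'(1) by (simp add: zero_curvature_metric_def curvature_eq radii_logs)
      then show "\<exists>rze. zero_curvature_metric F \<Phi> rze" by blast
    }
    assume "\<exists>rze. zero_curvature_metric F \<Phi> rze"
    then obtain z where z: "circle_packing_metric z" "\<And>i. total_curvature z i = 0"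
      by (auto simp: zero_curvature_metric_def curvature_eq)
    have "((\<lambda>t. logs (r t)) \<longlongrightarrow> logs z) at_top"
      by (rule flow.convergence_to_flat[OF logs_negative[OF z(1)] _ curve neg]) (simp_all add: radii_logs z)
    then have "((\<lambda>t. radii (logs (r t))) \<longlongrightarrow> radii (logs z)) at_top"
      by (rule tendsto_radii[OF _ logs_negative[OF z(1)]])
    then have lim: "((\<lambda>t. radii (logs (r t))) \<longlongrightarrow> z) at_top" by (simp add: radii_logs z(1))
    have "radii (logs (r t)) = r t" if "t \<ge> 0" for t
      using flow that by (intro radii_logs) (auto simp: calabi_flow_on_def)
    then have "\<forall>\<^sub>F t in at_top. radii (logs (r t)) = r t"
      using eventually_ge_at_top[of 0] by (rule eventually_mono[rotated])
    then have "(r \<longlongrightarrow> z) at_top" using lim tendsto_cong by metis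
    then show "\<exists>r'. circle_packing_metric r' \<and> (r \<longlongrightarrow> r') at_top" using z(1) by blast
  qed
qed

end

text \<open>
  A triangulation of a surface has faces with three vertices, which cover all of the vertices; with
  the bounds on the weights these are the data of \<open>weighted_complex\<close>.
\<close>

theorem theorem1p5:
  fixes X :: "'a topology"
    and F :: "'v::finite set set"
    and \<Phi> :: "'v set \<Rightarrow> real"
    and p :: real
    and r0 :: "real^'v"
  assumes "p > 1"
    and "closed_surface X" and "connected_space X"
    and "triangulates F X"
    and "euler_characteristic F < 0"
    and "\<forall>e \<in> edges F. 0 \<le> \<Phi> e \<and> \<Phi> e \<le> pi / 2"
    and "circle_packing_metric r0"
  shows "(\<exists>r. calabi_flow_on {0..} F \<Phi> p r \<and> r 0 = r0) \<and>
    (\<forall>T > 0. \<forall>s. calabi_flow_on {0..<T} F \<Phi> p s \<and> s 0 = r0 \<longrightarrow>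
       (\<exists>r. calabi_flow_on {0..} F \<Phi> p r \<and> (\<forall>t \<in> {0..<T}. r t = s t))) \<and>
    (\<forall>r. calabi_flow_on {0..} F \<Phi> p r \<and> r 0 = r0 \<longrightarrow>
       ((\<exists>r'. circle_packing_metric r' \<and> (r \<longlongrightarrow> r') at_top) \<longleftrightarrow>
        (\<exists>rze. zero_curvature_metric F \<Phi> rze)))"
proof -
  interpret weighted_complex F \<Phi>
    by unfold_locales (use assms in \<open>auto simp: triangulates_def\<close>)
  show ?thesis using calabi_flow_behaviour[OF assms(1,7)] by blast
qed

end
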